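(* Let $G=(G^0,G^1,r,s)$ be a directed graph with countable vertex set and countable edge set, and let $\tilde{G}$ be the graph obtained by adding a head to each vertex of $G$. Then $C^*(\tilde{G})$ is the stabilization of $C^*(G)$; that is, $C^*(\tilde{G})\cong C^*(G)\otimes\mathcal{K}$.
   Context: Graphs: a graph $G=(G^0,G^1,r,s)$ consists of countable sets $G^0$ (vertices) and $G^1$ (edges) and maps $r,s:G^1\to G^0$ (range and source). A vertex $v$ is singular if $s^{-1}(v)$ is empty or infinite. No row-finiteness is assumed. Graph algebra: a Cuntz-Krieger $G$-family consists of mutually orthogonal projections $\{p_v: v\in G^0\}$ and partial isometries $\{s_e: e\in G^1\}$ with mutually orthogonal ranges such that (1) $s_e^*s_e=p_{r(e)}$ for every $e\in G^1$; (2) $s_es_e^*\le p_{s(e)}$ for every $e\in G^1$; (3) $p_v=\sum_{s(e)=v}s_es_e^*$ for every $v\in G^0$ that is not singular. $C^*(G)$ is the $C^*$-algebra generated by a universal Cuntz-Krieger $G$-family. Adding a head to a vertex $v$ means adjoining new distinct vertices $v_1,v_2,\dots$ and new distinct edges $e_1,e_2,\dots$ with $s(e_i)=v_i$ for $i\ge1$, $r(e_1)=v$, and $r(e_i)=v_{i-1}$ for $i\ge2$ (so the attached piece is $\cdots\to v_3\to v_2\to v_1\to v$). In $\tilde{G}$ a separate head (with its own new vertices and edges) is added to each vertex of $G$: $\tilde{G}^0=G^0\sqcup\{v_i: v\in G^0, i\ge1\}$, $\tilde{G}^1=G^1\sqcup\{e^v_i: v\in G^0, i\ge1\}$, with $r,s$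 unchanged on $G^1$, $s(e^v_i)=v_i$, $r(e^v_1)=v$, and $r(e^v_i)=v_{i-1}$ for $i\ge2$. $\mathcal{K}$ denotes the compact operators on a separable infinite-dimensional Hilbert space; the stabilization of a $C^*$-algebra $A$ is $A\otimes\mathcal{K}$. *)

theory Defs
  imports "HOL-Analysis.Analysis" "HOL-Algebra.Ring" "Graph_Theory.Digraph"
begin

section \<open>C*-algebras\<close>

text \<open>
  C*-algebras are carried by a subset of a type. They need not have a unit; the field
  \<^const>\<open>one\<close> inherited from \<^typ>\<open>'a ring\<close> is never used.
\<close>

record 'a cstar = "'a ring" +
  smul :: "complex \<Rightarrow> 'a \<Rightarrow> 'a"
  adj :: "'a \<Rightarrow> 'a"
  nrm :: "'a \<Rightarrow> real"

text \<open>
  The locale \<^locale>\<open>Metric_space\<close> requires nonnegativity and symmetry also outside the carrier.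
\<close>

definition cdist :: "'a cstar \<Rightarrow> 'a \<Rightarrow> 'a \<Rightarrow> real" where
  "cdist A x y = (if x \<in> carrier A \<and> y \<in> carrier A then nrm A (x \<ominus>\<^bsub>A\<^esub> y) else 0)"

abbreviation norm_topology :: "'a cstar \<Rightarrow> 'a topology" where
  "norm_topology A \<equiv> Metric_space.mtopology (carrier A) (cdist A)"

locale cstar_algebra = abelian_group A for A :: "'a cstar" (structure) +
  assumes mult_closed: "x \<in> carrier A \<Longrightarrow> y \<in> carrier A \<Longrightarrow> x \<otimes> y \<in> carrier A"
    and mult_assoc: "x \<in> carrier A \<Longrightarrow> y \<in> carrier A \<Longrightarrow> z \<in> carrier A \<Longrightarrow>
          (x \<otimes> y) \<otimes> z = x \<otimes> (y \<otimes> z)"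
    and distrib_left: "x \<in> carrier A \<Longrightarrow> y \<in> carrier A \<Longrightarrow> z \<in> carrier A \<Longrightarrow>
          z \<otimes> (x \<oplus> y) = z \<otimes> x \<oplus> z \<otimes> y"
    and distrib_right: "x \<in> carrier A \<Longrightarrow> y \<in> carrier A \<Longrightarrow> z \<in> carrier A \<Longrightarrow>
          (x \<oplus> y) \<otimes> z = x \<otimes> z \<oplus> y \<otimes> z"
    and smul_closed: "x \<in> carrier A \<Longrightarrow> smul A c x \<in> carrier A"
    and smul_add_right: "x \<in> carrier A \<Longrightarrow> y \<in> carrier A \<Longrightarrow>
          smul A c (x \<oplus> y) = smul A c x \<oplus> smul A c y"
    and smul_add_left: "x \<in> carrier A \<Longrightarrow> smul A (c + d) x = smul A c x \<oplus> smul A d x"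
    and smul_smul: "x \<in> carrier A \<Longrightarrow> smul A c (smul A d x) = smul A (c * d) x"
    and smul_one: "x \<in> carrier A \<Longrightarrow> smul A 1 x = x"
    and smul_mult_left: "x \<in> carrier A \<Longrightarrow> y \<in> carrier A \<Longrightarrow>
          smul A c x \<otimes> y = smul A c (x \<otimes> y)"
    and smul_mult_right: "x \<in> carrier A \<Longrightarrow> y \<in> carrier A \<Longrightarrow>
          x \<otimes> smul A c y = smul A c (x \<otimes> y)"
    and adj_closed: "x \<in> carrier A \<Longrightarrow> adj A x \<in> carrier A"
    and adj_adj: "x \<in> carrier A \<Longrightarrow> adj A (adj A x) = x"
    and adj_add: "x \<in> carrier A \<Longrightarrow> y \<in> carrier A \<Longrightarrow> adj A (x \<oplus> y) = adj A x \<oplus> adj A y"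
    and adj_smul: "x \<in> carrier A \<Longrightarrow> adj A (smul A c x) = smul A (cnj c) (adj A x)"
    and adj_mult: "x \<in> carrier A \<Longrightarrow> y \<in> carrier A \<Longrightarrow> adj A (x \<otimes> y) = adj A y \<otimes> adj A x"
    and nrm_nonneg: "x \<in> carrier A \<Longrightarrow> 0 \<le> nrm A x"
    and nrm_eq_0: "x \<in> carrier A \<Longrightarrow> nrm A x = 0 \<longleftrightarrow> x = \<zero>"
    and nrm_triangle: "x \<in> carrier A \<Longrightarrow> y \<in> carrier A \<Longrightarrow> nrm A (x \<oplus> y) \<le> nrm A x + nrm A y"
    and nrm_smul: "x \<in> carrier A \<Longrightarrow> nrm A (smul A c x) = cmod c * nrm A x"
    and nrm_mult: "x \<in> carrier A \<Longrightarrow> y \<in> carrier A \<Longrightarrow> nrm A (x \<otimes> y) \<le> nrm A x * nrm A y"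
    and cstar_identity: "x \<in> carrier A \<Longrightarrow> nrm A (adj A x \<otimes> x) = (nrm A x)\<^sup>2"
    and complete: "Metric_space.mcomplete (carrier A) (cdist A)"

definition cstar_hom :: "'a cstar \<Rightarrow> 'b cstar \<Rightarrow> ('a \<Rightarrow> 'b) set" where
  "cstar_hom A B = {\<phi>. \<phi> \<in> carrier A \<rightarrow> carrier B \<and>
     (\<forall>x\<in>carrier A. \<forall>y\<in>carrier A. \<phi> (x \<oplus>\<^bsub>A\<^esub> y) = \<phi> x \<oplus>\<^bsub>B\<^esub> \<phi> y) \<and>
     (\<forall>x\<in>carrier A. \<forall>y\<in>carrier A. \<phi> (x \<otimes>\<^bsub>A\<^esub> y) = \<phi> x \<otimes>\<^bsub>B\<^esub> \<phi> y) \<and>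
     (\<forall>c. \<forall>x\<in>carrier A. \<phi> (smul A c x) = smul B c (\<phi> x)) \<and>
     (\<forall>x\<in>carrier A. \<phi> (adj A x) = adj B (\<phi> x))}"

definition cstar_isomorphic :: "'a cstar \<Rightarrow> 'b cstar \<Rightarrow> bool" (infix \<open>\<cong>\<^sup>*\<close> 50) where
  "A \<cong>\<^sup>* B \<longleftrightarrow> (\<exists>\<phi>\<in>cstar_hom A B. bij_betw \<phi> (carrier A) (carrier B))"

definition cstar_subalgebra :: "'a set \<Rightarrow> 'a cstar \<Rightarrow> bool" where
  "cstar_subalgebra S A \<longleftrightarrow> S \<subseteq> carrier A \<and> \<zero>\<^bsub>A\<^esub> \<in> S \<and>
     (\<forall>x\<in>S. \<forall>y\<in>S. x \<oplus>\<^bsub>A\<^esub> y \<in> S \<and> x \<otimes>\<^bsub>A\<^esub> y \<in> S) \<and>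
     (\<forall>x\<in>S. adj A x \<in> S \<and> (\<forall>c. smul A c x \<in> S)) \<and>
     closedin (norm_topology A) S"

definition cstar_generated :: "'a cstar \<Rightarrow> 'a set \<Rightarrow> 'a set" where
  "cstar_generated A X = \<Inter>{S. cstar_subalgebra S A \<and> X \<subseteq> S}"

definition projection :: "'a cstar \<Rightarrow> 'a \<Rightarrow> bool" where
  "projection A p \<longleftrightarrow> p \<in> carrier A \<and> adj A p = p \<and> p \<otimes>\<^bsub>A\<^esub> p = p"

definition partial_isometry :: "'a cstar \<Rightarrow> 'a \<Rightarrow> bool" where
  "partial_isometry A s \<longleftrightarrow> s \<in> carrier A \<and> s \<otimes>\<^bsub>A\<^esub> adj A s \<otimes>\<^bsub>A\<^esub> s = s"

definition range_proj :: "'a cstar \<Rightarrow> 'a \<Rightarrow> 'a" where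
  "range_proj A s = s \<otimes>\<^bsub>A\<^esub> adj A s"

text \<open>The order on projections: \<open>q \<le> p\<close> iff \<open>q\<close> is a subprojection of \<open>p\<close>.\<close>

definition proj_le :: "'a cstar \<Rightarrow> 'a \<Rightarrow> 'a \<Rightarrow> bool" where
  "proj_le A q p \<longleftrightarrow> p \<otimes>\<^bsub>A\<^esub> q = q"


subsection \<open>Generated subalgebras\<close>

text \<open>
  A C*-subalgebra generated by a countable set has at most continuum many elements, so it has an
  isomorphic copy carried by a set of sets of naturals.
\<close>

context cstar_algebra begin

lemma smul_zero_left: "x \<in> carrier A \<Longrightarrow> smul A 0 x = \<zero>"
  using smul_add_left[of x 0 0] smul_closed[of x 0] by simp

lemma smul_minus_one: "x \<in> carrier A \<Longrightarrow> smul A (-1) x = \<ominus> x"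
  using smul_add_left[of x "-1" 1] smul_closed[of x "-1"]
  by (simp add: smul_one smul_zero_left minus_equality)

lemma nrm_uminus: "x \<in> carrier A \<Longrightarrow> nrm A (\<ominus> x) = nrm A x"
  using nrm_smul[of x "-1"] by (simp add: smul_minus_one)

lemma cdist_eq: "x \<in> carrier A \<Longrightarrow> y \<in> carrier A \<Longrightarrow> cdist A x y = nrm A (x \<ominus> y)"
  by (simp add: cdist_def)

lemma Metric_space_cdist: "Metric_space (carrier A) (cdist A)"
proof
  show "0 \<le> cdist A x y" for x y
    by (simp add: cdist_def nrm_nonneg)
  show "cdist A x y = cdist A y x" for x y
  proof (cases "x \<in> carrier A \<and> y \<in> carrier A")
    case True
    then have "x \<ominus> y = \<ominus> (y \<ominus> x)"
      by (simp add: a_minus_def minus_add a_comm)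
    then show ?thesis
      using True by (simp add: cdist_def nrm_uminus)
  qed (auto simp: cdist_def)
  show "cdist A x y = 0 \<longleftrightarrow> x = y" if "x \<in> carrier A" "y \<in> carrier A" for x y
  proof -
    have "x \<ominus> y \<oplus> y = x"
      using that by (simp add: a_minus_def a_assoc l_neg)
    then show ?thesis
      using that by (auto simp: cdist_def nrm_eq_0 a_minus_def r_neg)
  qed
  show "cdist A x z \<le> cdist A x y + cdist A y z"
    if "x \<in> carrier A" "y \<in> carrier A" "z \<in> carrier A" for x y z
  proof -
    have "x \<ominus> z = (x \<ominus> y) \<oplus> (y \<ominus> z)"
      using that by (simp add: a_minus_def a_assoc r_neg1 r_neg2)
    then show ?thesis
      using that by (simp add: cdist_def nrm_triangle)
  qed
qed

lemma nrm_adj: assumes "x \<in> carrier A" shows "nrm A (adj A x) = nrm A x"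
proof -
  have le: "nrm A y \<le> nrm A (adj A y)" if y: "y \<in> carrier A" for y
  proof -
    have "(nrm A y)\<^sup>2 \<le> nrm A (adj A y) * nrm A y"
      using cstar_identity[OF y] nrm_mult[OF adj_closed[OF y] y] by simp
    then show ?thesis
      using nrm_nonneg[OF y] nrm_nonneg[OF adj_closed[OF y]]
      by (cases "nrm A y = 0") (auto simp: power2_eq_square)
  qed
  show ?thesis
    using le[OF assms] le[OF adj_closed[OF assms]] by (simp add: adj_adj assms)
qed

lemma cdist_add:
  assumes "x \<in> carrier A" "y \<in> carrier A" "x' \<in> carrier A" "y' \<in> carrier A"
  shows "cdist A (x \<oplus> y) (x' \<oplus> y') \<le> cdist A x x' + cdist A y y'"
proof -
  have "(x \<oplus> y) \<ominus> (x' \<oplus> y') = (x \<ominus> x') \<oplus> (y \<ominus> y')"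
    using assms by (simp add: a_minus_def minus_add a_ac)
  then show ?thesis
    using assms by (simp add: cdist_def nrm_triangle)
qed

lemma mult_uminus_right: "x \<in> carrier A \<Longrightarrow> y \<in> carrier A \<Longrightarrow> x \<otimes> \<ominus> y = \<ominus> (x \<otimes> y)"
  using smul_mult_right[of x y "-1"] by (simp add: smul_minus_one mult_closed)

lemma mult_uminus_left: "x \<in> carrier A \<Longrightarrow> y \<in> carrier A \<Longrightarrow> \<ominus> x \<otimes> y = \<ominus> (x \<otimes> y)"
  using smul_mult_left[of x y "-1"] by (simp add: smul_minus_one mult_closed)

lemma cdist_mult:
  assumes "x \<in> carrier A" "y \<in> carrier A" "x' \<in> carrier A" "y' \<in> carrier A"
  shows "cdist A (x \<otimes> y) (x' \<otimes> y') \<le> nrm A x * cdist A y y' + cdist A x x' * nrm A y'"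
proof -
  have "(x \<otimes> y) \<ominus> (x' \<otimes> y') = x \<otimes> (y \<ominus> y') \<oplus> (x \<ominus> x') \<otimes> y'"
    using assms by (simp add: a_minus_def distrib_left distrib_right mult_uminus_left
        mult_uminus_right mult_closed a_assoc r_neg1 r_neg2)
  moreover have "nrm A (x \<otimes> (y \<ominus> y') \<oplus> (x \<ominus> x') \<otimes> y')
      \<le> nrm A (x \<otimes> (y \<ominus> y')) + nrm A ((x \<ominus> x') \<otimes> y')"
    using assms by (simp add: nrm_triangle mult_closed)
  moreover have "nrm A (x \<otimes> (y \<ominus> y')) \<le> nrm A x * nrm A (y \<ominus> y')"
      "nrm A ((x \<ominus> x') \<otimes> y') \<le> nrm A (x \<ominus> x') * nrm A y'"
    using assms by (simp_all add: nrm_mult)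
  ultimately show ?thesis
    using assms by (simp add: cdist_def mult_closed)
qed

lemma cdist_smul:
  assumes "x \<in> carrier A" "x' \<in> carrier A"
  shows "cdist A (smul A c x) (smul A c' x') \<le> cmod c * cdist A x x' + cmod (c - c') * nrm A x'"
proof -
  have m: "\<ominus> smul A d y = smul A (- d) y" if "y \<in> carrier A" for d y
    using smul_smul[OF that, of "-1" d] smul_minus_one[OF smul_closed[OF that]] by simp
  have "smul A c (\<ominus> x') = smul A (- c) x'"
    using assms smul_smul[of x' c "-1"] by (simp add: smul_minus_one)
  then have eq: "smul A c x \<ominus> smul A c' x' = smul A c (x \<ominus> x') \<oplus> smul A (c - c') x'"
    using assms by (simp add: a_minus_def smul_add_right a_assoc smul_closed m flip: smul_add_left)
  have "nrm A (smul A c (x \<ominus> x') \<oplus> smul A (c - c') x')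
      \<le> nrm A (smul A c (x \<ominus> x')) + nrm A (smul A (c - c') x')"
    using assms by (simp add: nrm_triangle smul_closed)
  then show ?thesis
    using assms by (simp add: cdist_def smul_closed eq nrm_smul)
qed

lemma cdist_adj:
  assumes "x \<in> carrier A" "y \<in> carrier A"
  shows "cdist A (adj A x) (adj A y) = cdist A x y"
proof -
  have "adj A (\<ominus> y) = \<ominus> adj A y"
    using assms adj_smul[of y "-1"] by (simp add: smul_minus_one adj_closed)
  then have "adj A x \<ominus> adj A y = adj A (x \<ominus> y)"
    using assms by (simp add: a_minus_def adj_add)
  then show ?thesis
    using assms by (simp add: cdist_def adj_closed nrm_adj)
qed


definition star_step :: "'a set \<Rightarrow> 'a set" where
  "star_step S = S \<union> case_prod (\<oplus>) ` (S \<times> S) \<union> case_prod (\<otimes>) ` (S \<times> S) \<union> adj A ` S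
     \<union> case_prod (smul A) ` ((SOME D. countable D \<and> closure D = UNIV) \<times> S)"

lemma countable_dense_complex:
  "countable (SOME D :: complex set. countable D \<and> closure D = UNIV)"
  "closure (SOME D :: complex set. countable D \<and> closure D = UNIV) = UNIV"
proof -
  have "\<exists>D :: complex set. countable D \<and> closure D = UNIV"
    using separable[of "UNIV :: complex set"] by (metis top.extremum_unique)
  from someI_ex[OF this]
  show "countable (SOME D :: complex set. countable D \<and> closure D = UNIV)"
    "closure (SOME D :: complex set. countable D \<and> closure D = UNIV) = UNIV"
    by blast+
qed

lemma cstar_generated_subset_dense:
  assumes X: "countable X" "X \<subseteq> carrier A"
  obtains S0 where "countable S0" "S0 \<subseteq> carrier A"
    "\<And>x e. x \<in> cstar_generated A X \<Longrightarrow> e > 0 \<Longrightarrow> \<exists>y\<in>S0. cdist A x y < e"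
proof -
  interpret M: Metric_space "carrier A" "cdist A" by (rule Metric_space_cdist)
  define L where "L n = (star_step ^^ n) (insert \<zero> X)" for n :: nat
  define S0 where "S0 = (\<Union>n. L n)"
  have L_Suc: "L (Suc n) = star_step (L n)" for n
    by (simp add: L_def)
  have Lc: "countable (L n)" for n
  proof (induction n)
    case 0
    then show ?case using X by (simp add: L_def)
  next
    case (Suc n)
    then show ?case unfolding L_Suc star_step_def
      by (intro countable_Un countable_image countable_SIGMA countable_dense_complex)
  qed
  have Ls: "L n \<subseteq> carrier A" for n
  proof (induction n)
    case 0
    then show ?case using X by (simp add: L_def)
  next
    case (Suc n)
    then show ?case unfolding L_Suc star_step_def
      by (auto intro!: mult_closed adj_closed smul_closed)
  qed
  have mono: "L m \<subseteq> L n" if "m \<le> n" for m n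
    using that by (rule lift_Suc_mono_le[rotated]) (auto simp: L_Suc star_step_def)
  have S0c: "countable S0" unfolding S0_def using Lc by simp
  have S0s: "S0 \<subseteq> carrier A" unfolding S0_def using Ls by blast
  have add0: "x \<oplus> y \<in> S0" "x \<otimes> y \<in> S0" if xy: "x \<in> S0" "y \<in> S0" for x y
  proof -
    obtain m n where "x \<in> L m" "y \<in> L n" using xy unfolding S0_def by blast
    then have "x \<in> L (max m n)" "y \<in> L (max m n)"
      using mono[of m "max m n"] mono[of n "max m n"] by auto
    then have "x \<oplus> y \<in> L (Suc (max m n))" "x \<otimes> y \<in> L (Suc (max m n))"
      unfolding L_Suc star_step_def by force+
    then show "x \<oplus> y \<in> S0" "x \<otimes> y \<in> S0" by (auto simp: S0_def)
  qed
  have adj0: "adj A x \<in> S0" if x: "x \<in> S0" for x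
  proof -
    obtain m where "x \<in> L m" using x unfolding S0_def by blast
    then have "adj A x \<in> L (Suc m)" unfolding L_Suc star_step_def by blast
    then show ?thesis by (auto simp: S0_def)
  qed
  have smul0: "\<exists>c'. cmod (c - c') < e \<and> (\<forall>x\<in>S0. smul A c' x \<in> S0)" if "e > 0" for c and e :: real
  proof -
    obtain c' where c': "c' \<in> (SOME D :: complex set. countable D \<and> closure D = UNIV)"
      "dist c' c < e"
      using countable_dense_complex(2) \<open>e > 0\<close> closure_approachable by (metis UNIV_I)
    have "smul A c' x \<in> S0" if x: "x \<in> S0" for x
    proof -
      obtain m where "x \<in> L m" using x unfolding S0_def by blast
      then have "smul A c' x \<in> L (Suc m)"
        unfolding L_Suc star_step_def using c'(1) by force
      then show ?thesis by (auto simp: S0_def)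
    qed
    then show ?thesis
      using c'(2) by (auto simp: dist_norm norm_minus_commute)
  qed
  define C where "C = Abstract_Topology.closure_of M.mtopology S0"
  have C_iff: "x \<in> C \<longleftrightarrow> x \<in> carrier A \<and> (\<forall>e>0. \<exists>y\<in>S0. cdist A x y < e)" for x
    unfolding C_def M.metric_closure_of using S0s by (auto simp: subset_iff)
  have S0C: "S0 \<subseteq> C"
    unfolding C_def using S0s by (simp add: closure_of_subset)
  have "cstar_subalgebra C A"
    unfolding cstar_subalgebra_def
  proof (intro conjI ballI allI)
    show "C \<subseteq> carrier A" using C_iff by blast
    have "\<zero> \<in> L 0" by (simp add: L_def)
    then show "\<zero> \<in> C" using S0C by (auto simp: S0_def)
    show "closedin M.mtopology C" by (simp add: C_def)
  next
    fix x y assume xy: "x \<in> C" "y \<in> C"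
    then have c: "x \<in> carrier A" "y \<in> carrier A" by (simp_all add: C_iff)
    show "x \<oplus> y \<in> C" unfolding C_iff
    proof (intro conjI allI impI)
      fix e :: real assume "e > 0"
      then obtain x' y' where *: "x' \<in> S0" "cdist A x x' < e/2" "y' \<in> S0" "cdist A y y' < e/2"
        using xy unfolding C_iff by (meson half_gt_zero)
      then have "cdist A (x \<oplus> y) (x' \<oplus> y') < e"
        using cdist_add[OF c, of x' y'] S0s by force
      then show "\<exists>z\<in>S0. cdist A (x \<oplus> y) z < e" using add0 * by blast
    qed (use c in simp)
    show "x \<otimes> y \<in> C" unfolding C_iff
    proof (intro conjI allI impI)
      fix e :: real assume e: "e > 0"
      define K where "K = nrm A x + nrm A y + 1"
      have K: "K \<ge> 1" using nrm_nonneg c by (simp add: K_def)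
      define d where "d = min 1 (e / (2 * K))"
      have d: "d > 0" "d \<le> 1" "d * K \<le> e / 2"
        using K e by (auto simp: d_def min_def field_simps)
      obtain x' y' where *: "x' \<in> S0" "cdist A x x' < d" "y' \<in> S0" "cdist A y y' < d"
        using xy d(1) unfolding C_iff by meson
      have c': "x' \<in> carrier A" "y' \<in> carrier A" using * S0s by auto
      have "y' = (y' \<ominus> y) \<oplus> y"
        using c c' by (simp add: a_minus_def a_assoc l_neg)
      then have "nrm A y' \<le> nrm A (y' \<ominus> y) + nrm A y"
        using nrm_triangle[of "y' \<ominus> y" y] c c' by simp
      also have "nrm A (y' \<ominus> y) = cdist A y y'"
        using cdist_eq[OF c'(2) c(2)] M.commute[of y y'] by simp
      finally have n: "nrm A y' \<le> K" using *(4) d(2) nrm_nonneg[OF c(1)] by (simp add: K_def)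
      have "cdist A (x \<otimes> y) (x' \<otimes> y') \<le> nrm A x * cdist A y y' + cdist A x x' * nrm A y'"
        by (rule cdist_mult[OF c c'])
      also have "\<dots> \<le> nrm A x * d + d * nrm A y'"
        using * nrm_nonneg c c' by (intro add_mono mult_left_mono mult_right_mono) auto
      also have "\<dots> < e"
      proof -
        have "nrm A x * d \<le> d * (K - 1)"
          using nrm_nonneg c d(1) by (simp add: K_def mult.commute)
        moreover have "d * nrm A y' \<le> d * K"
          using n d(1) by (simp only: mult_le_cancel_left_pos)
        moreover have "d * (K - 1) = d * K - d"
          by (simp add: algebra_simps)
        ultimately show ?thesis using d by linarith
      qed
      finally show "\<exists>z\<in>S0. cdist A (x \<otimes> y) z < e" using add0 * by blast
    qed (use c in \<open>simp add: mult_closed\<close>)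
  next
    fix x assume x: "x \<in> C"
    then have c: "x \<in> carrier A" by (simp add: C_iff)
    show "adj A x \<in> C" unfolding C_iff
    proof (intro conjI allI impI)
      fix e :: real assume "e > 0"
      then obtain x' where *: "x' \<in> S0" "cdist A x x' < e" using x C_iff by blast
      then have "cdist A (adj A x) (adj A x') < e"
        using cdist_adj[OF c, of x'] S0s by auto
      then show "\<exists>z\<in>S0. cdist A (adj A x) z < e" using adj0 * by blast
    qed (use c in \<open>simp add: adj_closed\<close>)
    fix k
    show "smul A k x \<in> C" unfolding C_iff
    proof (intro conjI allI impI)
      fix e :: real assume e: "e > 0"
      define d where "d = e / (2 * (cmod k + 1))"
      have "cmod k + 1 > 0" using norm_ge_zero[of k] by linarith
      then have d: "d > 0" "cmod k * d < e / 2"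
        using e by (simp_all add: d_def field_simps)
      obtain x' where *: "x' \<in> S0" "cdist A x x' < d" using x d(1) C_iff by blast
      have c': "x' \<in> carrier A" using * S0s by auto
      have "e / (2 * (nrm A x' + 1)) > 0"
        using e nrm_nonneg[OF c'] by simp
      then obtain k' where k': "cmod (k - k') < e / (2 * (nrm A x' + 1))"
        "\<forall>x\<in>S0. smul A k' x \<in> S0"
        using smul0 by blast
      have "cmod (k - k') * nrm A x' \<le> cmod (k - k') * (nrm A x' + 1)"
        by (simp add: mult_left_mono)
      also have "\<dots> < e / 2"
        using k'(1) nrm_nonneg[OF c'] by (simp add: field_simps)
      finally have "cmod (k - k') * nrm A x' < e / 2" .
      moreover have "cmod k * cdist A x x' \<le> cmod k * d"
        using * by (simp add: mult_left_mono)
      ultimately have "cdist A (smul A k x) (smul A k' x') < e"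
        using cdist_smul[OF c c', of k k'] d(2) by linarith
      then show "\<exists>z\<in>S0. cdist A (smul A k x) z < e" using k' * by blast
    qed (use c in \<open>simp add: smul_closed\<close>)
  qed
  moreover have "X \<subseteq> C"
    using S0C by (auto simp: S0_def L_def intro!: UN_I[of 0])
  ultimately have "cstar_generated A X \<subseteq> C"
    unfolding cstar_generated_def by blast
  then show thesis
    using that[OF S0c S0s] C_iff by blast
qed

lemma cstar_generated_inj:
  assumes X: "countable X" "X \<subseteq> carrier A"
  obtains f :: "'a \<Rightarrow> nat set" where "inj_on f (cstar_generated A X)"
proof -
  interpret M: Metric_space "carrier A" "cdist A" by (rule Metric_space_cdist)
  obtain S0 where S0: "countable S0" "S0 \<subseteq> carrier A"
    "\<And>x e. x \<in> cstar_generated A X \<Longrightarrow> e > 0 \<Longrightarrow> \<exists>y\<in>S0. cdist A x y < e"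
    using cstar_generated_subset_dense[OF X] by blast
  have sub: "cstar_generated A X \<subseteq> carrier A"
  proof -
    have "cstar_subalgebra (carrier A) A"
      by (auto simp: cstar_subalgebra_def mult_closed adj_closed smul_closed)
    then show ?thesis using X unfolding cstar_generated_def by blast
  qed
  define f :: "'a \<Rightarrow> nat set" where
    "f x = {prod_encode (to_nat_on S0 y, k) | y k. y \<in> S0 \<and> cdist A x y < 1 / real (Suc k)}" for x
  have "inj_on f (cstar_generated A X)"
  proof (rule inj_onI, rule ccontr)
    fix x y assume xy: "x \<in> cstar_generated A X" "y \<in> cstar_generated A X" "f x = f y" "x \<noteq> y"
    then have c: "x \<in> carrier A" "y \<in> carrier A" using sub by auto
    then have "cdist A x y > 0" using xy(4) by simp
    then obtain k where k: "1 / real (Suc k) < cdist A x y / 2"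
      by (metis half_gt_zero nat_approx_posE)
    obtain z where z: "z \<in> S0" "cdist A x z < 1 / real (Suc k)"
      using S0(3)[OF xy(1), of "1 / real (Suc k)"] by auto
    then have "prod_encode (to_nat_on S0 z, k) \<in> f y"
      using xy(3) unfolding f_def by blast
    then obtain z' where "z' \<in> S0" "cdist A y z' < 1 / real (Suc k)" "to_nat_on S0 z' = to_nat_on S0 z"
      unfolding f_def by auto
    then have "cdist A y z < 1 / real (Suc k)"
      using inj_on_to_nat_on[OF S0(1)] z(1) by (metis inj_onD)
    moreover have "cdist A x y \<le> cdist A x z + cdist A y z"
      using M.triangle'[of x z y] c z(1) S0(2) by auto
    ultimately show False using z(2) k by linarith
  qed
  then show thesis using that by blast
qed

lemma cstar_subalgebra_generated:
  assumes "X \<subseteq> carrier A"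
  shows "cstar_subalgebra (cstar_generated A X) A" "X \<subseteq> cstar_generated A X"
proof -
  interpret M: Metric_space "carrier A" "cdist A" by (rule Metric_space_cdist)
  have car: "cstar_subalgebra (carrier A) A"
    by (auto simp: cstar_subalgebra_def mult_closed adj_closed smul_closed)
  then have sub: "cstar_generated A X \<subseteq> carrier A"
    using assms unfolding cstar_generated_def by blast
  have "closedin (norm_topology A) (cstar_generated A X)"
    unfolding cstar_generated_def
    using car assms by (intro closedin_Inter) (auto simp: cstar_subalgebra_def)
  then show "cstar_subalgebra (cstar_generated A X) A"
    using sub unfolding cstar_subalgebra_def cstar_generated_def by auto
  show "X \<subseteq> cstar_generated A X" by (auto simp: cstar_generated_def)
qed

end


text \<open>Transport of a C*-subalgebra along an injection.\<close>

definition cstar_transport :: "'a cstar \<Rightarrow> 'a set \<Rightarrow> ('a \<Rightarrow> 'b) \<Rightarrow> 'b cstar" where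
  "cstar_transport A S f = (let g = inv_into S f in
     \<lparr>carrier = f ` S, mult = (\<lambda>x y. f (g x \<otimes>\<^bsub>A\<^esub> g y)), one = undefined,
      zero = f \<zero>\<^bsub>A\<^esub>, add = (\<lambda>x y. f (g x \<oplus>\<^bsub>A\<^esub> g y)),
      smul = (\<lambda>c x. f (smul A c (g x))), adj = (\<lambda>x. f (adj A (g x))), nrm = (\<lambda>x. nrm A (g x))\<rparr>)"

lemma (in cstar_algebra)
  assumes S: "cstar_subalgebra S A" and f: "inj_on f S"
  defines "R \<equiv> cstar_transport A S f" and "g \<equiv> inv_into S f"
  shows cstar_algebra_transport: "cstar_algebra R"
    and cstar_hom_transport: "g \<in> cstar_hom R A"
    and finsum_transport: "finite F \<Longrightarrow> h \<in> F \<rightarrow> S \<Longrightarrow> finsum R (f \<circ> h) F = f (finsum A h F)"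
proof -
  interpret M: Metric_space "carrier A" "cdist A" by (rule Metric_space_cdist)
  have SA: "x \<in> carrier A" if "x \<in> S" for x
    using S that by (auto simp: cstar_subalgebra_def)
  have Sadd: "x \<oplus> y \<in> S" and Smult: "x \<otimes> y \<in> S" if "x \<in> S" "y \<in> S" for x y
    using S that by (auto simp: cstar_subalgebra_def)
  have Sadj: "adj A x \<in> S" and Ssmul: "smul A c x \<in> S" if "x \<in> S" for x c
    using S that by (auto simp: cstar_subalgebra_def)
  have zS: "\<zero> \<in> S" using S by (auto simp: cstar_subalgebra_def)
  have Smin: "\<ominus> x \<in> S" if "x \<in> S" for x
    using Ssmul[OF that, of "-1"] by (simp add: smul_minus_one SA that)
  have gf [simp]: "g (f x) = x" if "x \<in> S" for x
    using f that by (simp add: g_def)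
  note R_simps = R_def cstar_transport_def Let_def g_def[symmetric]
  have R [simp]: "carrier R = f ` S" "\<zero>\<^bsub>R\<^esub> = f \<zero>"
    "x \<otimes>\<^bsub>R\<^esub> y = f (g x \<otimes> g y)" "x \<oplus>\<^bsub>R\<^esub> y = f (g x \<oplus> g y)"
    "smul R c x = f (smul A c (g x))" "adj R x = f (adj A (g x))" "nrm R x = nrm A (g x)" for x y c
    by (simp_all add: R_simps)
  note S_closed = zS Sadd Smult Sadj Ssmul Smin
  interpret R: abelian_group R
  proof (rule abelian_groupI)
    fix x assume "x \<in> carrier R"
    then obtain u where u: "u \<in> S" "x = f u" by auto
    then show "\<exists>y\<in>carrier R. y \<oplus>\<^bsub>R\<^esub> x = \<zero>\<^bsub>R\<^esub>"
      by (intro bexI[of _ "f (\<ominus> u)"]) (auto simp: S_closed SA l_neg)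
  qed (auto simp: S_closed SA a_ac)
  have Rneg: "\<ominus>\<^bsub>R\<^esub> f u = f (\<ominus> u)" if "u \<in> S" for u
    using that by (intro R.minus_equality) (auto simp: S_closed SA l_neg)
  have Rdist: "cdist R (f u) (f v) = cdist A u v" if "u \<in> S" "v \<in> S" for u v
    using that by (simp add: cdist_def SA a_minus_def Rneg S_closed)
  have Rcar: "x \<in> carrier R \<longleftrightarrow> (\<exists>u\<in>S. x = f u)" for x by auto
  have Rms: "Metric_space (carrier R) (cdist R)"
  proof
    show "0 \<le> cdist R x y" for x y
      using Rdist M.nonneg by (cases "x \<in> carrier R \<and> y \<in> carrier R") (auto simp: cdist_def[of R])
    show "cdist R x y = cdist R y x" for x y
    proof (cases "x \<in> carrier R \<and> y \<in> carrier R")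
      case True
      then obtain u v where "u \<in> S" "v \<in> S" "x = f u" "y = f v" by auto
      then show ?thesis by (simp add: Rdist M.commute)
    qed (auto simp: cdist_def)
    show "cdist R x y = 0 \<longleftrightarrow> x = y" if "x \<in> carrier R" "y \<in> carrier R" for x y
      using that f by (auto simp: Rdist SA)
    show "cdist R x z \<le> cdist R x y + cdist R y z"
      if "x \<in> carrier R" "y \<in> carrier R" "z \<in> carrier R" for x y z
      using that by (auto simp: Rdist SA intro!: M.triangle)
  qed
  interpret RM: Metric_space "carrier R" "cdist R" by (rule Rms)
  show "cstar_algebra R"
  proof
    show "RM.mcomplete" unfolding RM.mcomplete_def
    proof (intro allI impI)
      fix \<sigma> assume \<sigma>: "RM.MCauchy \<sigma>"
      then have "range \<sigma> \<subseteq> carrier R" using RM.MCauchy_def by blast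
      then have "\<forall>n. \<exists>u\<in>S. \<sigma> n = f u" by (auto simp: image_subset_iff image_iff)
      then obtain \<tau> where \<tau>: "\<And>n. \<tau> n \<in> S" "\<And>n. \<sigma> n = f (\<tau> n)" by metis
      have "M.MCauchy \<tau>"
        using \<sigma> unfolding RM.MCauchy_def M.MCauchy_def by (auto simp: \<tau> Rdist SA)
      then obtain l where l: "limitin M.mtopology \<tau> l sequentially"
        using complete unfolding M.mcomplete_def by blast
      moreover have "closedin M.mtopology S" using S by (simp add: cstar_subalgebra_def)
      ultimately have "l \<in> S"
        using \<tau>(1) unfolding M.metric_closedin_iff_sequentially_closed by blast
      then have "limitin RM.mtopology \<sigma> (f l) sequentially"
        using l \<tau> \<open>l \<in> S\<close> unfolding RM.limit_metric_sequentially M.limit_metric_sequentially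
        by (simp add: Rdist SA)
      then show "\<exists>l. limitin RM.mtopology \<sigma> l sequentially" by blast
    qed
  next
    fix x assume "x \<in> carrier R"
    then show "nrm R x = 0 \<longleftrightarrow> x = \<zero>\<^bsub>R\<^esub>"
      using f by (auto simp: nrm_eq_0 SA S_closed)
  qed (auto simp: S_closed SA mult_assoc distrib_left distrib_right smul_add_left smul_add_right
      smul_smul smul_one smul_mult_left smul_mult_right adj_adj adj_add adj_smul adj_mult
      nrm_nonneg nrm_triangle nrm_smul nrm_mult cstar_identity)
  show "g \<in> cstar_hom R A"
    by (auto simp: cstar_hom_def S_closed SA)
  have "finsum R (f \<circ> h) F = f (finsum A h F) \<and> finsum A h F \<in> S"
    if "finite F" "h \<in> F \<rightarrow> S" for h F
    using that
  proof (induction F rule: finite_induct)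
    case (insert x F)
    have h: "h \<in> F \<rightarrow> S" "h x \<in> S" using insert.prems by auto
    have IH: "finsum R (f \<circ> h) F = f (finsum A h F)" "finsum A h F \<in> S"
      using insert.IH[OF h(1)] by blast+
    have "finsum A h (insert x F) = h x \<oplus> finsum A h F"
      using insert.hyps h SA by (intro finsum_insert) auto
    moreover have "finsum R (f \<circ> h) (insert x F) = (f \<circ> h) x \<oplus>\<^bsub>R\<^esub> finsum R (f \<circ> h) F"
      using insert.hyps h by (intro R.finsum_insert) auto
    ultimately show ?case
      using h by (simp only: IH) (simp add: IH(2) Sadd)
  qed (simp add: zS)
  then show "finite F \<Longrightarrow> h \<in> F \<rightarrow> S \<Longrightarrow> finsum R (f \<circ> h) F = f (finsum A h F)"
    by blast
qed


section \<open>Graph algebras\<close>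

text \<open>
  The source map is \<^const>\<open>tail\<close>, the range map is \<^const>\<open>head\<close>.
\<close>

definition singular :: "('v, 'e) pre_digraph \<Rightarrow> 'v \<Rightarrow> bool" where
  "singular G v \<longleftrightarrow> {e \<in> arcs G. tail G e = v} = {} \<or> infinite {e \<in> arcs G. tail G e = v}"

definition CK_family ::
  "('v, 'e) pre_digraph \<Rightarrow> 'a cstar \<Rightarrow> ('v \<Rightarrow> 'a) \<Rightarrow> ('e \<Rightarrow> 'a) \<Rightarrow> bool" where
  "CK_family G A p s \<longleftrightarrow>
     (\<forall>v\<in>verts G. projection A (p v)) \<and>
     (\<forall>v\<in>verts G. \<forall>w\<in>verts G. v \<noteq> w \<longrightarrow> p v \<otimes>\<^bsub>A\<^esub> p w = \<zero>\<^bsub>A\<^esub>) \<and>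
     (\<forall>e\<in>arcs G. partial_isometry A (s e)) \<and>
     (\<forall>e\<in>arcs G. \<forall>f\<in>arcs G. e \<noteq> f \<longrightarrow>
        range_proj A (s e) \<otimes>\<^bsub>A\<^esub> range_proj A (s f) = \<zero>\<^bsub>A\<^esub>) \<and>
     (\<forall>e\<in>arcs G. adj A (s e) \<otimes>\<^bsub>A\<^esub> s e = p (head G e)) \<and>
     (\<forall>e\<in>arcs G. proj_le A (range_proj A (s e)) (p (tail G e))) \<and>
     (\<forall>v\<in>verts G. \<not> singular G v \<longrightarrow>
        p v = (\<Oplus>\<^bsub>A\<^esub> e\<in>{e \<in> arcs G. tail G e = v}. range_proj A (s e)))"

text \<open>
  A universal Cuntz-Krieger family that generates its C*-algebra. HOL cannot quantify over all
  types inside a formula, so the universal property is required only for the target algebras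
  that are carried by a set of sets of naturals. For a countable graph this is no restriction:
  the C*-algebra generated by a Cuntz-Krieger family has at most continuum many elements. Lemma
  \<open>universal_CK_family_hom\<close> below derives the universal property for target algebras
  carried by any type.
\<close>

definition universal_CK_family ::
  "('v, 'e) pre_digraph \<Rightarrow> 'a cstar \<Rightarrow> ('v \<Rightarrow> 'a) \<Rightarrow> ('e \<Rightarrow> 'a) \<Rightarrow> bool" where
  "universal_CK_family G A p s \<longleftrightarrow>
     CK_family G A p s \<and>
     cstar_generated A (p ` verts G \<union> s ` arcs G) = carrier A \<and>
     (\<forall>(B :: nat set cstar) q t. cstar_algebra B \<longrightarrow> CK_family G B q t \<longrightarrow>
        (\<exists>\<phi>\<in>cstar_hom A B. (\<forall>v\<in>verts G. \<phi> (p v) = q v) \<and> (\<forall>e\<in>arcs G. \<phi> (s e) = t e)))"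

lemma universal_CK_family_hom:
  fixes G :: "('v, 'e) pre_digraph" and A :: "'a cstar" and B :: "'b cstar"
  assumes G: "wf_digraph G" "countable (verts G)" "countable (arcs G)"
    and univ: "universal_CK_family G A p s"
    and B: "cstar_algebra B" and CK: "CK_family G B q t"
  shows "\<exists>\<phi>\<in>cstar_hom A B. (\<forall>v\<in>verts G. \<phi> (p v) = q v) \<and> (\<forall>e\<in>arcs G. \<phi> (s e) = t e)"
proof -
  interpret B: cstar_algebra B by (rule B)
  interpret wf_digraph G by (rule G)
  define X where "X = q ` verts G \<union> t ` arcs G"
  have X: "countable X" "X \<subseteq> carrier B"
    using G CK by (auto simp: X_def CK_family_def projection_def partial_isometry_def)
  obtain f :: "'b \<Rightarrow> nat set" where f: "inj_on f (cstar_generated B X)"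
    using B.cstar_generated_inj[OF X] by blast
  define S where "S = cstar_generated B X"
  have S: "cstar_subalgebra S B" and XS: "X \<subseteq> S"
    unfolding S_def using B.cstar_subalgebra_generated X by blast+
  note f = f[folded S_def]
  define R where "R = cstar_transport B S f"
  have R: "cstar_algebra R" and g: "inv_into S f \<in> cstar_hom R B"
    unfolding R_def using B.cstar_algebra_transport[OF S f] B.cstar_hom_transport[OF S f] by auto
  have gf [simp]: "inv_into S f (f x) = x" if "x \<in> S" for x
    using f that by simp
  have R_simps [simp]: "carrier R = f ` S" "\<zero>\<^bsub>R\<^esub> = f \<zero>\<^bsub>B\<^esub>"
    "x \<otimes>\<^bsub>R\<^esub> y = f (inv_into S f x \<otimes>\<^bsub>B\<^esub> inv_into S f y)"
    "adj R x = f (adj B (inv_into S f x))" for x y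
    by (simp_all add: R_def cstar_transport_def Let_def)
  have qS: "q v \<in> S" if "v \<in> verts G" for v using XS that by (auto simp: X_def)
  have tS: "t e \<in> S" if "e \<in> arcs G" for e using XS that by (auto simp: X_def)
  have multS: "x \<otimes>\<^bsub>B\<^esub> y \<in> S" if "x \<in> S" "y \<in> S" for x y
    using S that by (auto simp: cstar_subalgebra_def)
  have adjS: "adj B x \<in> S" if "x \<in> S" for x
    using S that by (auto simp: cstar_subalgebra_def)
  have rp: "range_proj R (f (t e)) = f (range_proj B (t e))" "range_proj B (t e) \<in> S"
    if "e \<in> arcs G" for e
    using that by (simp_all add: range_proj_def tS adjS multS)
  have "CK_family G R (f \<circ> q) (f \<circ> t)"
    unfolding CK_family_def
  proof (intro conjI ballI impI)
    fix v assume v: "v \<in> verts G" "\<not> singular G v"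
    let ?E = "{e \<in> arcs G. tail G e = v}"
    have "finite ?E" using v by (auto simp: singular_def)
    have "finsum R (\<lambda>e. range_proj R ((f \<circ> t) e)) ?E = finsum R (f \<circ> (\<lambda>e. range_proj B (t e))) ?E"
      using rp R by (intro abelian_monoid.finsum_cong') 
        (auto simp: cstar_algebra_def abelian_group_def)
    also have "\<dots> = f (finsum B (\<lambda>e. range_proj B (t e)) ?E)"
      unfolding R_def by (rule B.finsum_transport[OF S f \<open>finite ?E\<close>]) (use rp in auto)
    also have "\<dots> = (f \<circ> q) v"
      using CK v by (simp add: CK_family_def)
    finally show "(f \<circ> q) v = finsum R (\<lambda>e. range_proj R ((f \<circ> t) e)) ?E" by simp
  qed (use CK in \<open>auto simp: CK_family_def projection_def partial_isometry_def proj_le_def rp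
      qS tS adjS multS\<close>)
  then obtain \<phi> where \<phi>: "\<phi> \<in> cstar_hom A R" "\<forall>v\<in>verts G. \<phi> (p v) = f (q v)"
    "\<forall>e\<in>arcs G. \<phi> (s e) = f (t e)"
    using univ R unfolding universal_CK_family_def by (metis comp_apply)
  have "inv_into S f \<circ> \<phi> \<in> cstar_hom A B"
    using \<phi>(1) g unfolding cstar_hom_def
    by (auto simp: Pi_iff simp del: R_simps)
  then show ?thesis
    using \<phi> qS tS by (intro bexI[of _ "inv_into S f \<circ> \<phi>"]) auto
qed

text \<open>\<open>A\<close> is (a model of) \<open>C*(G)\<close>.\<close>

definition is_graph_algebra :: "('v, 'e) pre_digraph \<Rightarrow> 'a cstar \<Rightarrow> bool" where
  "is_graph_algebra G A \<longleftrightarrow> cstar_algebra A \<and> (\<exists>p s. universal_CK_family G A p s)"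

text \<open>
  For \<open>i \<ge> 1\<close>, \<open>Inr (v, i)\<close> is the vertex \<open>v\<^sub>i\<close>, respectively the
  edge \<open>e\<^sub>i\<close>, of the head added to \<open>v\<close>.
\<close>

definition add_heads :: "('v, 'e) pre_digraph \<Rightarrow> ('v + 'v \<times> nat, 'e + 'v \<times> nat) pre_digraph" where
  "add_heads G = \<lparr>
     verts = Inl ` verts G \<union> Inr ` (verts G \<times> {1..}),
     arcs = Inl ` arcs G \<union> Inr ` (verts G \<times> {1..}),
     tail = (\<lambda>x. case x of Inl e \<Rightarrow> Inl (tail G e) | Inr (v, i) \<Rightarrow> Inr (v, i)),
     head = (\<lambda>x. case x of Inl e \<Rightarrow> Inl (head G e)
               | Inr (v, i) \<Rightarrow> if i = 1 then Inl v else Inr (v, i - 1))\<rparr>"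


section \<open>Compact operators\<close>

class complex_hilbert = real_inner + complete_space +
  fixes scaleC :: "complex \<Rightarrow> 'a \<Rightarrow> 'a" (infixr \<open>*\<^sub>C\<close> 75)
    and cinner :: "'a \<Rightarrow> 'a \<Rightarrow> complex"
  assumes scaleC_add_right: "c *\<^sub>C (x + y) = c *\<^sub>C x + c *\<^sub>C y"
    and scaleC_add_left: "(c + d) *\<^sub>C x = c *\<^sub>C x + d *\<^sub>C x"
    and scaleC_scaleC: "c *\<^sub>C d *\<^sub>C x = (c * d) *\<^sub>C x"
    and scaleC_of_real: "complex_of_real r *\<^sub>C x = r *\<^sub>R x"
    and cinner_commute: "cinner x y = cnj (cinner y x)"
    and cinner_add_left: "cinner (x + y) z = cinner x z + cinner y z"
    and cinner_scaleC_left: "cinner (c *\<^sub>C x) y = c * cinner x y"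
    and inner_eq_Re_cinner: "inner x y = Re (cinner x y)"

definition bounded_clinear :: "('h::complex_hilbert \<Rightarrow> 'h) \<Rightarrow> bool" where
  "bounded_clinear f \<longleftrightarrow> bounded_linear f \<and> (\<forall>c x. f (c *\<^sub>C x) = c *\<^sub>C f x)"

definition compact_operator :: "('h::complex_hilbert \<Rightarrow> 'h) \<Rightarrow> bool" where
  "compact_operator f \<longleftrightarrow> bounded_clinear f \<and> compact (closure (f ` cball 0 1))"

definition hilbert_adjoint :: "('h::complex_hilbert \<Rightarrow> 'h) \<Rightarrow> 'h \<Rightarrow> 'h" where
  "hilbert_adjoint f = (THE g. \<forall>x y. cinner (f x) y = cinner x (g y))"

definition compact_operators :: "('h::complex_hilbert \<Rightarrow> 'h) cstar" where
  "compact_operators = \<lparr>carrier = {f. compact_operator f}, mult = (\<circ>), one = id,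
     zero = (\<lambda>x. 0), add = (\<lambda>f g x. f x + g x), smul = (\<lambda>c f x. c *\<^sub>C f x),
     adj = hilbert_adjoint, nrm = onorm\<rparr>"

text \<open>Having a finite spanning set over the reals is the same as having one over \<open>\<complex>\<close>.\<close>

definition infinite_dimensional :: "'h::real_vector itself \<Rightarrow> bool" where
  "infinite_dimensional _ \<longleftrightarrow> (\<nexists>B :: 'h set. finite B \<and> span B = UNIV)"


section \<open>Tensor products and stabilization\<close>

text \<open>
  \<open>T\<close>, together with the elementary tensors \<open>tens a d\<close>, is a completion of the
  algebraic tensor product of \<open>A\<close> and \<open>D\<close> in some C*-norm. Injectivity of the canonical
  map from the algebraic tensor product to \<open>T\<close> is expressed by \<open>tens_inj\<close>: each element of the
  algebraic tensor product is a sum of elementary tensors \<open>a\<^sub>i \<otimes> d\<^sub>i\<close> with linearly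
  independent \<open>d\<^sub>i\<close>, and such a sum is zero only if every \<open>a\<^sub>i\<close> is zero.
  No particular C*-norm is chosen. If \<open>A\<close> or \<open>D\<close> is nuclear, as the compact operators are, there
  is exactly one.
\<close>

locale cstar_tensor_product =
  fixes A :: "'a cstar" and D :: "'d cstar" and T :: "'t cstar" and tens :: "'a \<Rightarrow> 'd \<Rightarrow> 't"
  assumes cstar_A: "cstar_algebra A" and cstar_D: "cstar_algebra D" and cstar_T: "cstar_algebra T"
    and tens_closed: "a \<in> carrier A \<Longrightarrow> d \<in> carrier D \<Longrightarrow> tens a d \<in> carrier T"
    and tens_add_left: "a \<in> carrier A \<Longrightarrow> a' \<in> carrier A \<Longrightarrow> d \<in> carrier D \<Longrightarrow>
          tens (a \<oplus>\<^bsub>A\<^esub> a') d = tens a d \<oplus>\<^bsub>T\<^esub> tens a' d"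
    and tens_add_right: "a \<in> carrier A \<Longrightarrow> d \<in> carrier D \<Longrightarrow> d' \<in> carrier D \<Longrightarrow>
          tens a (d \<oplus>\<^bsub>D\<^esub> d') = tens a d \<oplus>\<^bsub>T\<^esub> tens a d'"
    and tens_smul_left: "a \<in> carrier A \<Longrightarrow> d \<in> carrier D \<Longrightarrow>
          tens (smul A c a) d = smul T c (tens a d)"
    and tens_smul_right: "a \<in> carrier A \<Longrightarrow> d \<in> carrier D \<Longrightarrow>
          tens a (smul D c d) = smul T c (tens a d)"
    and tens_mult: "a \<in> carrier A \<Longrightarrow> a' \<in> carrier A \<Longrightarrow> d \<in> carrier D \<Longrightarrow> d' \<in> carrier D \<Longrightarrow>
          tens a d \<otimes>\<^bsub>T\<^esub> tens a' d' = tens (a \<otimes>\<^bsub>A\<^esub> a') (d \<otimes>\<^bsub>D\<^esub> d')"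
    and tens_adj: "a \<in> carrier A \<Longrightarrow> d \<in> carrier D \<Longrightarrow>
          adj T (tens a d) = tens (adj A a) (adj D d)"
    and tens_inj: "(\<And>i. i < n \<Longrightarrow> as i \<in> carrier A \<and> ds i \<in> carrier D) \<Longrightarrow>
          (\<And>c :: nat \<Rightarrow> complex. (\<Oplus>\<^bsub>D\<^esub> i\<in>{..<n}. smul D (c i) (ds i)) = \<zero>\<^bsub>D\<^esub> \<Longrightarrow>
             \<forall>i<n. c i = 0) \<Longrightarrow>
          (\<Oplus>\<^bsub>T\<^esub> i\<in>{..<n}. tens (as i) (ds i)) = \<zero>\<^bsub>T\<^esub> \<Longrightarrow>
          \<forall>i<n. as i = \<zero>\<^bsub>A\<^esub>"
    and tens_dense: "Abstract_Topology.closure_of (norm_topology T)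
          {x. \<exists>(n::nat) as ds. (\<forall>i<n. as i \<in> carrier A \<and> ds i \<in> carrier D) \<and>
             x = (\<Oplus>\<^bsub>T\<^esub> i\<in>{..<n}. tens (as i) (ds i))} = carrier T"

text \<open>\<open>T\<close> is (a model of) the stabilization of \<open>A\<close>, with the compact operators on \<open>'h\<close>.\<close>

definition is_stabilization ::
  "'h::complex_hilbert itself \<Rightarrow> 'a cstar \<Rightarrow> 't cstar \<Rightarrow> bool" where
  "is_stabilization _ A T \<longleftrightarrow>
     (\<exists>tens. cstar_tensor_product A (compact_operators :: ('h \<Rightarrow> 'h) cstar) T tens)"

end

theory Submission
  imports Defs
begin

text \<open>
  Let \<open>e\<^sub>i\<^sub>j\<close> be the matrix units of an orthonormal basis. The elements \<open>p\<^sub>v \<otimes> e\<^sub>0\<^sub>0\<close> and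
  \<open>s\<^sub>e \<otimes> e\<^sub>0\<^sub>0\<close> (old vertices and edges), \<open>p\<^sub>v \<otimes> e\<^sub>i\<^sub>i\<close> (new vertices) and \<open>p\<^sub>v \<otimes> e\<^sub>i\<^sub>,\<^sub>i\<^sub>-\<^sub>1\<close> (new edges)
  form a Cuntz-Krieger family for the graph with heads, which gives \<open>\<phi> : C*(G') \<rightarrow> T\<close>. Universality of \<open>C*(G)\<close> gives
  \<open>\<theta> : C*(G) \<rightarrow> C*(G')\<close> with \<open>\<phi> (\<theta> a) = a \<otimes> e\<^sub>0\<^sub>0\<close>, and the latter map is isometric. The elements
  \<open>W\<^sub>v\<^sub>i \<theta>(a) W\<^sub>w\<^sub>j\<^sup>*\<close>, where \<open>W\<^sub>v\<^sub>i\<close> is the partial isometry of the path from \<open>v\<^sub>i\<close> to \<open>v\<close>, span a dense subspace. An \<open>x\<close> in the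
  kernel of \<open>\<phi>\<close> has every compression \<open>W\<^sub>v\<^sub>i\<^sup>* x W\<^sub>w\<^sub>j\<close> in the closure of the range of \<open>\<theta>\<close>, where \<open>\<phi>\<close> is injective,
  so \<open>x = 0\<close>. The range of \<open>\<phi>\<close> is closed and contains all \<open>a \<otimes> e\<^sub>i\<^sub>j\<close>.

  Spectral theory is avoided. If \<open>y\<^sup>* z = z\<^sup>* y\<close> then \<open>\<parallel>y\<parallel>\<^sup>2 \<le> \<parallel>y\<^sup>* y + z\<^sup>* z\<parallel>\<close>, because \<open>w = y \<plusminus> i z\<close> has
  \<open>w\<^sup>* w = y\<^sup>* y + z\<^sup>* z\<close>. Together with an iterative square root of \<open>1 - w\<close> for \<open>\<parallel>w\<parallel> \<le> 1\<close> this yields that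
  *-homomorphisms are contractive, that injective ones are isometric, and that \<open>\<parallel>a \<otimes> d x\<parallel> \<le> \<parallel>d\<parallel> \<parallel>a \<otimes> x\<parallel>\<close> in
  any C*-tensor product. The last bound makes \<open>d \<mapsto> a \<otimes> d\<close> continuous along the finite-rank truncations of \<open>d\<close>,
  whatever C*-norm \<open>T\<close> carries.
\<close>


section \<open>Square roots and homomorphisms of C*-algebras\<close>

text \<open>No uniqueness theorem for graph algebras is used. The only source of injectivity is the
  independence axiom of the tensor product, so every question about the kernel of \<phi> is moved
  into the corner with index (0, 0). The algebras need not have a unit, and an element is not the
  sum of its compressions; it is shown to vanish by testing y x z = 0 on a dense subspace and
  letting y and z both tend to the adjoint of x. A norm bound on a self-adjoint contraction d is
  traded for an algebraic certificate, an element c with 2c = d^2 + c^2 (formally c = 1 - sqrt(1 -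
  d^2)). Such an equation survives homomorphisms and tensoring with a fixed element. Lower bounds
  for injective homomorphisms need the absolute value of h^2 - e 1, and this is why units are
  adjoined. As the C*-norm of \<open>T\<close> is arbitrary, continuity of elementary tensors in the
  second factor is not given and has to be extracted from the C*-identity.\<close>

context cstar_algebra begin

lemmas cstar_closed [simp] = mult_closed adj_closed smul_closed

lemma smul_minus: "x \<in> carrier A \<Longrightarrow> smul A (- c) x = \<ominus> smul A c x"
  using smul_smul[of x "-1" c] by (simp add: smul_minus_one)

lemma smul_uminus: "x \<in> carrier A \<Longrightarrow> smul A c (\<ominus> x) = \<ominus> smul A c x"
  using smul_smul[of x c "-1"] smul_minus[of x c] by (simp only: smul_minus_one mult_minus1_right)

lemma smul_zero_right [simp]: "smul A c \<zero> = \<zero>"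
  using smul_smul[of \<zero> c 0] by (simp add: smul_zero_left)

lemma adj_uminus: "x \<in> carrier A \<Longrightarrow> adj A (\<ominus> x) = \<ominus> adj A x"
  using adj_smul[of x "-1"] by (simp add: smul_minus_one)

lemma adj_zero [simp]: "adj A \<zero> = \<zero>"
  using adj_smul[of \<zero> 0] by (simp add: smul_zero_left)

lemma mult_zero_left [simp]: "x \<in> carrier A \<Longrightarrow> \<zero> \<otimes> x = \<zero>"
  using smul_mult_left[of \<zero> x 0] by (simp add: smul_zero_left)

lemma mult_zero_right [simp]: "x \<in> carrier A \<Longrightarrow> x \<otimes> \<zero> = \<zero>"
  using smul_mult_right[of x \<zero> 0] by (simp add: smul_zero_left)

lemma nrm_zero [simp]: "nrm A \<zero> = 0"
  by (simp add: nrm_eq_0)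

lemma nrm_diff: "x \<in> carrier A \<Longrightarrow> y \<in> carrier A \<Longrightarrow> nrm A (x \<ominus> y) \<le> nrm A x + nrm A y"
  using nrm_triangle[of x "\<ominus> y"] by (simp add: a_minus_def nrm_uminus)

lemma minus_add_cancel: "x \<in> carrier A \<Longrightarrow> y \<in> carrier A \<Longrightarrow> (x \<ominus> y) \<oplus> y = x"
  by (simp add: a_minus_def a_assoc l_neg)

lemma minus_eq_zero_iff: "x \<in> carrier A \<Longrightarrow> y \<in> carrier A \<Longrightarrow> x \<ominus> y = \<zero> \<longleftrightarrow> x = y"
  using minus_add_cancel[of x y] by (auto simp: a_minus_def r_neg)

lemma mult_diff_left: "x \<in> carrier A \<Longrightarrow> y \<in> carrier A \<Longrightarrow> z \<in> carrier A \<Longrightarrow>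
    (x \<ominus> y) \<otimes> z = x \<otimes> z \<ominus> y \<otimes> z"
  by (simp add: a_minus_def distrib_right mult_uminus_left)

lemma mult_diff_right: "x \<in> carrier A \<Longrightarrow> y \<in> carrier A \<Longrightarrow> z \<in> carrier A \<Longrightarrow>
    z \<otimes> (x \<ominus> y) = z \<otimes> x \<ominus> z \<otimes> y"
  by (simp add: a_minus_def distrib_left mult_uminus_right)

lemma adj_diff: "x \<in> carrier A \<Longrightarrow> y \<in> carrier A \<Longrightarrow> adj A (x \<ominus> y) = adj A x \<ominus> adj A y"
  by (simp add: a_minus_def adj_add adj_uminus)

lemma smul_diff_right: "x \<in> carrier A \<Longrightarrow> y \<in> carrier A \<Longrightarrow>
    smul A c (x \<ominus> y) = smul A c x \<ominus> smul A c y"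
  by (simp add: a_minus_def smul_add_right smul_uminus)

lemma nrm_selfadjoint_mult:
  assumes "x \<in> carrier A" "adj A x = x"
  shows "nrm A (x \<otimes> x) = (nrm A x)\<^sup>2"
  using cstar_identity[of x] assms by simp

lemma mult_adj_eq_zero: "x \<in> carrier A \<Longrightarrow> adj A x \<otimes> x = \<zero> \<Longrightarrow> x = \<zero>"
  using cstar_identity[of x] by (simp add: nrm_eq_0)


section \<open>Convergence in norm\<close>

definition conv :: "(nat \<Rightarrow> 'a) \<Rightarrow> 'a \<Rightarrow> bool" where
  "conv X l \<longleftrightarrow> (\<forall>n. X n \<in> carrier A) \<and> l \<in> carrier A \<and> (\<lambda>n. nrm A (X n \<ominus> l)) \<longlonglongrightarrow> 0"

lemma conv_carrier: "conv X l \<Longrightarrow> X n \<in> carrier A" "conv X l \<Longrightarrow> l \<in> carrier A"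
  by (auto simp: conv_def)

lemma conv_lim: "conv X l \<Longrightarrow> (\<lambda>n. nrm A (X n \<ominus> l)) \<longlonglongrightarrow> 0"
  unfolding conv_def by blast

lemma convI:
  assumes "\<And>n. X n \<in> carrier A" "l \<in> carrier A" "\<And>n. nrm A (X n \<ominus> l) \<le> f n" "f \<longlonglongrightarrow> 0"
  shows "conv X l"
  unfolding conv_def
proof (intro conjI allI)
  show "(\<lambda>n. nrm A (X n \<ominus> l)) \<longlonglongrightarrow> 0"
    by (rule Lim_null_comparison[OF _ assms(4)]) (simp add: assms nrm_nonneg)
qed (use assms in auto)

lemma conv_const: "x \<in> carrier A \<Longrightarrow> conv (\<lambda>n. x) x"
  by (simp add: conv_def a_minus_def r_neg)

lemma conv_add:
  assumes "conv X x" "conv Y y"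
  shows "conv (\<lambda>n. X n \<oplus> Y n) (x \<oplus> y)"
proof (rule convI)
  note c = conv_carrier[OF assms(1)] conv_carrier[OF assms(2)]
  show "nrm A (X n \<oplus> Y n \<ominus> (x \<oplus> y)) \<le> nrm A (X n \<ominus> x) + nrm A (Y n \<ominus> y)" for n
    using cdist_add[of "X n" "Y n" x y] c by (simp add: cdist_eq)
  show "(\<lambda>n. nrm A (X n \<ominus> x) + nrm A (Y n \<ominus> y)) \<longlonglongrightarrow> 0"
    by (intro tendsto_add_zero conv_lim assms)
qed (simp_all add: conv_carrier[OF assms(1)] conv_carrier[OF assms(2)])

lemma nrm_le_diff:
  assumes "x \<in> carrier A" "y \<in> carrier A" shows "nrm A x \<le> nrm A y + nrm A (x \<ominus> y)"
proof -
  show ?thesis using nrm_triangle[of "x \<ominus> y" y] minus_add_cancel[of x y] assms by simp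
qed

lemma nrm_diff_commute: "x \<in> carrier A \<Longrightarrow> y \<in> carrier A \<Longrightarrow> nrm A (x \<ominus> y) = nrm A (y \<ominus> x)"
  using nrm_uminus[of "x \<ominus> y"] by (simp add: a_minus_def minus_add a_comm)

lemma conv_nrm:
  assumes "conv X x" shows "(\<lambda>n. nrm A (X n)) \<longlonglongrightarrow> nrm A x"
proof (rule LIM_zero_cancel)
  note c = conv_carrier[OF assms]
  have "\<bar>nrm A (X n) - nrm A x\<bar> \<le> nrm A (X n \<ominus> x)" for n
    using nrm_le_diff[OF c(1) c(2), of n] nrm_le_diff[OF c(2) c(1), of n] nrm_diff_commute[OF c(2) c(1), of n]
    by linarith
  then have "\<forall>\<^sub>F n in sequentially. norm (nrm A (X n) - nrm A x) \<le> nrm A (X n \<ominus> x)"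
    by (intro always_eventually allI) (simp only: real_norm_def)
  then show "(\<lambda>n. nrm A (X n) - nrm A x) \<longlonglongrightarrow> 0"
    by (rule Lim_null_comparison[OF _ conv_lim[OF assms]])
qed

lemma conv_mult:
  assumes "conv X x" "conv Y y"
  shows "conv (\<lambda>n. X n \<otimes> Y n) (x \<otimes> y)"
proof (rule convI)
  note c = conv_carrier[OF assms(1)] conv_carrier[OF assms(2)]
  show "nrm A (X n \<otimes> Y n \<ominus> (x \<otimes> y)) \<le> nrm A (X n) * nrm A (Y n \<ominus> y) + nrm A (X n \<ominus> x) * nrm A y" for n
    using cdist_mult[of "X n" "Y n" x y] c by (simp add: cdist_eq)
  have "(\<lambda>n. nrm A (X n) * nrm A (Y n \<ominus> y) + nrm A (X n \<ominus> x) * nrm A y) \<longlonglongrightarrow> nrm A x * 0 + 0 * nrm A y"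
    by (intro tendsto_add tendsto_mult tendsto_const conv_nrm[OF assms(1)] conv_lim assms)
  then show "(\<lambda>n. nrm A (X n) * nrm A (Y n \<ominus> y) + nrm A (X n \<ominus> x) * nrm A y) \<longlonglongrightarrow> 0"
    by simp
qed (simp_all add: conv_carrier[OF assms(1)] conv_carrier[OF assms(2)])

lemma conv_smul:
  assumes "conv X x" shows "conv (\<lambda>n. smul A c (X n)) (smul A c x)"
proof (rule convI)
  note c = conv_carrier[OF assms]
  show "nrm A (smul A c (X n) \<ominus> smul A c x) \<le> cmod c * nrm A (X n \<ominus> x)" for n
    using c(1)[of n] c(2) nrm_smul[of "X n \<ominus> x" c] by (simp add: smul_diff_right)
  show "(\<lambda>n. cmod c * nrm A (X n \<ominus> x)) \<longlonglongrightarrow> 0"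
    by (intro tendsto_mult_right_zero conv_lim assms)
qed (simp_all add: conv_carrier[OF assms])

lemma conv_adj:
  assumes "conv X x" shows "conv (\<lambda>n. adj A (X n)) (adj A x)"
proof (rule convI)
  note c = conv_carrier[OF assms]
  show "nrm A (adj A (X n) \<ominus> adj A x) \<le> nrm A (X n \<ominus> x)" for n
    using cdist_adj[of "X n" x] c by (simp add: cdist_eq)
qed (simp_all add: conv_carrier[OF assms] conv_lim[OF assms])

lemma conv_unique:
  assumes "conv X x" "conv X y" shows "x = y"
proof -
  note c = conv_carrier[OF assms(1)] conv_carrier[OF assms(2)]
  have "nrm A (x \<ominus> y) \<le> nrm A (X n \<ominus> x) + nrm A (X n \<ominus> y)" for n
  proof -
    have "x \<ominus> y = (X n \<ominus> y) \<ominus> (X n \<ominus> x)"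
      using c by (simp add: a_minus_def minus_add a_ac r_neg1 r_neg2)
        (simp add: a_lcomm[of "X n" "\<ominus> y"] r_neg)
    then show ?thesis using nrm_diff[of "X n \<ominus> y" "X n \<ominus> x"] c by simp
  qed
  moreover have "(\<lambda>n. nrm A (X n \<ominus> x) + nrm A (X n \<ominus> y)) \<longlonglongrightarrow> 0"
    by (intro tendsto_add_zero conv_lim assms)
  ultimately have "nrm A (x \<ominus> y) \<le> 0"
    by (intro LIMSEQ_le_const[of "\<lambda>n. nrm A (X n \<ominus> x) + nrm A (X n \<ominus> y)"]) auto
  then show ?thesis
    using c nrm_nonneg[of "x \<ominus> y"] nrm_eq_0[of "x \<ominus> y"] by (simp add: minus_eq_zero_iff)
qed

lemma conv_Suc: "conv X x \<Longrightarrow> conv (\<lambda>n. X (Suc n)) x"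
  unfolding conv_def by (auto intro: LIMSEQ_Suc)

text \<open>\<open>conv\<close> asks for every term to lie in the carrier, \<open>limitin\<close>
  only for all large indices; hence the hypothesis.\<close>

lemma conv_iff_limitin:
  assumes "\<And>n. X n \<in> carrier A"
  shows "conv X l \<longleftrightarrow> limitin (norm_topology A) X l sequentially"
proof -
  interpret M: Metric_space "carrier A" "cdist A" by (rule Metric_space_cdist)
  show ?thesis
    using assms nrm_nonneg unfolding M.limit_metric_sequentially conv_def LIMSEQ_iff
    by (auto simp: cdist_eq)
qed

lemma closed_conv:
  assumes "closedin (norm_topology A) S" "\<And>n. X n \<in> S" "conv X l"
  shows "l \<in> S"
proof -
  interpret M: Metric_space "carrier A" "cdist A" by (rule Metric_space_cdist)
  have "range X \<subseteq> S" using assms(2) by auto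
  then show ?thesis
    using assms conv_iff_limitin[of X l] conv_carrier[of X l]
    unfolding M.metric_closedin_iff_sequentially_closed by blast
qed

lemma closedI:
  assumes "S \<subseteq> carrier A" "\<And>X l. (\<And>n. X n \<in> S) \<Longrightarrow> conv X l \<Longrightarrow> l \<in> S"
  shows "closedin (norm_topology A) S"
proof -
  interpret M: Metric_space "carrier A" "cdist A" by (rule Metric_space_cdist)
  show ?thesis
    unfolding M.metric_closedin_iff_sequentially_closed
    using assms conv_iff_limitin by (metis range_subsetD subsetD)
qed

lemma in_closure_conv:
  assumes "S \<subseteq> carrier A" "x \<in> Abstract_Topology.closure_of (norm_topology A) S"
  obtains X where "\<And>n. X n \<in> S" "conv X x"
proof -
  interpret M: Metric_space "carrier A" "cdist A" by (rule Metric_space_cdist)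
  obtain X where X: "range X \<subseteq> S \<inter> carrier A" "limitin (norm_topology A) X x sequentially"
    using assms unfolding M.closure_of_sequentially by blast
  then show ?thesis using that[of X] conv_iff_limitin[of X] by blast
qed

lemma conv_in_closure:
  assumes "S \<subseteq> carrier A" "\<And>n. X n \<in> S" "conv X x"
  shows "x \<in> Abstract_Topology.closure_of (norm_topology A) S"
proof -
  interpret M: Metric_space "carrier A" "cdist A" by (rule Metric_space_cdist)
  show ?thesis using assms conv_iff_limitin[of X] unfolding M.closure_of_sequentially
    by (auto simp: conv_def intro!: exI[of _ X])
qed

lemma Cauchy_conv:
  assumes "\<And>n. X n \<in> carrier A" "\<And>e. e > 0 \<Longrightarrow> \<exists>N. \<forall>m\<ge>N. \<forall>n\<ge>N. nrm A (X m \<ominus> X n) < e"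
  obtains l where "conv X l"
proof -
  interpret M: Metric_space "carrier A" "cdist A" by (rule Metric_space_cdist)
  have "M.MCauchy X"
    unfolding M.MCauchy_def using assms by (auto simp: cdist_eq)
  then obtain l where "limitin M.mtopology X l sequentially"
    using complete unfolding M.mcomplete_def by blast
  then show ?thesis using that assms(1) conv_iff_limitin by blast
qed

text \<open>With \<open>w = y \<plusminus> iz\<close> the mixed terms of \<open>w\<^sup>* w\<close> cancel, and \<open>2y\<close> is the sum of the
  two choices of \<open>w\<close>. This replaces the order structure of a C*-algebra throughout.\<close>

lemma nrm_sum_squares:
  assumes c: "y \<in> carrier A" "z \<in> carrier A" and yz: "adj A y \<otimes> z = adj A z \<otimes> y"
  shows "(nrm A y)\<^sup>2 \<le> nrm A (adj A y \<otimes> y \<oplus> adj A z \<otimes> z)"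
proof -
  define N where "N = adj A y \<otimes> y \<oplus> adj A z \<otimes> z"
  have Nc: "N \<in> carrier A" using c by (simp add: N_def)
  have w: "(nrm A (y \<oplus> smul A k z))\<^sup>2 = nrm A N" if k: "k = \<i> \<or> k = - \<i>" for k
  proof -
    have "adj A (y \<oplus> smul A k z) \<otimes> (y \<oplus> smul A k z) =
      (adj A y \<otimes> y \<oplus> smul A k (adj A z \<otimes> y)) \<oplus> (smul A (cnj k) (adj A z \<otimes> y) \<oplus> smul A (cnj k * k) (adj A z \<otimes> z))"
      using c by (simp add: adj_add adj_smul distrib_left distrib_right smul_mult_left
          smul_mult_right smul_smul yz smul_add_right a_ac mult.commute)
    also have "\<dots> = N \<oplus> (smul A k (adj A z \<otimes> y) \<oplus> smul A (cnj k) (adj A z \<otimes> y))"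
      using c k by (auto simp: N_def smul_one a_ac)
    also have "smul A k (adj A z \<otimes> y) \<oplus> smul A (cnj k) (adj A z \<otimes> y) = smul A (k + cnj k) (adj A z \<otimes> y)"
      using c by (simp add: smul_add_left)
    also have "\<dots> = \<zero>" using k c by (auto simp: smul_zero_left)
    finally have "adj A (y \<oplus> smul A k z) \<otimes> (y \<oplus> smul A k z) = N" using Nc by simp
    then show ?thesis using cstar_identity[of "y \<oplus> smul A k z"] c by simp
  qed
  have "smul A 2 y = (y \<oplus> smul A \<i> z) \<oplus> (y \<oplus> smul A (- \<i>) z)"
  proof -
    have "(y \<oplus> smul A \<i> z) \<oplus> (y \<oplus> smul A (- \<i>) z) = (y \<oplus> y) \<oplus> smul A 0 z"
      using c by (simp add: smul_minus smul_zero_left a_ac r_neg)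
    also have "\<dots> = smul A (1 + 1) y"
      using c by (simp only: smul_add_left smul_one) (simp add: smul_zero_left)
    finally show ?thesis by simp
  qed
  then have "2 * nrm A y \<le> nrm A (y \<oplus> smul A \<i> z) + nrm A (y \<oplus> smul A (- \<i>) z)"
    using nrm_smul[of y 2] nrm_triangle[of "y \<oplus> smul A \<i> z" "y \<oplus> smul A (- \<i>) z"] c by simp
  also have "\<dots> = 2 * sqrt (nrm A N)"
    using w[of \<i>, THEN real_sqrt_unique] w[of "-\<i>", THEN real_sqrt_unique] c nrm_nonneg by simp
  finally have "nrm A y \<le> sqrt (nrm A N)" by simp
  then show ?thesis
    using nrm_nonneg[OF c(1)] nrm_nonneg[OF Nc] unfolding N_def
    by (metis real_sqrt_le_iff real_sqrt_pow2 power_mono)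
qed

text \<open>Stands in for u^2 \<le> u^2 + v^2: squares of commuting self-adjoint elements cannot
  cancel. If their sum is 0, both vanish.\<close>

lemma nrm_commuting_squares:
  assumes "u \<in> carrier A" "v \<in> carrier A" "adj A u = u" "adj A v = v" "u \<otimes> v = v \<otimes> u"
  shows "(nrm A u)\<^sup>2 \<le> nrm A (u \<otimes> u \<oplus> v \<otimes> v)"
  using nrm_sum_squares[of u v] assms by simp


section \<open>Square roots without a unit\<close>

lemma smul_two: "x \<in> carrier A \<Longrightarrow> smul A 2 x = x \<oplus> x"
  using smul_add_left[of x 1 1] by (simp add: smul_one)

lemma smul_half_unique:
  assumes "x \<in> carrier A" "y \<in> carrier A" "x = smul A (1/2) y" shows "smul A 2 x = y"
  using assms smul_smul[of y 2 "1/2"] by (simp add: smul_one)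

lemma uminus_zero [simp]: "\<ominus> \<zero> = \<zero>"
  by (simp add: minus_equality)

lemma diff_zero [simp]: "x \<in> carrier A \<Longrightarrow> x \<ominus> \<zero> = x"
  by (simp add: a_minus_def)

lemma diff_add_diff:
  "x \<in> carrier A \<Longrightarrow> y \<in> carrier A \<Longrightarrow> z \<in> carrier A \<Longrightarrow> (x \<ominus> y) \<oplus> (y \<ominus> z) = x \<ominus> z"
  by (simp add: a_minus_def a_assoc r_neg1)

lemma add_diff_cancel_left:
  assumes "w \<in> carrier A" "x \<in> carrier A" "y \<in> carrier A"
  shows "(w \<oplus> x) \<ominus> (w \<oplus> y) = x \<ominus> y"
  using assms by (simp add: a_minus_def minus_add a_assoc a_lcomm[of x "\<ominus> w"] r_neg2)

text \<open>Formally c = 1 - sqrt(1 - w): expanding (1 - c)^2 = 1 - w gives 2c = w + c^2, an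
  equation that makes sense without a unit. Iterating x \<mapsto> (w + x^2)/2 from 0 converges even
  for norm 1, where the map need not be a strict contraction: the same iteration for the number 1
  dominates both the iterates and their increments, and it is increasing and bounded. Whatever
  commutes with w commutes with the iterates and hence with c.\<close>

lemma half_square_fixpoint:
  assumes w: "w \<in> carrier A" "adj A w = w" "nrm A w \<le> 1"
  obtains c where "c \<in> carrier A" "adj A c = c" "nrm A c \<le> 1" "smul A 2 c = w \<oplus> c \<otimes> c"
    "\<And>z. z \<in> carrier A \<Longrightarrow> z \<otimes> w = w \<otimes> z \<Longrightarrow> z \<otimes> c = c \<otimes> z"
proof -
  define c where "c = rec_nat \<zero> (\<lambda>_ x. smul A (1/2) (w \<oplus> x \<otimes> x))"
  \<comment> \<open>The extreme scalar case w = 1, which dominates every w of norm at most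
    1.\<close>
  define g :: "nat \<Rightarrow> real" where "g = rec_nat 0 (\<lambda>_ x. (1 + x\<^sup>2) / 2)"
  have c_0: "c 0 = \<zero>" and g_0: "g 0 = 0" by (simp_all add: c_def g_def)
  have c_Suc: "c (Suc n) = smul A (1/2) (w \<oplus> c n \<otimes> c n)" for n by (simp add: c_def)
  have g_Suc: "g (Suc n) = (1 + (g n)\<^sup>2) / 2" for n by (simp add: g_def)
  have g01: "0 \<le> g n \<and> g n \<le> 1" for n
  proof (induction n)
    case (Suc n)
    then have "(g n)\<^sup>2 \<le> 1" by (simp add: power_le_one)
    then show ?case by (simp add: g_Suc)
  qed (simp add: g_0)
  have g_mono: "g n \<le> g (Suc n)" for n
  proof -
    have "0 \<le> (1 - g n)\<^sup>2" by simp
    then show ?thesis by (simp add: g_Suc power2_eq_square algebra_simps)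
  qed
  have cc [simp]: "c n \<in> carrier A" for n
    by (induction n) (simp_all add: c_0 c_Suc w)
  have ca: "adj A (c n) = c n" for n
    by (induction n) (simp_all add: c_0 c_Suc w adj_smul adj_add adj_mult)
  have comm: "z \<otimes> c n = c n \<otimes> z" if z: "z \<in> carrier A" "z \<otimes> w = w \<otimes> z" for z n
  proof (induction n)
    case 0 then show ?case using z by (simp add: c_0)
  next
    case (Suc n)
    have "z \<otimes> (c n \<otimes> c n) = c n \<otimes> c n \<otimes> z"
      using z by (simp add: Suc mult_assoc[symmetric]) (simp add: Suc mult_assoc)
    then show ?case
      using z w by (simp add: c_Suc smul_mult_left smul_mult_right distrib_left distrib_right)
  qed
  have cn: "nrm A (c n) \<le> g n" for n
  proof (induction n)
    case (Suc n)
    have "nrm A (w \<oplus> c n \<otimes> c n) \<le> nrm A w + nrm A (c n \<otimes> c n)"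
      using w by (intro nrm_triangle) auto
    also have "nrm A (c n \<otimes> c n) \<le> (g n)\<^sup>2"
      using Suc nrm_mult[of "c n" "c n"] mult_mono[OF Suc Suc] nrm_nonneg[of "c n"] g01[of n]
      by (simp add: power2_eq_square)
    finally show ?case using w by (simp add: c_Suc g_Suc nrm_smul)
  qed (simp add: c_0 g_0)
  \<comment> \<open>Iterates commute, so x^2 - y^2 = (x - y)(x + y). Both factors are bounded by the
    corresponding scalar factors, whose product is twice the next scalar increment.\<close>
  have step: "nrm A (c (Suc n) \<ominus> c n) \<le> g (Suc n) - g n" for n
  proof (induction n)
    case 0
    then show ?case using cn[of 1] by (simp add: c_0 g_0)
  next
    case (Suc n)
    let ?x = "c (Suc n)" and ?y = "c n"
    have xy: "?x \<otimes> ?y = ?y \<otimes> ?x"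
      by (rule comm) (use w comm[of w "Suc n"] in simp_all)
    have "c (Suc (Suc n)) \<ominus> ?x = smul A (1/2) (?x \<otimes> ?x \<ominus> ?y \<otimes> ?y)"
    proof -
      have "c (Suc (Suc n)) \<ominus> ?x = smul A (1/2) ((w \<oplus> ?x \<otimes> ?x) \<ominus> (w \<oplus> ?y \<otimes> ?y))"
        using w by (simp add: c_Suc[of "Suc n"] smul_diff_right) (simp add: c_Suc[of n])
      also have "(w \<oplus> ?x \<otimes> ?x) \<ominus> (w \<oplus> ?y \<otimes> ?y) = ?x \<otimes> ?x \<ominus> ?y \<otimes> ?y"
        using w by (simp add: add_diff_cancel_left)
      finally show ?thesis .
    qed
    also have "?x \<otimes> ?x \<ominus> ?y \<otimes> ?y = (?x \<ominus> ?y) \<otimes> (?x \<oplus> ?y)"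
      by (simp add: distrib_left mult_diff_left xy diff_add_diff)
    finally have "nrm A (c (Suc (Suc n)) \<ominus> ?x) \<le> (1/2) * (nrm A (?x \<ominus> ?y) * nrm A (?x \<oplus> ?y))"
      using nrm_mult[of "?x \<ominus> ?y" "?x \<oplus> ?y"] by (simp add: nrm_smul)
    also have "nrm A (?x \<ominus> ?y) * nrm A (?x \<oplus> ?y) \<le> (g (Suc n) - g n) * (g (Suc n) + g n)"
    proof (rule mult_mono[OF Suc])
      show "nrm A (?x \<oplus> ?y) \<le> g (Suc n) + g n"
        using nrm_triangle[of ?x ?y] cn[of n] cn[of "Suc n"] by simp
    qed (use g_mono[of n] nrm_nonneg in auto)
    also have "(1/2) * ((g (Suc n) - g n) * (g (Suc n) + g n)) = g (Suc (Suc n)) - g (Suc n)"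
      by (simp add: g_Suc[of "Suc n"] g_Suc[of n, symmetric] power2_eq_square algebra_simps)
        (use g_Suc[of n] in \<open>simp add: power2_eq_square algebra_simps\<close>)
    finally show ?case by simp
  qed
  have dist: "nrm A (c (n + k) \<ominus> c n) \<le> g (n + k) - g n" for n k
  proof (induction k)
    case (Suc k)
    have "c (n + Suc k) \<ominus> c n = (c (Suc (n + k)) \<ominus> c (n + k)) \<oplus> (c (n + k) \<ominus> c n)"
      by (simp add: a_minus_def a_assoc r_neg1 r_neg2)
    then have "nrm A (c (n + Suc k) \<ominus> c n) \<le> nrm A (c (Suc (n + k)) \<ominus> c (n + k)) + nrm A (c (n + k) \<ominus> c n)"
      by (simp add: nrm_triangle)
    then show ?case using Suc step[of "n + k"] by simp
  qed (simp add: a_minus_def r_neg)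
  have "convergent g"
    using g01 g_mono by (intro Bseq_monoseq_convergent incseq_imp_monoseq incseq_SucI BseqI'[of _ 1]) auto
  then have "Cauchy g" by (rule convergent_Cauchy)
  obtain l where l: "conv c l"
  proof (rule Cauchy_conv)
    fix e :: real assume "e > 0"
    then obtain N where N: "\<And>m n. m \<ge> N \<Longrightarrow> n \<ge> N \<Longrightarrow> \<bar>g m - g n\<bar> < e"
      using \<open>Cauchy g\<close> unfolding Cauchy_def dist_real_def by blast
    have "nrm A (c m \<ominus> c n) < e" if "m \<ge> N" "n \<ge> N" for m n
    proof (cases "n \<le> m")
      case True
      then show ?thesis using dist[of n "m - n"] N[OF that] by simp
    next
      case False
      then show ?thesis
        using dist[of m "n - m"] N[OF that] nrm_diff_commute[of "c m" "c n"] by simp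
    qed
    then show "\<exists>N. \<forall>m\<ge>N. \<forall>n\<ge>N. nrm A (c m \<ominus> c n) < e" by blast
  qed simp
  have lc: "l \<in> carrier A" by (rule conv_carrier[OF l])
  show thesis
  proof (rule that)
    show "l \<in> carrier A" by (rule lc)
    show "adj A l = l" using conv_unique[OF conv_adj[OF l]] l by (simp add: ca)
    show "nrm A l \<le> 1"
      using cn g01 by (intro LIMSEQ_le_const2[OF conv_nrm[OF l]]) (meson order_trans)
    have "conv (\<lambda>n. c (Suc n)) (smul A (1/2) (w \<oplus> l \<otimes> l))"
      unfolding c_Suc by (intro conv_smul conv_add conv_mult conv_const l w)
    then have "l = smul A (1/2) (w \<oplus> l \<otimes> l)"
      using conv_unique conv_Suc[OF l] by blast
    then show "smul A 2 l = w \<oplus> l \<otimes> l"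
      using w lc by (intro smul_half_unique) auto
    show "z \<otimes> l = l \<otimes> z" if z: "z \<in> carrier A" "z \<otimes> w = w \<otimes> z" for z
      using conv_unique[OF conv_mult[OF conv_const[OF z(1)] l]] conv_mult[OF l conv_const[OF z(1)]]
      by (simp add: comm[OF z])
  qed
qed

text \<open>In the unitization, \<open>d\<^sup>2 + (1 - c)\<^sup>2 = 1\<close>.\<close>

lemma complementary_squares:
  assumes c: "c \<in> carrier A" "d \<in> carrier A" "y \<in> carrier A" and sa: "adj A c = c" "adj A d = d"
    and comm: "d \<otimes> c = c \<otimes> d" and eq: "smul A 2 c = d \<otimes> d \<oplus> c \<otimes> c"
  shows "adj A (d \<otimes> y) \<otimes> (y \<ominus> c \<otimes> y) = adj A (y \<ominus> c \<otimes> y) \<otimes> (d \<otimes> y)"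
    and "adj A (d \<otimes> y) \<otimes> (d \<otimes> y) \<oplus> adj A (y \<ominus> c \<otimes> y) \<otimes> (y \<ominus> c \<otimes> y) = adj A y \<otimes> y"
proof -
  let ?u = "d \<otimes> y" and ?v = "y \<ominus> c \<otimes> y" and ?y = "adj A y"
  have ya: "?y \<in> carrier A" using c by simp
  have u: "adj A ?u = ?y \<otimes> d" and v: "adj A ?v = ?y \<ominus> ?y \<otimes> c"
    using c sa by (simp_all add: adj_mult adj_diff)
  have "d \<otimes> (c \<otimes> y) = c \<otimes> (d \<otimes> y)"
    using c comm by (simp add: mult_assoc[symmetric])
  then show "adj A ?u \<otimes> ?v = adj A ?v \<otimes> ?u"
    using c ya by (simp add: u v mult_diff_left mult_diff_right mult_assoc)
  have "adj A ?u \<otimes> ?u \<oplus> adj A ?v \<otimes> ?v = ?y \<otimes> (d \<otimes> d \<otimes> y \<oplus> (?v \<ominus> c \<otimes> ?v))"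
    using c ya by (simp add: u v mult_diff_left mult_diff_right distrib_left mult_assoc)
  also have "d \<otimes> d \<otimes> y \<oplus> (?v \<ominus> c \<otimes> ?v) = y"
  proof -
    have "d \<otimes> d \<otimes> y \<oplus> c \<otimes> c \<otimes> y = c \<otimes> y \<oplus> c \<otimes> y"
      using c eq smul_two[of "c \<otimes> y"] by (simp add: distrib_right[symmetric] smul_mult_left[symmetric])
    moreover have "d \<otimes> d \<otimes> y \<oplus> (?v \<ominus> c \<otimes> ?v)
        = (d \<otimes> d \<otimes> y \<oplus> c \<otimes> c \<otimes> y) \<oplus> (y \<oplus> \<ominus> (c \<otimes> y \<oplus> c \<otimes> y))"
      using c by (simp add: distrib_left mult_uminus_right mult_assoc a_minus_def minus_add a_ac)
    ultimately show ?thesis using c by (simp add: a_lcomm[of _ y] r_neg)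
  qed
  finally show "adj A ?u \<otimes> ?u \<oplus> adj A ?v \<otimes> ?v = ?y \<otimes> y" .
qed

text \<open>The equation for c plays the part of \<open>nrm A d \<le> 1\<close>. Being purely
  algebraic, it also holds for the images of c and d under a homomorphism, where no norm bound is
  known beforehand.\<close>

lemma nrm_mult_le:
  assumes c: "c \<in> carrier A" "d \<in> carrier A" "y \<in> carrier A" and sa: "adj A c = c" "adj A d = d"
    and comm: "d \<otimes> c = c \<otimes> d" and eq: "smul A 2 c = d \<otimes> d \<oplus> c \<otimes> c"
  shows "nrm A (d \<otimes> y) \<le> nrm A y"
proof -
  have "(nrm A (d \<otimes> y))\<^sup>2 \<le> nrm A (adj A y \<otimes> y)"
    using c nrm_sum_squares[of "d \<otimes> y" "y \<ominus> c \<otimes> y"] complementary_squares[OF assms] by simp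
  then show ?thesis using c nrm_nonneg by (simp add: cstar_identity power2_le_iff_abs_le)
qed

end

section \<open>Homomorphisms are contractive\<close>

lemma cstar_homD:
  assumes "\<phi> \<in> cstar_hom A B" "x \<in> carrier A"
  shows "\<phi> x \<in> carrier B" "\<phi> (adj A x) = adj B (\<phi> x)" "\<phi> (smul A c x) = smul B c (\<phi> x)"
    "y \<in> carrier A \<Longrightarrow> \<phi> (x \<oplus>\<^bsub>A\<^esub> y) = \<phi> x \<oplus>\<^bsub>B\<^esub> \<phi> y"
    "y \<in> carrier A \<Longrightarrow> \<phi> (x \<otimes>\<^bsub>A\<^esub> y) = \<phi> x \<otimes>\<^bsub>B\<^esub> \<phi> y"
  using assms by (auto simp: cstar_hom_def)

lemma cstar_hom_diff:
  assumes "cstar_algebra A" "cstar_algebra B" "\<phi> \<in> cstar_hom A B" "x \<in> carrier A" "y \<in> carrier A"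
  shows "\<phi> (x \<ominus>\<^bsub>A\<^esub> y) = \<phi> x \<ominus>\<^bsub>B\<^esub> \<phi> y"
proof -
  interpret A: cstar_algebra A by fact
  interpret B: cstar_algebra B by fact
  have "\<phi> (\<ominus>\<^bsub>A\<^esub> y) = \<ominus>\<^bsub>B\<^esub> \<phi> y"
    using cstar_homD(3)[OF assms(3,5), of "-1"] cstar_homD(1)[OF assms(3,5)] assms(5)
    by (simp add: A.smul_minus_one B.smul_minus_one)
  then show ?thesis
    using assms by (simp add: a_minus_def cstar_homD)
qed

lemma cstar_hom_zero:
  assumes "cstar_algebra A" "cstar_algebra B" "\<phi> \<in> cstar_hom A B"
  shows "\<phi> \<zero>\<^bsub>A\<^esub> = \<zero>\<^bsub>B\<^esub>"
proof -
  interpret A: cstar_algebra A by fact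
  interpret B: cstar_algebra B by fact
  show ?thesis
    using cstar_homD(3)[OF assms(3), of "\<zero>\<^bsub>A\<^esub>" 0] cstar_homD(1)[OF assms(3), of "\<zero>\<^bsub>A\<^esub>"]
    by (simp add: B.smul_zero_left)
qed

text \<open>For self-adjoint d in the unit ball, the element c obtained for w = d^2 certifies the
  bound for \<phi> d as well. The general case follows by scaling and the C*-identity.\<close>

lemma cstar_hom_contractive:
  assumes A: "cstar_algebra A" and B: "cstar_algebra B" and \<phi>: "\<phi> \<in> cstar_hom A B" and x: "x \<in> carrier A"
  shows "nrm B (\<phi> x) \<le> nrm A x"
proof -
  interpret A: cstar_algebra A by fact
  interpret B: cstar_algebra B by fact
  note \<phi>D = cstar_homD[OF \<phi>]
  have unit: "nrm B (\<phi> d) \<le> 1" if d: "d \<in> carrier A" "adj A d = d" "nrm A d \<le> 1" for d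
  proof -
    have dd: "d \<otimes>\<^bsub>A\<^esub> d \<in> carrier A" "adj A (d \<otimes>\<^bsub>A\<^esub> d) = d \<otimes>\<^bsub>A\<^esub> d" "nrm A (d \<otimes>\<^bsub>A\<^esub> d) \<le> 1"
      using d A.nrm_nonneg by (simp_all add: A.nrm_selfadjoint_mult power_le_one A.adj_mult)
    obtain c where c: "c \<in> carrier A" "adj A c = c"
      "nrm A c \<le> 1" "smul A 2 c = d \<otimes>\<^bsub>A\<^esub> d \<oplus>\<^bsub>A\<^esub> c \<otimes>\<^bsub>A\<^esub> c"
      "\<And>z. z \<in> carrier A \<Longrightarrow> z \<otimes>\<^bsub>A\<^esub> (d \<otimes>\<^bsub>A\<^esub> d) = d \<otimes>\<^bsub>A\<^esub> d \<otimes>\<^bsub>A\<^esub> z \<Longrightarrow> z \<otimes>\<^bsub>A\<^esub> c = c \<otimes>\<^bsub>A\<^esub> z"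
      using A.half_square_fixpoint[OF _ _ dd(3)] dd(1,2) by blast
    have dc: "d \<otimes>\<^bsub>A\<^esub> c = c \<otimes>\<^bsub>A\<^esub> d" using d by (intro c(5)) (simp_all add: A.mult_assoc)
    \<comment> \<open>Left multiplication by \<open>\<phi> d\<close> is tested on
      \<open>\<phi> d\<close> itself: the square of its norm is at most its norm.\<close>
    have "nrm B (\<phi> d \<otimes>\<^bsub>B\<^esub> \<phi> d) \<le> nrm B (\<phi> d)"
    proof (rule B.nrm_mult_le[of "\<phi> c"])
      show "\<phi> d \<otimes>\<^bsub>B\<^esub> \<phi> c = \<phi> c \<otimes>\<^bsub>B\<^esub> \<phi> d" 
        using \<phi>D(5)[OF c(1) d(1)] \<phi>D(5)[OF d(1) c(1)] dc by simp
      show "smul B 2 (\<phi> c) = \<phi> d \<otimes>\<^bsub>B\<^esub> \<phi> d \<oplus>\<^bsub>B\<^esub> \<phi> c \<otimes>\<^bsub>B\<^esub> \<phi> c"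
        using \<phi>D(3)[OF c(1), of 2] c(1,4) d by (simp add: \<phi>D)
    qed (use \<phi>D(1)[OF d(1)] \<phi>D(1)[OF c(1)] \<phi>D(2)[OF d(1)] \<phi>D(2)[OF c(1)] c(2) d(2) in simp_all)
    moreover have "nrm B (\<phi> d \<otimes>\<^bsub>B\<^esub> \<phi> d) = (nrm B (\<phi> d))\<^sup>2"
      using \<phi>D(2)[OF d(1)] d \<phi>D(1)[OF d(1)] by (intro B.nrm_selfadjoint_mult) auto
    ultimately show ?thesis
      by (cases "nrm B (\<phi> d) \<le> 1") (auto simp: power2_eq_square mult_le_cancel_left1)
  qed
  have sa: "nrm B (\<phi> d) \<le> nrm A d" if d: "d \<in> carrier A" "adj A d = d" for d
  proof (cases "nrm A d = 0")
    case True
    then have "d = \<zero>\<^bsub>A\<^esub>" using d A.nrm_eq_0 by blast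
    then show ?thesis using cstar_hom_zero[OF A B \<phi>] by simp
  next
    case False
    then have pos: "nrm A d > 0" using A.nrm_nonneg[OF d(1)] by simp
    have "nrm B (\<phi> (smul A (of_real (1 / nrm A d)) d)) \<le> 1"
      using d pos by (intro unit) (simp_all add: A.adj_smul A.nrm_smul norm_divide)
    then show ?thesis
      using d pos \<phi>D[OF d(1)] by (simp add: B.nrm_smul norm_divide field_simps)
  qed
  have "(nrm B (\<phi> x))\<^sup>2 = nrm B (\<phi> (adj A x \<otimes>\<^bsub>A\<^esub> x))"
    using x \<phi>D[OF x] \<phi>D(5)[of "adj A x" x] by (simp add: B.cstar_identity)
  also have "\<dots> \<le> nrm A (adj A x \<otimes>\<^bsub>A\<^esub> x)"
    using x by (intro sa) (simp_all add: A.adj_mult A.adj_adj)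
  also have "\<dots> = (nrm A x)\<^sup>2" using x by (simp add: A.cstar_identity)
  finally show ?thesis using A.nrm_nonneg[OF x] by (rule power2_le_imp_le)
qed

context cstar_algebra begin

lemma commute_mult:
  assumes "z \<in> carrier A" "u \<in> carrier A" "v \<in> carrier A"
    and "z \<otimes> u = u \<otimes> z" "z \<otimes> v = v \<otimes> z"
  shows "z \<otimes> (u \<otimes> v) = (u \<otimes> v) \<otimes> z"
proof -
  have "z \<otimes> (u \<otimes> v) = (z \<otimes> u) \<otimes> v" using assms(1-3) by (simp add: mult_assoc)
  also have "\<dots> = u \<otimes> (z \<otimes> v)" using assms(1-3) by (simp only: assms(4) mult_assoc)
  also have "\<dots> = (u \<otimes> v) \<otimes> z" using assms(1-3) by (simp only: assms(5) mult_assoc)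
  finally show ?thesis .
qed

text \<open>Positivity is expressed by being the square of a self-adjoint element. With a = y^2, b =
  q^2 and d = a - b, the hypothesis gives (a + b) d = 0, so (y d)^2 + (q d)^2 = (a + b) d^2 = 0.
  Commuting squares cannot cancel, hence y d = q d = 0. Then a d^2 = b d^2 = 0, so d^3 = 0, and a
  self-adjoint element with vanishing cube is 0.\<close>

lemma commuting_positive_root_unique:
  assumes c: "y \<in> carrier A" "q \<in> carrier A" and sa: "adj A y = y" "adj A q = q"
    and yq: "y \<otimes> q = q \<otimes> y" and eq: "(y \<otimes> y) \<otimes> (y \<otimes> y) = (q \<otimes> q) \<otimes> (q \<otimes> q)"
  shows "y \<otimes> y = q \<otimes> q"
proof -
  define a b d where "a = y \<otimes> y" and "b = q \<otimes> q" and "d = a \<ominus> b"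
  have cl [simp]: "a \<in> carrier A" "b \<in> carrier A" "d \<in> carrier A"
    using c by (simp_all add: a_def b_def d_def)
  have ya: "y \<otimes> a = a \<otimes> y" and qb: "q \<otimes> b = b \<otimes> q"
    using c by (simp_all add: a_def b_def mult_assoc)
  have yb: "y \<otimes> b = b \<otimes> y"
    using c unfolding b_def by (intro commute_mult yq)
  have qa: "q \<otimes> a = a \<otimes> q"
    using c unfolding a_def by (intro commute_mult yq[symmetric])
  have ab: "a \<otimes> b = b \<otimes> a"
    using c unfolding a_def by (intro commute_mult[symmetric] cl yb[symmetric])
  have dy: "d \<otimes> y = y \<otimes> d" and dq: "d \<otimes> q = q \<otimes> d"
    using c by (simp_all add: d_def mult_diff_left mult_diff_right ya yb qa qb)
  have sd: "adj A d = d" using c by (simp add: d_def a_def b_def adj_diff adj_mult sa)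
  have sq: "(z \<otimes> d) \<otimes> (z \<otimes> d) = (z \<otimes> z) \<otimes> d \<otimes> d" if "z \<in> carrier A" "d \<otimes> z = z \<otimes> d" for z
  proof -
    have "(z \<otimes> d) \<otimes> (z \<otimes> d) = z \<otimes> (d \<otimes> z) \<otimes> d" using that(1) by (simp add: mult_assoc)
    also have "\<dots> = (z \<otimes> z) \<otimes> d \<otimes> d" using that(1) by (simp only: that(2)) (simp add: mult_assoc)
    finally show ?thesis .
  qed
  have "(a \<oplus> b) \<otimes> d = (a \<otimes> a \<ominus> b \<otimes> a) \<oplus> (b \<otimes> a \<ominus> b \<otimes> b)"
    by (subst distrib_right) (simp_all add: d_def mult_diff_right ab)
  also have "\<dots> = a \<otimes> a \<ominus> b \<otimes> b" by (simp add: diff_add_diff)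
  also have "\<dots> = \<zero>" using eq by (simp add: a_def[symmetric] b_def[symmetric] minus_eq_zero_iff)
  finally have "(a \<oplus> b) \<otimes> d \<otimes> d = \<zero>" by simp
  then have "(y \<otimes> d) \<otimes> (y \<otimes> d) \<oplus> (q \<otimes> d) \<otimes> (q \<otimes> d) = \<zero>"
    using c dy dq by (simp add: sq a_def[symmetric] b_def[symmetric] distrib_right)
  moreover have "(y \<otimes> d) \<otimes> (q \<otimes> d) = (q \<otimes> d) \<otimes> (y \<otimes> d)"
  proof -
    have "(y \<otimes> d) \<otimes> (q \<otimes> d) = y \<otimes> (d \<otimes> q) \<otimes> d" using c by (simp add: mult_assoc)
    also have "\<dots> = (y \<otimes> q) \<otimes> d \<otimes> d" using c by (simp add: dq mult_assoc)
    also have "\<dots> = q \<otimes> (y \<otimes> d) \<otimes> d" using c by (simp add: yq mult_assoc)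
    also have "\<dots> = (q \<otimes> d) \<otimes> (y \<otimes> d)" using c by (simp add: dy[symmetric] mult_assoc)
    finally show ?thesis .
  qed
  moreover have "adj A (y \<otimes> d) = y \<otimes> d" "adj A (q \<otimes> d) = q \<otimes> d"
    using c by (simp_all add: adj_mult sd sa dy dq)
  ultimately have "(nrm A (y \<otimes> d))\<^sup>2 \<le> nrm A \<zero>"
      and "(nrm A (q \<otimes> d))\<^sup>2 \<le> nrm A ((q \<otimes> d) \<otimes> (q \<otimes> d) \<oplus> (y \<otimes> d) \<otimes> (y \<otimes> d))"
      and "(q \<otimes> d) \<otimes> (q \<otimes> d) \<oplus> (y \<otimes> d) \<otimes> (y \<otimes> d) = \<zero>"
    using c nrm_commuting_squares[of "y \<otimes> d" "q \<otimes> d"] nrm_commuting_squares[of "q \<otimes> d" "y \<otimes> d"]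
      a_comm[of "(q \<otimes> d) \<otimes> (q \<otimes> d)" "(y \<otimes> d) \<otimes> (y \<otimes> d)"]
    by (simp_all only: cl mult_closed)
  then have "y \<otimes> d = \<zero>" "q \<otimes> d = \<zero>" using c by (simp_all add: nrm_eq_0)
  then have "a \<otimes> d \<otimes> d = \<zero>" "b \<otimes> d \<otimes> d = \<zero>"
    unfolding a_def b_def sq[OF c(1) dy, symmetric] sq[OF c(2) dq, symmetric] by simp_all
  then have "d \<otimes> d \<otimes> d = \<zero>"
    by (subst (1) d_def) (simp add: mult_diff_left)
  then have "adj A (d \<otimes> d) \<otimes> (d \<otimes> d) = \<zero>"
    by (simp add: adj_mult sd mult_assoc)
  then have "d \<otimes> d = \<zero>" by (rule mult_adj_eq_zero[rotated]) simp
  then have "d = \<zero>" by (intro mult_adj_eq_zero[of d]) (simp_all only: sd cl)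
  then show ?thesis using minus_eq_zero_iff[of a b] by (simp add: d_def a_def b_def c)
qed

end

section \<open>Roots and absolute values in unital algebras\<close>

locale unital_cstar_algebra = cstar_algebra +
  assumes one_closed [simp]: "\<one> \<in> carrier A"
    and l_one [simp]: "x \<in> carrier A \<Longrightarrow> \<one> \<otimes> x = x"
    and r_one [simp]: "x \<in> carrier A \<Longrightarrow> x \<otimes> \<one> = x"
begin

lemma adj_one [simp]: "adj A \<one> = \<one>"
proof -
  have "\<one> = adj A (adj A \<one> \<otimes> \<one>)" by (simp add: adj_adj)
  also have "\<dots> = adj A \<one>" by (simp add: adj_mult adj_adj del: r_one)  simp
  finally show ?thesis by simp
qed

lemma nrm_one_le: "nrm A \<one> \<le> 1"
proof -
  have "nrm A \<one> = (nrm A \<one>)\<^sup>2" using nrm_selfadjoint_mult[of \<one>] by simp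
  then show ?thesis by (cases "nrm A \<one> \<le> 1") (auto simp: power2_eq_square)
qed

text \<open>q = 1 - c for the fixed point c. The bound on \<open>\<one> \<ominus> q\<close> is
  exported because it permits a further root, namely of q = 1 - (1 - q).\<close>

lemma root_one_minus:
  assumes w: "w \<in> carrier A" "adj A w = w" "nrm A w \<le> 1"
  obtains q where "q \<in> carrier A" "adj A q = q" "nrm A (\<one> \<ominus> q) \<le> 1" "q \<otimes> q = \<one> \<ominus> w"
    "\<And>z. z \<in> carrier A \<Longrightarrow> z \<otimes> w = w \<otimes> z \<Longrightarrow> z \<otimes> q = q \<otimes> z"
proof -
  obtain c where c: "c \<in> carrier A" "adj A c = c" "nrm A c \<le> 1" "smul A 2 c = w \<oplus> c \<otimes> c"
    "\<And>z. z \<in> carrier A \<Longrightarrow> z \<otimes> w = w \<otimes> z \<Longrightarrow> z \<otimes> c = c \<otimes> z"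
    using half_square_fixpoint[OF w] by blast
  show thesis
  proof (rule that[of "\<one> \<ominus> c"])
    have "\<one> \<ominus> (\<one> \<ominus> c) = c"
      using c(1) by (simp add: a_minus_def minus_add r_neg2)
    then show "nrm A (\<one> \<ominus> (\<one> \<ominus> c)) \<le> 1" using c by simp
    have "(\<one> \<ominus> c) \<otimes> (\<one> \<ominus> c) = \<one> \<ominus> ((c \<oplus> c) \<ominus> c \<otimes> c)"
      using c(1) by (simp add: mult_diff_left mult_diff_right) (simp add: a_minus_def minus_add a_ac)
    also have "c \<oplus> c = w \<oplus> c \<otimes> c" using c by (simp add: smul_two)
    also have "(w \<oplus> c \<otimes> c) \<ominus> c \<otimes> c = w" using c(1) w by (simp add: a_minus_def a_assoc r_neg)
    finally show "(\<one> \<ominus> c) \<otimes> (\<one> \<ominus> c) = \<one> \<ominus> w" .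
  qed (use c(1,2,5) in \<open>simp_all add: adj_diff mult_diff_left mult_diff_right\<close>)
qed

lemma root_minus:
  assumes w: "w \<in> carrier A" "adj A w = w" "nrm A w \<le> e" and e: "e > 0"
  obtains q where "q \<in> carrier A" "adj A q = q" "q \<otimes> q = smul A (of_real e) \<one> \<ominus> w"
    "\<And>z. z \<in> carrier A \<Longrightarrow> z \<otimes> w = w \<otimes> z \<Longrightarrow> z \<otimes> q = q \<otimes> z"
proof -
  let ?w = "smul A (of_real (1 / e)) w"
  have w': "?w \<in> carrier A" "adj A ?w = ?w" "nrm A ?w \<le> 1"
    using w e by (simp_all add: adj_smul nrm_smul norm_divide)
  obtain q where q: "q \<in> carrier A" "adj A q = q" "nrm A (\<one> \<ominus> q) \<le> 1" "q \<otimes> q = \<one> \<ominus> ?w"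
    "\<And>z. z \<in> carrier A \<Longrightarrow> z \<otimes> ?w = ?w \<otimes> z \<Longrightarrow> z \<otimes> q = q \<otimes> z"
    using root_one_minus[OF w'] by blast
  show thesis
  proof (rule that[of "smul A (of_real (sqrt e)) q"])
    have "smul A (of_real (sqrt e)) q \<otimes> smul A (of_real (sqrt e)) q = smul A (of_real e) (q \<otimes> q)"
      using q(1) e by (simp add: smul_mult_left smul_mult_right smul_smul of_real_mult[symmetric] del: of_real_mult)
    also have "\<dots> = smul A (of_real e) \<one> \<ominus> w"
      using w(1) e by (simp add: q(4) smul_diff_right smul_smul smul_one)
    finally show "smul A (of_real (sqrt e)) q \<otimes> smul A (of_real (sqrt e)) q = smul A (of_real e) \<one> \<ominus> w" .
    show "z \<otimes> smul A (of_real (sqrt e)) q = smul A (of_real (sqrt e)) q \<otimes> z"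
      if z: "z \<in> carrier A" "z \<otimes> w = w \<otimes> z" for z
      using q(1) q(5)[OF z(1)] z w(1) by (simp add: smul_mult_left smul_mult_right)
  qed (use q(1,2) in \<open>simp_all add: adj_smul\<close>)
qed

text \<open>\<open>y \<otimes> y\<close> is the absolute value of \<open>x\<close>.\<close>

lemma fourth_root_square:
  assumes x: "x \<in> carrier A" "adj A x = x"
  obtains y where "y \<in> carrier A" "adj A y = y" "(y \<otimes> y) \<otimes> (y \<otimes> y) = x \<otimes> x"
    "\<And>z. z \<in> carrier A \<Longrightarrow> z \<otimes> x = x \<otimes> z \<Longrightarrow> z \<otimes> y = y \<otimes> z"
proof -
  \<comment> \<open>Adding 1 keeps t positive when x = 0 and puts u into the unit ball.\<close>
  define t where "t = nrm A x + 1"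
  have t: "t > 0" using nrm_nonneg[OF x(1)] by (simp add: t_def)
  define u where "u = smul A (of_real (1 / t)) x"
  have u: "u \<in> carrier A" "adj A u = u" "nrm A u \<le> 1"
    using x t nrm_nonneg[OF x(1)] by (simp_all add: u_def adj_smul nrm_smul norm_divide) (simp add: t_def)
  have uu: "u \<otimes> u \<in> carrier A" "adj A (u \<otimes> u) = u \<otimes> u" "nrm A (u \<otimes> u) \<le> 1"
    using u nrm_nonneg[OF u(1)] by (simp_all add: adj_mult nrm_selfadjoint_mult power_le_one)
  \<comment> \<open>Three nested roots: s = sqrt(1 - u^2), then r = sqrt(1 - s^2), which is the
    absolute value of u, and finally the root of r.\<close>
  obtain s where s: "s \<in> carrier A" "adj A s = s" "nrm A (\<one> \<ominus> s) \<le> 1" "s \<otimes> s = \<one> \<ominus> u \<otimes> u"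
    "\<And>z. z \<in> carrier A \<Longrightarrow> z \<otimes> (u \<otimes> u) = u \<otimes> u \<otimes> z \<Longrightarrow> z \<otimes> s = s \<otimes> z"
    using root_one_minus[OF uu] by blast
  have us: "u \<otimes> s = s \<otimes> u" using u by (intro s(5)) (simp_all add: mult_assoc)
  \<comment> \<open>The root of 1 - s^2 needs \<parallel>s^2\<parallel> \<le> 1. In place of 0 \<le>
    1 - u^2 \<le> 1, this is read off from s^2 + u^2 = 1 by the bound for commuting squares.\<close>
  have "(nrm A s)\<^sup>2 \<le> nrm A (s \<otimes> s \<oplus> u \<otimes> u)"
    using u s(1,2) us by (intro nrm_commuting_squares) auto
  also have "s \<otimes> s \<oplus> u \<otimes> u = \<one>" using u(1) s(4) by (simp add: minus_add_cancel)
  finally have ns: "nrm A (s \<otimes> s) \<le> 1"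
    using nrm_one_le nrm_selfadjoint_mult[OF s(1,2)] by simp
  have ss: "s \<otimes> s \<in> carrier A" "adj A (s \<otimes> s) = s \<otimes> s" using s(1,2) by (simp_all add: adj_mult)
  obtain r where r: "r \<in> carrier A" "adj A r = r" "nrm A (\<one> \<ominus> r) \<le> 1" "r \<otimes> r = \<one> \<ominus> s \<otimes> s"
    "\<And>z. z \<in> carrier A \<Longrightarrow> z \<otimes> (s \<otimes> s) = s \<otimes> s \<otimes> z \<Longrightarrow> z \<otimes> r = r \<otimes> z"
    using root_one_minus[OF _ _ ns] ss by blast
  have rr: "r \<otimes> r = u \<otimes> u"
    using u(1) s(1,4) r(4) by (simp add: a_minus_def minus_add r_neg2)
  have nr: "\<one> \<ominus> r \<in> carrier A" "adj A (\<one> \<ominus> r) = \<one> \<ominus> r" using r(1,2) by (simp_all add: adj_diff)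
  obtain y where y: "y \<in> carrier A" "adj A y = y" "nrm A (\<one> \<ominus> y) \<le> 1" "y \<otimes> y = \<one> \<ominus> (\<one> \<ominus> r)"
    "\<And>z. z \<in> carrier A \<Longrightarrow> z \<otimes> (\<one> \<ominus> r) = (\<one> \<ominus> r) \<otimes> z \<Longrightarrow> z \<otimes> y = y \<otimes> z"
    using root_one_minus[OF nr r(3)] by blast
  have yy: "y \<otimes> y = r" using y(4) r(1) by (simp add: a_minus_def minus_add r_neg2)
  show thesis
  proof (rule that[of "smul A (of_real (sqrt t)) y"])
    let ?y = "smul A (of_real (sqrt t)) y"
    have "?y \<otimes> ?y = smul A (of_real t) r"
      using y(1) r(1) t by (simp add: smul_mult_left smul_mult_right smul_smul yy of_real_mult[symmetric] del: of_real_mult)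
    then have "(?y \<otimes> ?y) \<otimes> (?y \<otimes> ?y) = smul A (of_real t * of_real t) (u \<otimes> u)"
      using r(1) rr u(1) by (simp add: smul_mult_left smul_mult_right smul_smul)
    also have "\<dots> = x \<otimes> x"
      using x t by (simp add: u_def smul_mult_left smul_mult_right smul_smul smul_one)
    finally show "(?y \<otimes> ?y) \<otimes> (?y \<otimes> ?y) = x \<otimes> x" .
    show "z \<otimes> ?y = ?y \<otimes> z" if z: "z \<in> carrier A" "z \<otimes> x = x \<otimes> z" for z
    proof -
      have zu: "z \<otimes> u = u \<otimes> z" using z x by (simp add: u_def smul_mult_left smul_mult_right)
      have "z \<otimes> (u \<otimes> u) = u \<otimes> u \<otimes> z"
          using z(1) u(1) by (intro commute_mult zu)
      then have zs: "z \<otimes> s = s \<otimes> z" by (rule s(5)[OF z(1)])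
      have "z \<otimes> (s \<otimes> s) = s \<otimes> s \<otimes> z"
        using z(1) s(1) by (intro commute_mult zs)
      then have zr: "z \<otimes> r = r \<otimes> z" by (rule r(5)[OF z(1)])
      have "z \<otimes> y = y \<otimes> z"
        using z r(1) zr by (intro y(5)) (simp_all add: mult_diff_left mult_diff_right)
      then show ?thesis using z y(1) by (simp add: smul_mult_left smul_mult_right)
    qed
  qed (use y(1,2) in \<open>simp_all add: adj_smul\<close>)
qed

end

text \<open>By contradiction: scale h to g of norm 1, put k = g^2 and choose e with
  \<parallel>\<phi> k\<parallel> < e < 1. In \<open>B\<close>, e - \<phi> k is a square q^2, while
  in \<open>A\<close> only the absolute value y^2 of k - e is available. Now \<phi> (y^2) and q^2
  are positive roots of the same element, so they agree, and injectivity turns \<phi> (y^2) = \<phi>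
  (e - k) into y^2 = e - k. Hence g^2 + y^2 = e, and the bound for commuting squares gives 1 \<le>
  e.\<close>

lemma unital_injective_hom_selfadjoint:
  assumes A: "unital_cstar_algebra A" and B: "unital_cstar_algebra B" and \<phi>: "\<phi> \<in> cstar_hom A B"
    and one: "\<phi> \<one>\<^bsub>A\<^esub> = \<one>\<^bsub>B\<^esub>" and inj: "inj_on \<phi> (carrier A)"
    and h: "h \<in> carrier A" "adj A h = h"
  shows "nrm A h \<le> nrm B (\<phi> h)"
proof (rule ccontr)
  interpret A: unital_cstar_algebra A by fact
  interpret B: unital_cstar_algebra B by fact
  note \<phi>D = cstar_homD[OF \<phi>]
  assume "\<not> nrm A h \<le> nrm B (\<phi> h)"
  then have less: "nrm B (\<phi> h) < nrm A h" by simp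
  define t where "t = nrm A h"
  have t: "t > 0" using less B.nrm_nonneg[OF \<phi>D(1)[OF h(1)]] by (simp add: t_def)
  define g where "g = smul A (of_real (1 / t)) h"
  have g: "g \<in> carrier A" "adj A g = g" "nrm A g = 1"
    using h t by (simp_all add: g_def A.adj_smul A.nrm_smul norm_divide) (simp add: t_def)
  have \<phi>g: "\<phi> g \<in> carrier B" "adj B (\<phi> g) = \<phi> g"
    using \<phi>D(1)[OF g(1)] \<phi>D(2)[OF g(1)] g(2) by simp_all
  have \<phi>g1: "nrm B (\<phi> g) < 1"
    using less t \<phi>D(1)[OF h(1)] by (simp add: g_def \<phi>D(3)[OF h(1)] B.nrm_smul norm_divide t_def)
  define k where "k = g \<otimes>\<^bsub>A\<^esub> g"
  have k: "k \<in> carrier A" "adj A k = k" "\<phi> k \<in> carrier B" "adj B (\<phi> k) = \<phi> k"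
    using g \<phi>g \<phi>D(5)[OF g(1) g(1)] by (simp_all add: k_def A.adj_mult B.adj_mult)
  have "nrm B (\<phi> k) < 1"
    using \<phi>g \<phi>g1 B.nrm_nonneg[OF \<phi>g(1)] \<phi>D(5)[OF g(1) g(1)]
    by (simp add: k_def B.nrm_selfadjoint_mult abs_square_less_1)
  then obtain e where e: "nrm B (\<phi> k) < e" "e < 1" using dense[of "nrm B (\<phi> k)" 1] by blast
  have e0: "e > 0" using e(1) B.nrm_nonneg[OF k(3)] by simp
  define x where "x = k \<ominus>\<^bsub>A\<^esub> smul A (of_real e) \<one>\<^bsub>A\<^esub>"
  have x: "x \<in> carrier A" "adj A x = x"
    using k by (simp_all add: x_def A.adj_diff A.adj_smul)
  obtain y where y: "y \<in> carrier A" "adj A y = y"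
      "(y \<otimes>\<^bsub>A\<^esub> y) \<otimes>\<^bsub>A\<^esub> (y \<otimes>\<^bsub>A\<^esub> y) = x \<otimes>\<^bsub>A\<^esub> x"
      "\<And>z. z \<in> carrier A \<Longrightarrow> z \<otimes>\<^bsub>A\<^esub> x = x \<otimes>\<^bsub>A\<^esub> z \<Longrightarrow> z \<otimes>\<^bsub>A\<^esub> y = y \<otimes>\<^bsub>A\<^esub> z"
    using A.fourth_root_square[OF x] by blast
  obtain q where q: "q \<in> carrier B" "adj B q = q"
      "q \<otimes>\<^bsub>B\<^esub> q = smul B (of_real e) \<one>\<^bsub>B\<^esub> \<ominus>\<^bsub>B\<^esub> \<phi> k"
      "\<And>z. z \<in> carrier B \<Longrightarrow> z \<otimes>\<^bsub>B\<^esub> \<phi> k = \<phi> k \<otimes>\<^bsub>B\<^esub> z \<Longrightarrow> z \<otimes>\<^bsub>B\<^esub> q = q \<otimes>\<^bsub>B\<^esub> z"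
    using B.root_minus[OF k(3,4) less_imp_le[OF e(1)] e0] by blast
  \<comment> \<open>x differs from k by a scalar, so both have the same commutant. This is used for
    k and for g.\<close>
  have comm: "z \<otimes>\<^bsub>A\<^esub> y = y \<otimes>\<^bsub>A\<^esub> z" if "z \<in> carrier A" "z \<otimes>\<^bsub>A\<^esub> k = k \<otimes>\<^bsub>A\<^esub> z" for z
    using that k by (intro y(4)) (simp_all add: x_def A.mult_diff_left A.mult_diff_right A.smul_mult_left A.smul_mult_right)
  have \<phi>x: "\<phi> x = \<ominus>\<^bsub>B\<^esub> (q \<otimes>\<^bsub>B\<^esub> q)"
  proof -
    have "\<phi> x = \<phi> k \<ominus>\<^bsub>B\<^esub> smul B (of_real e) \<one>\<^bsub>B\<^esub>"
      unfolding x_def using k cstar_hom_diff[OF A.cstar_algebra_axioms B.cstar_algebra_axioms \<phi>]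
      by (simp add: \<phi>D(3)[OF A.one_closed] one)
    then show ?thesis using k by (simp add: q(3) a_minus_def B.minus_add B.a_comm)
  qed
  have \<phi>y: "\<phi> y \<in> carrier B" "adj B (\<phi> y) = \<phi> y" "\<phi> (y \<otimes>\<^bsub>A\<^esub> y) = \<phi> y \<otimes>\<^bsub>B\<^esub> \<phi> y"
    using \<phi>D(1,2)[OF y(1)] \<phi>D(5)[OF y(1) y(1)] y(2) by simp_all
  have "\<phi> y \<otimes>\<^bsub>B\<^esub> \<phi> y = q \<otimes>\<^bsub>B\<^esub> q"
  proof (rule B.commuting_positive_root_unique)
    \<comment> \<open>Uniqueness of roots requires that \<phi> y and q commute: y commutes with k,
      so \<phi> y commutes with \<phi> k and therefore with q.\<close>
    have "k \<otimes>\<^bsub>A\<^esub> y = y \<otimes>\<^bsub>A\<^esub> k" using k by (intro comm) auto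
    then have "\<phi> y \<otimes>\<^bsub>B\<^esub> \<phi> k = \<phi> k \<otimes>\<^bsub>B\<^esub> \<phi> y"
      using \<phi>D(5)[OF y(1) k(1)] \<phi>D(5)[OF k(1) y(1)] by simp
    then show "\<phi> y \<otimes>\<^bsub>B\<^esub> q = q \<otimes>\<^bsub>B\<^esub> \<phi> y" by (rule q(4)[OF \<phi>y(1)])
    have yy: "y \<otimes>\<^bsub>A\<^esub> y \<in> carrier A" using y(1) by simp
    have "(\<phi> y \<otimes>\<^bsub>B\<^esub> \<phi> y) \<otimes>\<^bsub>B\<^esub> (\<phi> y \<otimes>\<^bsub>B\<^esub> \<phi> y) = \<phi> x \<otimes>\<^bsub>B\<^esub> \<phi> x"
      using \<phi>D(5)[OF yy yy] \<phi>D(5)[OF x(1) x(1)] by (simp add: \<phi>y(3) y(3))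
    then show "(\<phi> y \<otimes>\<^bsub>B\<^esub> \<phi> y) \<otimes>\<^bsub>B\<^esub> (\<phi> y \<otimes>\<^bsub>B\<^esub> \<phi> y) = (q \<otimes>\<^bsub>B\<^esub> q) \<otimes>\<^bsub>B\<^esub> (q \<otimes>\<^bsub>B\<^esub> q)"
      using q(1) by (simp add: \<phi>x B.mult_uminus_left B.mult_uminus_right)
  qed (use \<phi>y(1,2) q(1,2) in simp_all)
  moreover have "\<phi> (\<ominus>\<^bsub>A\<^esub> x) = q \<otimes>\<^bsub>B\<^esub> q"
  proof -
    have "\<phi> (\<ominus>\<^bsub>A\<^esub> x) = \<ominus>\<^bsub>B\<^esub> \<phi> x"
      using \<phi>D(3)[OF x(1), of "-1"] \<phi>D(1)[OF x(1)] x(1) by (simp add: A.smul_minus_one B.smul_minus_one)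
    then show ?thesis using q(1) by (simp add: \<phi>x)
  qed
  ultimately have "\<phi> (y \<otimes>\<^bsub>A\<^esub> y) = \<phi> (\<ominus>\<^bsub>A\<^esub> x)" by (simp add: \<phi>y)
  then have "y \<otimes>\<^bsub>A\<^esub> y = \<ominus>\<^bsub>A\<^esub> x" by (rule inj_onD[OF inj]) (use x(1) y(1) in simp_all)
  then have sum: "g \<otimes>\<^bsub>A\<^esub> g \<oplus>\<^bsub>A\<^esub> y \<otimes>\<^bsub>A\<^esub> y = smul A (of_real e) \<one>\<^bsub>A\<^esub>"
    using k(1) by (simp add: k_def[symmetric] x_def a_minus_def A.minus_add A.r_neg2)
  have "g \<otimes>\<^bsub>A\<^esub> y = y \<otimes>\<^bsub>A\<^esub> g"
    using g by (intro comm) (simp_all add: k_def A.mult_assoc)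
  then have "(nrm A g)\<^sup>2 \<le> nrm A (g \<otimes>\<^bsub>A\<^esub> g \<oplus>\<^bsub>A\<^esub> y \<otimes>\<^bsub>A\<^esub> y)"
    using g y(1,2) by (intro A.nrm_commuting_squares) auto
  also have "\<dots> \<le> e"
    using A.nrm_one_le e0 by (simp add: sum A.nrm_smul mult_left_le)
  finally show False using g(3) e(2) by simp
qed

section \<open>Unitization\<close>

text \<open>A pair (a, \<lambda>) stands for a + \<lambda> 1; this is its left multiplication on
  \<open>A\<close>.\<close>

definition unit_act :: "'a cstar \<Rightarrow> 'a \<times> complex \<Rightarrow> 'a \<Rightarrow> 'a" where
  "unit_act A u x = fst u \<otimes>\<^bsub>A\<^esub> x \<oplus>\<^bsub>A\<^esub> smul A (snd u) x"

text \<open>The operator norm, taken as the least admissible bound. A supremum of quotients would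
  range over the empty set when \<open>A\<close> is zero.\<close>

definition unit_act_norm :: "'a cstar \<Rightarrow> 'a \<times> complex \<Rightarrow> real" where
  "unit_act_norm A u = Inf {C. 0 \<le> C \<and> (\<forall>x\<in>carrier A. nrm A (unit_act A u x) \<le> C * nrm A x)}"

text \<open>The operator norm alone would vanish at \<open>(-1, 1)\<close> if \<open>A\<close> already had a unit.\<close>

definition unitization :: "'a cstar \<Rightarrow> ('a \<times> complex) cstar" where
  "unitization A = \<lparr>carrier = carrier A \<times> UNIV,
     mult = (\<lambda>u v. (fst u \<otimes>\<^bsub>A\<^esub> fst v \<oplus>\<^bsub>A\<^esub> (smul A (snd u) (fst v) \<oplus>\<^bsub>A\<^esub> smul A (snd v) (fst u)), snd u * snd v)),
     one = (\<zero>\<^bsub>A\<^esub>, 1), zero = (\<zero>\<^bsub>A\<^esub>, 0),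
     add = (\<lambda>u v. (fst u \<oplus>\<^bsub>A\<^esub> fst v, snd u + snd v)),
     smul = (\<lambda>k u. (smul A k (fst u), k * snd u)),
     adj = (\<lambda>u. (adj A (fst u), cnj (snd u))),
     nrm = (\<lambda>u. max (unit_act_norm A u) (cmod (snd u)))\<rparr>"

lemma unitization_simps [simp]:
  "carrier (unitization A) = carrier A \<times> UNIV"
  "u \<otimes>\<^bsub>unitization A\<^esub> v =
     (fst u \<otimes>\<^bsub>A\<^esub> fst v \<oplus>\<^bsub>A\<^esub> (smul A (snd u) (fst v) \<oplus>\<^bsub>A\<^esub> smul A (snd v) (fst u)), snd u * snd v)"
  "\<one>\<^bsub>unitization A\<^esub> = (\<zero>\<^bsub>A\<^esub>, 1)" "\<zero>\<^bsub>unitization A\<^esub> = (\<zero>\<^bsub>A\<^esub>, 0)"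
  "u \<oplus>\<^bsub>unitization A\<^esub> v = (fst u \<oplus>\<^bsub>A\<^esub> fst v, snd u + snd v)"
  "smul (unitization A) k u = (smul A k (fst u), k * snd u)"
  "adj (unitization A) u = (adj A (fst u), cnj (snd u))"
  "nrm (unitization A) u = max (unit_act_norm A u) (cmod (snd u))"
  by (simp_all add: unitization_def)

lemma le_of_square_le_mult: "(a::real)\<^sup>2 \<le> b * a \<Longrightarrow> 0 \<le> a \<Longrightarrow> 0 \<le> b \<Longrightarrow> a \<le> b"
  by (cases "a = 0") (simp_all add: power2_eq_square)

lemma max_square: "0 \<le> a \<Longrightarrow> 0 \<le> b \<Longrightarrow> max (a\<^sup>2) (b\<^sup>2) = (max a b :: real)\<^sup>2"
  by (cases "a \<le> b") (simp_all add: max_absorb1 max_absorb2 power_mono)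

text \<open>The metric properties of \<open>cdist\<close> were proved inside
  \<open>cstar_algebra\<close>, whose axioms already include completeness. This criterion starts
  from the norm axioms alone, so it can establish the completeness of the unitization.\<close>

lemma mcomplete_cdistI:
  assumes B: "abelian_group B"
    and nonneg: "\<And>x. x \<in> carrier B \<Longrightarrow> 0 \<le> nrm B x"
    and eq0: "\<And>x. x \<in> carrier B \<Longrightarrow> nrm B x = 0 \<longleftrightarrow> x = \<zero>\<^bsub>B\<^esub>"
    and tri: "\<And>x y. x \<in> carrier B \<Longrightarrow> y \<in> carrier B \<Longrightarrow> nrm B (x \<oplus>\<^bsub>B\<^esub> y) \<le> nrm B x + nrm B y"
    and minus: "\<And>x. x \<in> carrier B \<Longrightarrow> nrm B (\<ominus>\<^bsub>B\<^esub> x) = nrm B x"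
    and complete: "\<And>X. (\<And>n. X n \<in> carrier B) \<Longrightarrow>
      (\<And>e. e > 0 \<Longrightarrow> \<exists>N. \<forall>m\<ge>N. \<forall>n\<ge>N. nrm B (X m \<ominus>\<^bsub>B\<^esub> X n) < e) \<Longrightarrow>
      \<exists>l\<in>carrier B. (\<lambda>n. nrm B (X n \<ominus>\<^bsub>B\<^esub> l)) \<longlonglongrightarrow> 0"
  shows "Metric_space.mcomplete (carrier B) (cdist B)"
proof -
  interpret B: abelian_group B by (rule B)
  have cd: "cdist B x y = nrm B (x \<ominus>\<^bsub>B\<^esub> y)" if "x \<in> carrier B" "y \<in> carrier B" for x y
    using that by (simp add: cdist_def)
  interpret M: Metric_space "carrier B" "cdist B"
  proof
    show "0 \<le> cdist B x y" for x y by (simp add: cdist_def nonneg)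
    show "cdist B x y = cdist B y x" for x y
    proof (cases "x \<in> carrier B \<and> y \<in> carrier B")
      case True
      then have "\<ominus>\<^bsub>B\<^esub> (y \<ominus>\<^bsub>B\<^esub> x) = x \<ominus>\<^bsub>B\<^esub> y" by (simp add: a_minus_def B.minus_add B.a_comm)
      then show ?thesis using True minus[of "y \<ominus>\<^bsub>B\<^esub> x"] by (simp add: cd)
    qed (auto simp: cdist_def)
    show "cdist B x y = 0 \<longleftrightarrow> x = y" if "x \<in> carrier B" "y \<in> carrier B" for x y
    proof -
      have "(x \<ominus>\<^bsub>B\<^esub> y) \<oplus>\<^bsub>B\<^esub> y = x" using that by (simp add: a_minus_def B.a_assoc B.l_neg)
      then show ?thesis using that by (auto simp: cd eq0 a_minus_def B.r_neg)
    qed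
    show "cdist B x z \<le> cdist B x y + cdist B y z"
      if "x \<in> carrier B" "y \<in> carrier B" "z \<in> carrier B" for x y z
    proof -
      have "x \<ominus>\<^bsub>B\<^esub> z = (x \<ominus>\<^bsub>B\<^esub> y) \<oplus>\<^bsub>B\<^esub> (y \<ominus>\<^bsub>B\<^esub> z)"
        using that by (simp add: a_minus_def B.a_assoc B.r_neg1)
      then show ?thesis using that by (simp add: cd tri)
    qed
  qed
  show ?thesis
    unfolding M.mcomplete_def
  proof (intro allI impI)
    fix X assume X: "M.MCauchy X"
    have Xc: "X n \<in> carrier B" for n
      using X unfolding M.MCauchy_def by blast
    have ex: "\<exists>N. \<forall>m\<ge>N. \<forall>n\<ge>N. nrm B (X m \<ominus>\<^bsub>B\<^esub> X n) < e" if "e > 0" for e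
      using X that unfolding M.MCauchy_def by (metis cd Xc)
    obtain l where l: "l \<in> carrier B" "(\<lambda>n. nrm B (X n \<ominus>\<^bsub>B\<^esub> l)) \<longlonglongrightarrow> 0"
      using complete[OF Xc ex] by blast
    have "\<exists>N. \<forall>n\<ge>N. X n \<in> carrier B \<and> cdist B (X n) l < e" if "e > 0" for e
      using LIMSEQ_D[OF l(2) that] l(1) by (auto simp: cd Xc nonneg)
    then show "\<exists>l. limitin M.mtopology X l sequentially"
      unfolding M.limit_metric_sequentially using l(1) by blast
  qed
qed

context cstar_algebra begin

lemma unit_act_closed [simp]: "u \<in> carrier A \<times> UNIV \<Longrightarrow> x \<in> carrier A \<Longrightarrow> unit_act A u x \<in> carrier A"
  by (auto simp: unit_act_def)

lemma unit_act_norm_set: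
  assumes "u \<in> carrier A \<times> UNIV"
  shows "nrm A (fst u) + cmod (snd u) \<in> {C. 0 \<le> C \<and> (\<forall>x\<in>carrier A. nrm A (unit_act A u x) \<le> C * nrm A x)}"
proof -
  have "nrm A (unit_act A u x) \<le> (nrm A (fst u) + cmod (snd u)) * nrm A x" if x: "x \<in> carrier A" for x
  proof -
    have "nrm A (unit_act A u x) \<le> nrm A (fst u \<otimes> x) + nrm A (smul A (snd u) x)"
      using assms x unfolding unit_act_def by (intro nrm_triangle) auto
    also have "\<dots> \<le> nrm A (fst u) * nrm A x + cmod (snd u) * nrm A x"
      using assms x by (auto intro!: add_mono nrm_mult simp: nrm_smul)
    finally show ?thesis by (simp add: ring_distribs)
  qed
  moreover have "0 \<le> nrm A (fst u)" using assms nrm_nonneg[of "fst u"] by (auto simp: mem_Times_iff)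
  ultimately show ?thesis by simp
qed

lemma unit_act_norm_least:
  assumes "0 \<le> C" "\<And>x. x \<in> carrier A \<Longrightarrow> nrm A (unit_act A u x) \<le> C * nrm A x"
  shows "unit_act_norm A u \<le> C"
  unfolding unit_act_norm_def
  by (rule cInf_lower) (use assms in \<open>auto intro!: bdd_belowI[of _ 0]\<close>)

lemma unit_act_norm_le: "u \<in> carrier A \<times> UNIV \<Longrightarrow> unit_act_norm A u \<le> nrm A (fst u) + cmod (snd u)"
  using unit_act_norm_set[of u] by (intro unit_act_norm_least) auto

lemma unit_act_norm_nonneg: "u \<in> carrier A \<times> UNIV \<Longrightarrow> 0 \<le> unit_act_norm A u"
  unfolding unit_act_norm_def using unit_act_norm_set[of u] by (intro cInf_greatest) blast+

lemma unit_act_norm_bound: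
  assumes "u \<in> carrier A \<times> UNIV" and x: "x \<in> carrier A"
  shows "nrm A (unit_act A u x) \<le> unit_act_norm A u * nrm A x"
proof (cases "nrm A x = 0")
  case True
  then show ?thesis using unit_act_norm_set[OF assms(1)] x by force
next
  case False
  then have pos: "nrm A x > 0" using nrm_nonneg[OF x] by simp
  have "nrm A (unit_act A u x) / nrm A x \<le> unit_act_norm A u"
    unfolding unit_act_norm_def
    by (rule cInf_greatest) (use unit_act_norm_set[OF assms(1)] pos x in \<open>auto simp: field_simps\<close>)
  then show ?thesis using pos by (simp add: field_simps)
qed

text \<open>The lower bound comes from letting a act on its own adjoint. Thus \<open>A\<close> sits
  isometrically in its unitization.\<close>

lemma unit_act_norm_fst:
  assumes a: "a \<in> carrier A" shows "unit_act_norm A (a, 0) = nrm A a"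
proof (rule antisym)
  show "unit_act_norm A (a, 0) \<le> nrm A a" using unit_act_norm_le[of "(a, 0)"] a by simp
  have "(nrm A (adj A a))\<^sup>2 \<le> unit_act_norm A (a, 0) * nrm A (adj A a)"
    using unit_act_norm_bound[of "(a, 0)" "adj A a"] cstar_identity[of "adj A a"] a
    by (simp add: unit_act_def smul_zero_left adj_adj)
  then show "nrm A a \<le> unit_act_norm A (a, 0)"
    using nrm_nonneg[OF a] unit_act_norm_nonneg[of "(a, 0)"] a
    by (cases "nrm A a = 0") (auto simp: nrm_adj power2_eq_square)
qed

lemma unit_act_add:
  "u \<in> carrier A \<times> UNIV \<Longrightarrow> v \<in> carrier A \<times> UNIV \<Longrightarrow> x \<in> carrier A \<Longrightarrow>
    unit_act A (u \<oplus>\<^bsub>unitization A\<^esub> v) x = unit_act A u x \<oplus> unit_act A v x"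
  by (auto simp: unit_act_def distrib_right smul_add_left a_ac)

lemma unit_act_mult:
  "u \<in> carrier A \<times> UNIV \<Longrightarrow> v \<in> carrier A \<times> UNIV \<Longrightarrow> x \<in> carrier A \<Longrightarrow>
    unit_act A (u \<otimes>\<^bsub>unitization A\<^esub> v) x = unit_act A u (unit_act A v x)"
  by (auto simp: unit_act_def distrib_right distrib_left smul_add_right smul_smul smul_mult_left
      smul_mult_right mult_assoc a_ac)

lemma unit_act_smul:
  "u \<in> carrier A \<times> UNIV \<Longrightarrow> x \<in> carrier A \<Longrightarrow>
    unit_act A (smul (unitization A) k u) x = smul A k (unit_act A u x)"
  by (auto simp: unit_act_def smul_add_right smul_smul smul_mult_left)

lemma unit_act_adj:
  "u \<in> carrier A \<times> UNIV \<Longrightarrow> x \<in> carrier A \<Longrightarrow> y \<in> carrier A \<Longrightarrow>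
    adj A (unit_act A u x) \<otimes> y = adj A x \<otimes> unit_act A (adj (unitization A) u) y"
  by (auto simp: unit_act_def adj_add adj_mult adj_smul distrib_right distrib_left smul_mult_left
      smul_mult_right mult_assoc)

lemma abelian_group_unitization: "abelian_group (unitization A)"
proof (rule abelian_groupI)
  fix u assume "u \<in> carrier (unitization A)"
  then show "\<exists>v\<in>carrier (unitization A). v \<oplus>\<^bsub>unitization A\<^esub> u = \<zero>\<^bsub>unitization A\<^esub>"
    by (intro bexI[of _ "(\<ominus> fst u, - snd u)"]) (auto simp: l_neg)
qed (auto simp: a_ac)

lemma unitization_uminus: "u \<in> carrier A \<times> UNIV \<Longrightarrow> \<ominus>\<^bsub>unitization A\<^esub> u = (\<ominus> fst u, - snd u)"
  by (intro abelian_group.minus_equality[OF abelian_group_unitization]) (auto simp: l_neg)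

lemma unitization_diff: "u \<in> carrier A \<times> UNIV \<Longrightarrow> v \<in> carrier A \<times> UNIV \<Longrightarrow>
    u \<ominus>\<^bsub>unitization A\<^esub> v = (fst u \<ominus> fst v, snd u - snd v)"
  by (simp add: a_minus_def unitization_uminus)

lemma nrm_unitization_le: "u \<in> carrier A \<times> UNIV \<Longrightarrow> nrm (unitization A) u \<le> nrm A (fst u) + cmod (snd u)"
  using unit_act_norm_le[of u] nrm_nonneg[of "fst u"] by (auto simp: mem_Times_iff)

lemma unit_act_norm_triangle:
  assumes "u \<in> carrier A \<times> UNIV" "v \<in> carrier A \<times> UNIV"
  shows "unit_act_norm A (u \<oplus>\<^bsub>unitization A\<^esub> v) \<le> unit_act_norm A u + unit_act_norm A v"
proof (rule unit_act_norm_least)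
  show "0 \<le> unit_act_norm A u + unit_act_norm A v"
    using assms by (intro add_nonneg_nonneg unit_act_norm_nonneg)
  fix x assume x: "x \<in> carrier A"
  have "nrm A (unit_act A (u \<oplus>\<^bsub>unitization A\<^esub> v) x) \<le> nrm A (unit_act A u x) + nrm A (unit_act A v x)"
    unfolding unit_act_add[OF assms x] using assms x by (intro nrm_triangle unit_act_closed)
  also have "\<dots> \<le> unit_act_norm A u * nrm A x + unit_act_norm A v * nrm A x"
    using assms x by (intro add_mono unit_act_norm_bound)
  finally show "nrm A (unit_act A (u \<oplus>\<^bsub>unitization A\<^esub> v) x) \<le> (unit_act_norm A u + unit_act_norm A v) * nrm A x"
    by (simp only: ring_distribs)
qed

lemma unit_act_norm_mult:
  assumes "u \<in> carrier A \<times> UNIV" "v \<in> carrier A \<times> UNIV"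
  shows "unit_act_norm A (u \<otimes>\<^bsub>unitization A\<^esub> v) \<le> unit_act_norm A u * unit_act_norm A v"
proof (rule unit_act_norm_least)
  show "0 \<le> unit_act_norm A u * unit_act_norm A v"
    using assms by (intro mult_nonneg_nonneg unit_act_norm_nonneg)
  fix x assume x: "x \<in> carrier A"
  have "nrm A (unit_act A (u \<otimes>\<^bsub>unitization A\<^esub> v) x) \<le> unit_act_norm A u * nrm A (unit_act A v x)"
    unfolding unit_act_mult[OF assms x] using assms x by (intro unit_act_norm_bound unit_act_closed)
  also have "\<dots> \<le> unit_act_norm A u * (unit_act_norm A v * nrm A x)"
    using assms x by (intro mult_left_mono unit_act_norm_bound unit_act_norm_nonneg)
  finally show "nrm A (unit_act A (u \<otimes>\<^bsub>unitization A\<^esub> v) x) \<le> unit_act_norm A u * unit_act_norm A v * nrm A x"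
    by (simp only: mult.assoc)
qed

lemma unit_act_norm_smul_le:
  assumes "u \<in> carrier A \<times> UNIV"
  shows "unit_act_norm A (smul (unitization A) k u) \<le> cmod k * unit_act_norm A u"
proof (rule unit_act_norm_least)
  show "0 \<le> cmod k * unit_act_norm A u" using assms by (intro mult_nonneg_nonneg unit_act_norm_nonneg norm_ge_zero)
  fix x assume x: "x \<in> carrier A"
  show "nrm A (unit_act A (smul (unitization A) k u) x) \<le> cmod k * unit_act_norm A u * nrm A x"
    unfolding unit_act_smul[OF assms x] using assms x
    by (simp only: nrm_smul unit_act_closed mult.assoc) (intro mult_left_mono unit_act_norm_bound norm_ge_zero)
qed

lemma unit_act_norm_smul:
  assumes "u \<in> carrier A \<times> UNIV"
  shows "unit_act_norm A (smul (unitization A) k u) = cmod k * unit_act_norm A u"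
proof (cases "k = 0")
  case True
  then show ?thesis
    using assms unit_act_norm_smul_le[OF assms, of 0] unit_act_norm_nonneg[of "smul (unitization A) 0 u"] by auto
next
  case False
  have "unit_act_norm A u \<le> cmod (1 / k) * unit_act_norm A (smul (unitization A) k u)"
    using unit_act_norm_smul_le[of "smul (unitization A) k u" "1 / k"] assms False
    by (auto simp: smul_smul smul_one)
  then have "cmod k * unit_act_norm A u \<le> unit_act_norm A (smul (unitization A) k u)"
    using False by (simp add: norm_divide field_simps)
  then show ?thesis using unit_act_norm_smul_le[OF assms, of k] by simp
qed

text \<open>\<parallel>v x\<parallel>^2 is the norm of adj x (adj v v x), whence
  \<parallel>v\<parallel>^2 \<le> \<parallel>adj v v\<parallel>. This inequality already implies
  \<parallel>v\<parallel> \<le> \<parallel>adj v\<parallel>, and applied to adj u it yields the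
  reverse bound.\<close>

lemma unit_act_norm_adj_mult:
  assumes u: "u \<in> carrier A \<times> UNIV"
  shows "unit_act_norm A (adj (unitization A) u \<otimes>\<^bsub>unitization A\<^esub> u) = (unit_act_norm A u)\<^sup>2"
proof -
  have le: "(unit_act_norm A v)\<^sup>2 \<le> unit_act_norm A (adj (unitization A) v \<otimes>\<^bsub>unitization A\<^esub> v)"
    if v: "v \<in> carrier A \<times> UNIV" for v
  proof -
    let ?w = "adj (unitization A) v \<otimes>\<^bsub>unitization A\<^esub> v"
    have v': "adj (unitization A) v \<in> carrier A \<times> UNIV" and w: "?w \<in> carrier A \<times> UNIV"
      using v by (auto simp: mem_Times_iff)
    have "unit_act_norm A v \<le> sqrt (unit_act_norm A ?w)"
    proof (rule unit_act_norm_least)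
      fix x assume x: "x \<in> carrier A"
      have "(nrm A (unit_act A v x))\<^sup>2 = nrm A (adj A x \<otimes> unit_act A ?w x)"
        using v v' x by (simp only: unit_act_adj unit_act_mult unit_act_closed cstar_identity[symmetric])
      also have "\<dots> \<le> nrm A x * (unit_act_norm A ?w * nrm A x)"
        using nrm_mult[of "adj A x" "unit_act A ?w x"] unit_act_norm_bound[OF w x] w x nrm_nonneg[OF x]
        by (intro order_trans[OF nrm_mult] mult_mono) (simp_all only: nrm_adj adj_closed unit_act_closed order_refl nrm_nonneg)
      finally have "(nrm A (unit_act A v x))\<^sup>2 \<le> (sqrt (unit_act_norm A ?w) * nrm A x)\<^sup>2"
        using unit_act_norm_nonneg[OF w] by (simp only: power_mult_distrib real_sqrt_pow2) (simp only: power2_eq_square mult_ac)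
      then show "nrm A (unit_act A v x) \<le> sqrt (unit_act_norm A ?w) * nrm A x"
        using unit_act_norm_nonneg[OF w] nrm_nonneg[OF x] by (intro power2_le_imp_le[OF _ mult_nonneg_nonneg]) auto
    qed (use unit_act_norm_nonneg[OF w] in \<open>simp only: real_sqrt_ge_0_iff\<close>)
    then have "(unit_act_norm A v)\<^sup>2 \<le> (sqrt (unit_act_norm A ?w))\<^sup>2"
      using unit_act_norm_nonneg[OF v] by (rule power_mono)
    then show ?thesis by (simp only: real_sqrt_pow2[OF unit_act_norm_nonneg[OF w]])
  qed
  have adj_le: "unit_act_norm A v \<le> unit_act_norm A (adj (unitization A) v)" if v: "v \<in> carrier A \<times> UNIV" for v
  proof -
    have v': "adj (unitization A) v \<in> carrier A \<times> UNIV" using v by (auto simp: mem_Times_iff)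
    have "(unit_act_norm A v)\<^sup>2 \<le> unit_act_norm A (adj (unitization A) v) * unit_act_norm A v"
      using le[OF v] unit_act_norm_mult[OF v' v] by (rule order_trans)
    then show ?thesis
      using unit_act_norm_nonneg[OF v] unit_act_norm_nonneg[OF v'] by (rule le_of_square_le_mult)
  qed
  have u': "adj (unitization A) u \<in> carrier A \<times> UNIV" using u by (auto simp: mem_Times_iff)
  have "adj (unitization A) (adj (unitization A) u) = u" using u by (auto simp: adj_adj)
  then have "unit_act_norm A (adj (unitization A) u) \<le> unit_act_norm A u" using adj_le[OF u'] by simp
  then have "unit_act_norm A (adj (unitization A) u \<otimes>\<^bsub>unitization A\<^esub> u) \<le> (unit_act_norm A u)\<^sup>2"
    using unit_act_norm_mult[OF u' u] mult_right_mono[OF _ unit_act_norm_nonneg[OF u]]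
    unfolding power2_eq_square by (blast intro: order_trans)
  then show ?thesis using le[OF u] by (rule antisym)
qed

text \<open>The scalar term of the maximum forces \<lambda> = 0; then the isometric embedding of
  \<open>A\<close> applies.\<close>

lemma unit_act_norm_eq_0:
  assumes u: "u \<in> carrier A \<times> UNIV" shows "nrm (unitization A) u = 0 \<longleftrightarrow> u = \<zero>\<^bsub>unitization A\<^esub>"
proof
  assume 0: "nrm (unitization A) u = 0"
  then have "cmod (snd u) \<le> 0" using max.cobounded2[of "cmod (snd u)" "unit_act_norm A u"] by simp
  then have "u = (fst u, 0)" by (simp add: prod_eq_iff)
  moreover have "fst u \<in> carrier A" using u by auto
  ultimately have "nrm A (fst u) = 0" using 0 unit_act_norm_fst[of "fst u"] nrm_nonneg[of "fst u"] by simp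
  then have "fst u = \<zero>" using \<open>fst u \<in> carrier A\<close> by (simp add: nrm_eq_0)
  then show "u = \<zero>\<^bsub>unitization A\<^esub>" using \<open>u = (fst u, 0)\<close> by simp
qed (simp add: unit_act_norm_fst)

text \<open>(a, 0) is (a, \<lambda>) minus (0, \<lambda>), and the norm of (a, \<lambda>) bounds
  both terms. This makes the first components of a Cauchy sequence Cauchy.\<close>

lemma nrm_fst_le:
  assumes u: "u \<in> carrier A \<times> UNIV" shows "nrm A (fst u) \<le> 2 * nrm (unitization A) u"
proof -
  have c: "fst u \<in> carrier A" using u by auto
  have "(fst u, 0) = u \<oplus>\<^bsub>unitization A\<^esub> (\<zero>, - snd u)" using c by simp
  then have "nrm A (fst u) \<le> unit_act_norm A u + unit_act_norm A (\<zero>, - snd u)"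
    using unit_act_norm_triangle[of u "(\<zero>, - snd u)"] u unit_act_norm_fst[OF c] by simp
  also have "unit_act_norm A (\<zero>, - snd u) \<le> cmod (snd u)"
    using unit_act_norm_le[of "(\<zero>, - snd u)"] by simp
  finally show ?thesis by simp
qed

lemma cstar_algebra_unitization: "cstar_algebra (unitization A)"
proof -
  let ?U = "unitization A"
  have tri: "nrm ?U (u \<oplus>\<^bsub>?U\<^esub> v) \<le> nrm ?U u + nrm ?U v" if "u \<in> carrier ?U" "v \<in> carrier ?U" for u v
    using unit_act_norm_triangle[of u v] that norm_triangle_ineq[of "snd u" "snd v"] by simp linarith
  have smul: "nrm ?U (smul ?U k u) = cmod k * nrm ?U u" if "u \<in> carrier ?U" for k u
    using unit_act_norm_smul[of u k] that by (simp add: norm_mult max_mult_distrib_left)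
  have nonneg: "0 \<le> nrm ?U u" for u by (simp add: le_max_iff_disj)
  have complete: "Metric_space.mcomplete (carrier ?U) (cdist ?U)"
  proof (rule mcomplete_cdistI[OF abelian_group_unitization nonneg _ tri])
    show "nrm ?U u = 0 \<longleftrightarrow> u = \<zero>\<^bsub>?U\<^esub>" if "u \<in> carrier ?U" for u
      using unit_act_norm_eq_0 that by simp
    show "nrm ?U (\<ominus>\<^bsub>?U\<^esub> u) = nrm ?U u" if "u \<in> carrier ?U" for u
    proof -
      have "\<ominus>\<^bsub>?U\<^esub> u = smul ?U (-1) u" using that by (auto simp: unitization_uminus smul_minus_one)
      then show ?thesis using smul[OF that, of "-1"] by simp
    qed
    fix X :: "nat \<Rightarrow> 'a \<times> complex" assume X: "\<And>n. X n \<in> carrier ?U"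
      and Cauchy: "\<And>e. e > 0 \<Longrightarrow> \<exists>N. \<forall>m\<ge>N. \<forall>n\<ge>N. nrm ?U (X m \<ominus>\<^bsub>?U\<^esub> X n) < e"
    have Xc: "X n \<in> carrier A \<times> UNIV" "fst (X n) \<in> carrier A" for n using X[of n] by auto
    have diff: "X m \<ominus>\<^bsub>?U\<^esub> X n = (fst (X m) \<ominus> fst (X n), snd (X m) - snd (X n))" for m n
      by (rule unitization_diff[OF Xc(1) Xc(1)])
    obtain a where a: "conv (\<lambda>n. fst (X n)) a"
    proof (rule Cauchy_conv)
      fix e :: real assume "e > 0"
      then obtain N where N: "\<forall>m\<ge>N. \<forall>n\<ge>N. nrm ?U (X m \<ominus>\<^bsub>?U\<^esub> X n) < e / 2" using Cauchy[of "e / 2"] by auto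
      have "nrm A (fst (X m) \<ominus> fst (X n)) < e" if "m \<ge> N" "n \<ge> N" for m n
      proof -
        have "X m \<ominus>\<^bsub>?U\<^esub> X n \<in> carrier A \<times> UNIV" using Xc by (simp add: diff)
        then have "nrm A (fst (X m \<ominus>\<^bsub>?U\<^esub> X n)) \<le> 2 * nrm ?U (X m \<ominus>\<^bsub>?U\<^esub> X n)" by (rule nrm_fst_le)
        also have "\<dots> < e" using N[rule_format, OF that] by linarith
        finally show ?thesis by (simp only: diff fst_conv)
      qed
      then show "\<exists>N. \<forall>m\<ge>N. \<forall>n\<ge>N. nrm A (fst (X m) \<ominus> fst (X n)) < e" by blast
    qed (rule Xc(2))
    have "Cauchy (\<lambda>n. snd (X n))"
    proof (rule CauchyI)
      fix e :: real assume "e > 0"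
      then obtain N where N: "\<forall>m\<ge>N. \<forall>n\<ge>N. nrm ?U (X m \<ominus>\<^bsub>?U\<^esub> X n) < e" using Cauchy[of e] by auto
      have "cmod (snd (X m) - snd (X n)) < e" if "m \<ge> N" "n \<ge> N" for m n
        using N that by (auto simp: diff)
      then show "\<exists>M. \<forall>m\<ge>M. \<forall>n\<ge>M. norm (snd (X m) - snd (X n)) < e" by blast
    qed
    then obtain k where k: "(\<lambda>n. snd (X n)) \<longlonglongrightarrow> k" using Cauchy_convergent convergent_def by blast
    have ac: "a \<in> carrier A" by (rule conv_carrier[OF a])
    have "(\<lambda>n. nrm ?U (X n \<ominus>\<^bsub>?U\<^esub> (a, k))) \<longlonglongrightarrow> 0"
    proof (rule Lim_null_comparison)
      show "(\<lambda>n. nrm A (fst (X n) \<ominus> a) + cmod (snd (X n) - k)) \<longlonglongrightarrow> 0"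
        using conv_lim[OF a] k by (intro tendsto_add_zero tendsto_norm_zero LIM_zero)
      have "norm (nrm ?U (X n \<ominus>\<^bsub>?U\<^esub> (a, k))) \<le> nrm A (fst (X n) \<ominus> a) + cmod (snd (X n) - k)" for n
      proof -
        have d: "X n \<ominus>\<^bsub>?U\<^esub> (a, k) = (fst (X n) \<ominus> a, snd (X n) - k)"
          using unitization_diff[OF Xc(1), of "(a, k)" n] ac by simp
        have "nrm ?U (X n \<ominus>\<^bsub>?U\<^esub> (a, k)) \<le> nrm A (fst (X n) \<ominus> a) + cmod (snd (X n) - k)"
          unfolding d using nrm_unitization_le[of "(fst (X n) \<ominus> a, snd (X n) - k)"] Xc(2)[of n] ac
          by (simp del: unitization_simps(8))
        then show ?thesis using nonneg[of "X n \<ominus>\<^bsub>?U\<^esub> (a, k)"] by (simp only: real_norm_def abs_of_nonneg)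
      qed
      then show "\<forall>\<^sub>F n in sequentially. norm (nrm ?U (X n \<ominus>\<^bsub>?U\<^esub> (a, k))) \<le> nrm A (fst (X n) \<ominus> a) + cmod (snd (X n) - k)"
        by (intro always_eventually allI)
    qed
    then show "\<exists>l\<in>carrier ?U. (\<lambda>n. nrm ?U (X n \<ominus>\<^bsub>?U\<^esub> l)) \<longlonglongrightarrow> 0"
      using ac by (intro bexI[of _ "(a, k)"]) auto
  qed
  interpret U: abelian_group ?U by (rule abelian_group_unitization)
  show ?thesis
  proof
    fix u v w assume u: "u \<in> carrier ?U" and v: "v \<in> carrier ?U" and w: "w \<in> carrier ?U"
    show "(u \<otimes>\<^bsub>?U\<^esub> v) \<otimes>\<^bsub>?U\<^esub> w = u \<otimes>\<^bsub>?U\<^esub> (v \<otimes>\<^bsub>?U\<^esub> w)"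
      using u v w by (auto simp: mult_assoc distrib_left distrib_right smul_add_right smul_smul
          smul_mult_left smul_mult_right a_ac mult.commute)
    show "w \<otimes>\<^bsub>?U\<^esub> (u \<oplus>\<^bsub>?U\<^esub> v) = w \<otimes>\<^bsub>?U\<^esub> u \<oplus>\<^bsub>?U\<^esub> w \<otimes>\<^bsub>?U\<^esub> v"
      using u v w by (auto simp: distrib_left smul_add_right smul_add_left a_ac ring_distribs)
    show "(u \<oplus>\<^bsub>?U\<^esub> v) \<otimes>\<^bsub>?U\<^esub> w = u \<otimes>\<^bsub>?U\<^esub> w \<oplus>\<^bsub>?U\<^esub> v \<otimes>\<^bsub>?U\<^esub> w"
      using u v w by (auto simp: distrib_right smul_add_right smul_add_left a_ac ring_distribs)
  next
    fix u v assume u: "u \<in> carrier ?U" and v: "v \<in> carrier ?U"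
    show "nrm ?U (u \<otimes>\<^bsub>?U\<^esub> v) \<le> nrm ?U u * nrm ?U v"
    proof -
      have "unit_act_norm A (u \<otimes>\<^bsub>?U\<^esub> v) \<le> nrm ?U u * nrm ?U v"
        using unit_act_norm_mult[of u v] u v unit_act_norm_nonneg[of v]
        by (intro order_trans[OF unit_act_norm_mult] mult_mono) (auto simp: le_max_iff_disj)
      moreover have "cmod (snd (u \<otimes>\<^bsub>?U\<^esub> v)) \<le> nrm ?U u * nrm ?U v"
        by (auto simp: norm_mult le_max_iff_disj intro!: mult_mono)
      ultimately show ?thesis by (simp only: unitization_simps(8) max.bounded_iff)
    qed
    show "adj ?U (u \<otimes>\<^bsub>?U\<^esub> v) = adj ?U v \<otimes>\<^bsub>?U\<^esub> adj ?U u"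
      using u v by (auto simp: adj_mult adj_add adj_smul a_ac)
    show "nrm ?U (u \<oplus>\<^bsub>?U\<^esub> v) \<le> nrm ?U u + nrm ?U v" by (rule tri[OF u v])
  next
    fix u assume u: "u \<in> carrier ?U"
    show "nrm ?U (adj ?U u \<otimes>\<^bsub>?U\<^esub> u) = (nrm ?U u)\<^sup>2"
    proof -
      have u': "u \<in> carrier A \<times> UNIV" using u by simp
      have "cmod (snd (adj ?U u \<otimes>\<^bsub>?U\<^esub> u)) = (cmod (snd u))\<^sup>2" by (simp add: norm_mult power2_eq_square)
      then have "nrm ?U (adj ?U u \<otimes>\<^bsub>?U\<^esub> u) = max ((unit_act_norm A u)\<^sup>2) ((cmod (snd u))\<^sup>2)"
        by (simp only: unitization_simps(8) unit_act_norm_adj_mult[OF u'])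
      also have "\<dots> = (nrm ?U u)\<^sup>2"
        using unit_act_norm_nonneg[OF u'] by (simp only: unitization_simps(8) max_square norm_ge_zero)
      finally show ?thesis .
    qed
    show "nrm ?U u = 0 \<longleftrightarrow> u = \<zero>\<^bsub>?U\<^esub>" using unit_act_norm_eq_0 u by simp
    show "nrm ?U (smul ?U c u) = cmod c * nrm ?U u" for c by (rule smul[OF u])
    show "0 \<le> nrm ?U u" by (rule nonneg)
  next
    show "Metric_space.mcomplete (carrier ?U) (cdist ?U)" by (rule complete)
  qed (auto simp: smul_add_right smul_add_left smul_smul smul_one smul_mult_left smul_mult_right
      adj_adj adj_add adj_smul a_ac ring_distribs mult.commute mult.left_commute)
qed

lemma unital_unitization: "unital_cstar_algebra (unitization A)"
  by (intro unital_cstar_algebra.intro cstar_algebra_unitization unital_cstar_algebra_axioms.intro)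
    (auto simp: smul_one)

end

text \<open>Extending \<phi> by the identity on scalars makes it unital and keeps it injective. The
  self-adjoint case is then applied to the product of the adjoint of x with x.\<close>

lemma cstar_hom_isometric:
  assumes A: "cstar_algebra A" and B: "cstar_algebra B" and \<phi>: "\<phi> \<in> cstar_hom A B"
    and inj: "inj_on \<phi> (carrier A)" and x: "x \<in> carrier A"
  shows "nrm B (\<phi> x) = nrm A x"
proof (rule antisym[OF cstar_hom_contractive[OF A B \<phi> x]])
  interpret A: cstar_algebra A by fact
  interpret B: cstar_algebra B by fact
  note \<phi>D = cstar_homD[OF \<phi>]
  let ?f = "map_prod \<phi> id"
  have f: "?f \<in> cstar_hom (unitization A) (unitization B)"
    unfolding cstar_hom_def by (auto simp: \<phi>D)
  have f1: "?f \<one>\<^bsub>unitization A\<^esub> = \<one>\<^bsub>unitization B\<^esub>" using cstar_hom_zero[OF A B \<phi>] by simp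
  have fi: "inj_on ?f (carrier (unitization A))"
    using inj by (auto simp: inj_on_def)
  let ?h = "adj A x \<otimes>\<^bsub>A\<^esub> x"
  have h: "?h \<in> carrier A" using x by simp
  have "nrm (unitization A) (?h, 0) \<le> nrm (unitization B) (?f (?h, 0))"
    by (rule unital_injective_hom_selfadjoint[OF A.unital_unitization B.unital_unitization f f1 fi])
      (use x in \<open>simp_all add: A.adj_mult A.adj_adj\<close>)
  then have "nrm A ?h \<le> nrm B (\<phi> ?h)"
    using h \<phi>D(1)[OF h] A.nrm_nonneg[OF h] B.nrm_nonneg[OF \<phi>D(1)[OF h]]
    by (simp add: A.unit_act_norm_fst B.unit_act_norm_fst)
  also have "\<phi> ?h = adj B (\<phi> x) \<otimes>\<^bsub>B\<^esub> \<phi> x" using x \<phi>D(5)[of "adj A x" x] \<phi>D(2)[OF x] by simp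
  finally have "(nrm A x)\<^sup>2 \<le> (nrm B (\<phi> x))\<^sup>2"
    using x \<phi>D(1)[OF x] by (simp add: A.cstar_identity B.cstar_identity)
  then show "nrm A x \<le> nrm B (\<phi> x)" using B.nrm_nonneg[OF \<phi>D(1)[OF x]] by (rule power2_le_imp_le)
qed

section \<open>Subalgebras and tensor products\<close>

lemma cstar_generated_subset: "cstar_subalgebra S A \<Longrightarrow> X \<subseteq> S \<Longrightarrow> cstar_generated A X \<subseteq> S"
  by (auto simp: cstar_generated_def)

context cstar_algebra begin

lemma cstar_subalgebra_closure:
  assumes S: "S \<subseteq> carrier A" "\<zero> \<in> S" and add: "\<And>x y. x \<in> S \<Longrightarrow> y \<in> S \<Longrightarrow> x \<oplus> y \<in> S"
    and mult: "\<And>x y. x \<in> S \<Longrightarrow> y \<in> S \<Longrightarrow> x \<otimes> y \<in> S" and adj: "\<And>x. x \<in> S \<Longrightarrow> adj A x \<in> S"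
    and smul: "\<And>x c. x \<in> S \<Longrightarrow> smul A c x \<in> S"
  shows "cstar_subalgebra (Abstract_Topology.closure_of (norm_topology A) S) A"
proof -
  interpret M: Metric_space "carrier A" "cdist A" by (rule Metric_space_cdist)
  let ?C = "Abstract_Topology.closure_of (norm_topology A) S"
  have sub: "?C \<subseteq> carrier A" using closure_of_subset_topspace[of M.mtopology S] by simp
  note C = in_closure_conv[OF S(1)] and I = conv_in_closure[OF S(1)]
  show ?thesis
    unfolding cstar_subalgebra_def
  proof (intro conjI ballI allI)
    show "?C \<subseteq> carrier A" by (rule sub)
    show "\<zero> \<in> ?C" using S(2) by (intro I[of "\<lambda>_. \<zero>"] conv_const) auto
    show "closedin M.mtopology ?C" by simp
    fix x assume "x \<in> ?C"
    then obtain X where X: "\<And>n. X n \<in> S" "conv X x" using C by metis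
    show "adj A x \<in> ?C" by (rule I[OF _ conv_adj[OF X(2)]]) (rule adj[OF X(1)])
    show "smul A c x \<in> ?C" for c by (rule I[OF _ conv_smul[OF X(2)]]) (rule smul[OF X(1)])
    fix y assume "y \<in> ?C"
    then obtain Y where Y: "\<And>n. Y n \<in> S" "conv Y y" using C by metis
    show "x \<oplus> y \<in> ?C" by (rule I[OF _ conv_add[OF X(2) Y(2)]]) (rule add[OF X(1) Y(1)])
    show "x \<otimes> y \<in> ?C" by (rule I[OF _ conv_mult[OF X(2) Y(2)]]) (rule mult[OF X(1) Y(1)])
  qed
qed

lemma cstar_subalgebraI:
  assumes "S \<subseteq> carrier A" "\<zero> \<in> S" "\<And>x y. x \<in> S \<Longrightarrow> y \<in> S \<Longrightarrow> x \<oplus> y \<in> S"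
    "\<And>x y. x \<in> S \<Longrightarrow> y \<in> S \<Longrightarrow> x \<otimes> y \<in> S" "\<And>x. x \<in> S \<Longrightarrow> adj A x \<in> S"
    "\<And>x c. x \<in> S \<Longrightarrow> smul A c x \<in> S" "\<And>X l. (\<And>n. X n \<in> S) \<Longrightarrow> conv X l \<Longrightarrow> l \<in> S"
  shows "cstar_subalgebra S A"
proof -
  have "closedin (norm_topology A) S" by (rule closedI[OF assms(1,7)])
  then show ?thesis unfolding cstar_subalgebra_def by (simp add: assms(1-6))
qed

lemma finsum_in_subalgebra:
  assumes S: "cstar_subalgebra S A" and f: "\<And>i. i \<in> I \<Longrightarrow> f i \<in> S"
  shows "finsum A f I \<in> S"
proof -
  have S': "S \<subseteq> carrier A" "\<zero> \<in> S" "\<And>x y. x \<in> S \<Longrightarrow> y \<in> S \<Longrightarrow> x \<oplus> y \<in> S"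
    using S by (auto simp: cstar_subalgebra_def)
  show ?thesis
  proof (cases "finite I")
    case True
    then show ?thesis using f
    proof (induction I rule: finite_induct)
      case (insert i I)
      then have "finsum A f (insert i I) = f i \<oplus> finsum A f I"
        using S' by (intro finsum_insert) auto
      then show ?case using insert S' by simp
    qed (simp add: S')
  qed (simp add: finsum_infinite S')
qed

end

lemma cstar_hom_conv:
  assumes A: "cstar_algebra A" and B: "cstar_algebra B" and \<phi>: "\<phi> \<in> cstar_hom A B"
    and X: "cstar_algebra.conv A X x"
  shows "cstar_algebra.conv B (\<lambda>n. \<phi> (X n)) (\<phi> x)"
proof -
  interpret A: cstar_algebra A by fact
  interpret B: cstar_algebra B by fact
  note c = A.conv_carrier[OF X]
  show ?thesis
  proof (rule B.convI[OF _ _ _ A.conv_lim[OF X]])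
    show "nrm B (\<phi> (X n) \<ominus>\<^bsub>B\<^esub> \<phi> x) \<le> nrm A (X n \<ominus>\<^bsub>A\<^esub> x)" for n
      using cstar_hom_contractive[OF A B \<phi>, of "X n \<ominus>\<^bsub>A\<^esub> x"] cstar_hom_diff[OF A B \<phi> c(1) c(2)] c by simp
  qed (use c in \<open>simp_all add: cstar_homD[OF \<phi>]\<close>)
qed

lemma cstar_hom_eq_on_generated:
  assumes A: "cstar_algebra A" and B: "cstar_algebra B" and \<phi>: "\<phi> \<in> cstar_hom A B" and \<psi>: "\<psi> \<in> cstar_hom A B"
    and X: "X \<subseteq> carrier A" and eq: "\<And>x. x \<in> X \<Longrightarrow> \<phi> x = \<psi> x" and x: "x \<in> cstar_generated A X"
  shows "\<phi> x = \<psi> x"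
proof -
  interpret A: cstar_algebra A by fact
  interpret B: cstar_algebra B by fact
  let ?S = "{x \<in> carrier A. \<phi> x = \<psi> x}"
  have "cstar_subalgebra ?S A"
  proof (rule A.cstar_subalgebraI)
    fix Y l assume Y: "\<And>n. Y n \<in> ?S" "A.conv Y l"
    then have "B.conv (\<lambda>n. \<psi> (Y n)) (\<phi> l)" using cstar_hom_conv[OF A B \<phi> Y(2)] by simp
    then show "l \<in> ?S"
      using B.conv_unique[OF cstar_hom_conv[OF A B \<psi> Y(2)]] A.conv_carrier(2)[OF Y(2)] by simp
  qed (auto simp: cstar_homD[OF \<phi>] cstar_homD[OF \<psi>] cstar_hom_zero[OF A B \<phi>] cstar_hom_zero[OF A B \<psi>])
  then show ?thesis
    using cstar_generated_subset[of ?S A X] X eq x by blast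
qed

text \<open>The range is closed because \<phi> is isometric: the preimages of a convergent sequence
  form a Cauchy sequence.\<close>

lemma cstar_subalgebra_range:
  assumes A: "cstar_algebra A" and B: "cstar_algebra B" and \<phi>: "\<phi> \<in> cstar_hom A B"
    and inj: "inj_on \<phi> (carrier A)"
  shows "cstar_subalgebra (\<phi> ` carrier A) B"
proof -
  interpret A: cstar_algebra A by fact
  interpret B: cstar_algebra B by fact
  note \<phi>D = cstar_homD[OF \<phi>]
  show ?thesis
  proof (rule B.cstar_subalgebraI)
    show "\<phi> ` carrier A \<subseteq> carrier B" by (auto simp: \<phi>D)
    show "\<zero>\<^bsub>B\<^esub> \<in> \<phi> ` carrier A" using cstar_hom_zero[OF A B \<phi>] by (metis A.zero_closed imageI)
  next
    fix x y assume "x \<in> \<phi> ` carrier A" "y \<in> \<phi> ` carrier A"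
    then obtain u v where uv: "u \<in> carrier A" "v \<in> carrier A" "x = \<phi> u" "y = \<phi> v" by blast
    have "x \<oplus>\<^bsub>B\<^esub> y = \<phi> (u \<oplus>\<^bsub>A\<^esub> v)" "x \<otimes>\<^bsub>B\<^esub> y = \<phi> (u \<otimes>\<^bsub>A\<^esub> v)" using uv by (simp_all add: \<phi>D)
    then show "x \<oplus>\<^bsub>B\<^esub> y \<in> \<phi> ` carrier A" "x \<otimes>\<^bsub>B\<^esub> y \<in> \<phi> ` carrier A" using uv by auto
  next
    fix x assume "x \<in> \<phi> ` carrier A"
    then obtain u where u: "u \<in> carrier A" "x = \<phi> u" by blast
    show "adj B x \<in> \<phi> ` carrier A" using u by (intro image_eqI[of _ _ "adj A u"]) (simp_all add: \<phi>D)
    show "smul B c x \<in> \<phi> ` carrier A" for c using u by (intro image_eqI[of _ _ "smul A c u"]) (simp_all add: \<phi>D)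
  next
    fix Y l assume Y: "\<And>n. Y n \<in> \<phi> ` carrier A" "B.conv Y l"
    have "\<forall>n. \<exists>u. u \<in> carrier A \<and> Y n = \<phi> u" using Y(1) by blast
    then obtain Z where Z: "\<And>n. Z n \<in> carrier A" "\<And>n. Y n = \<phi> (Z n)" by metis
    have iso: "nrm A (Z m \<ominus>\<^bsub>A\<^esub> Z n) = nrm B (Y m \<ominus>\<^bsub>B\<^esub> Y n)" for m n
      using cstar_hom_isometric[OF A B \<phi> inj, of "Z m \<ominus>\<^bsub>A\<^esub> Z n"] cstar_hom_diff[OF A B \<phi> Z(1) Z(1), of m n] Z
      by simp
    obtain z where z: "A.conv Z z"
    proof (rule A.Cauchy_conv[OF Z(1)])
      fix e :: real assume "e > 0"
      then obtain N where N: "\<And>n. n \<ge> N \<Longrightarrow> nrm B (Y n \<ominus>\<^bsub>B\<^esub> l) < e / 2"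
        using LIMSEQ_D[OF B.conv_lim[OF Y(2)], of "e / 2"] by fastforce
      have "nrm A (Z m \<ominus>\<^bsub>A\<^esub> Z n) < e" if "m \<ge> N" "n \<ge> N" for m n
      proof -
        note c = B.conv_carrier[OF Y(2)]
        have "Y m \<ominus>\<^bsub>B\<^esub> Y n = (Y m \<ominus>\<^bsub>B\<^esub> l) \<oplus>\<^bsub>B\<^esub> (l \<ominus>\<^bsub>B\<^esub> Y n)" using c by (simp add: B.diff_add_diff)
        then have "nrm B (Y m \<ominus>\<^bsub>B\<^esub> Y n) \<le> nrm B (Y m \<ominus>\<^bsub>B\<^esub> l) + nrm B (l \<ominus>\<^bsub>B\<^esub> Y n)"
          using c B.nrm_triangle[of "Y m \<ominus>\<^bsub>B\<^esub> l" "l \<ominus>\<^bsub>B\<^esub> Y n"] by simp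
        also have "nrm B (l \<ominus>\<^bsub>B\<^esub> Y n) = nrm B (Y n \<ominus>\<^bsub>B\<^esub> l)" by (rule B.nrm_diff_commute[OF c(2) c(1)])
        finally show ?thesis unfolding iso using N[OF that(1)] N[OF that(2)] by linarith
      qed
      then show "\<exists>N. \<forall>m\<ge>N. \<forall>n\<ge>N. nrm A (Z m \<ominus>\<^bsub>A\<^esub> Z n) < e" by blast
    qed
    have "B.conv Y (\<phi> z)" using cstar_hom_conv[OF A B \<phi> z] by (simp add: Z(2)[symmetric])
    then have "l = \<phi> z" using B.conv_unique[OF Y(2)] by blast
    then show "l \<in> \<phi> ` carrier A" using A.conv_carrier(2)[OF z] by blast
  qed
qed

section \<open>Norm estimates for elementary tensors\<close>

context cstar_tensor_product begin

sublocale A: cstar_algebra A by (rule cstar_A)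
sublocale D: cstar_algebra D by (rule cstar_D)
sublocale T: cstar_algebra T by (rule cstar_T)

lemmas [simp] = tens_closed

lemma tens_zero_left [simp]: "d \<in> carrier D \<Longrightarrow> tens \<zero>\<^bsub>A\<^esub> d = \<zero>\<^bsub>T\<^esub>"
  using tens_smul_left[of "\<zero>\<^bsub>A\<^esub>" d 0] by (simp add: T.smul_zero_left)

lemma tens_zero_right [simp]: "a \<in> carrier A \<Longrightarrow> tens a \<zero>\<^bsub>D\<^esub> = \<zero>\<^bsub>T\<^esub>"
  using tens_smul_right[of a "\<zero>\<^bsub>D\<^esub>" 0] by (simp add: T.smul_zero_left)

lemma tens_diff_right:
  assumes "a \<in> carrier A" "d \<in> carrier D" "d' \<in> carrier D"
  shows "tens a (d \<ominus>\<^bsub>D\<^esub> d') = tens a d \<ominus>\<^bsub>T\<^esub> tens a d'"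
proof -
  have "tens a (\<ominus>\<^bsub>D\<^esub> d') = \<ominus>\<^bsub>T\<^esub> tens a d'"
    using assms tens_smul_right[of a d' "-1"] by (simp add: D.smul_minus_one T.smul_minus_one)
  then show ?thesis using assms by (simp add: a_minus_def tens_add_right)
qed

lemma tens_hom_left: "projection D q \<Longrightarrow> (\<lambda>a. tens a q) \<in> cstar_hom A T"
  by (auto simp: cstar_hom_def projection_def tens_add_left tens_smul_left tens_mult tens_adj)

text \<open>The independence axiom for one summand: a single nonzero d is linearly
  independent.\<close>

lemma tens_eq_zero:
  assumes a: "a \<in> carrier A" and d: "d \<in> carrier D" "d \<noteq> \<zero>\<^bsub>D\<^esub>" and 0: "tens a d = \<zero>\<^bsub>T\<^esub>"
  shows "a = \<zero>\<^bsub>A\<^esub>"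
proof -
  have "\<forall>i<1::nat. (\<lambda>_. a) i = \<zero>\<^bsub>A\<^esub>"
  proof (rule tens_inj[of 1 _ "\<lambda>_. d"])
    fix c :: "nat \<Rightarrow> complex"
    assume "(\<Oplus>\<^bsub>D\<^esub>i\<in>{..<1}. smul D (c i) d) = \<zero>\<^bsub>D\<^esub>"
    then have "smul D (c 0) d = \<zero>\<^bsub>D\<^esub>" using d by (simp add: lessThan_Suc D.finsum_insert)
    then have "cmod (c 0) * nrm D d = 0" using D.nrm_smul[OF d(1), of "c 0"] by simp
    then show "\<forall>i<1. c i = 0" using d by (simp add: D.nrm_eq_0)
  qed (use a d 0 in \<open>simp_all add: lessThan_Suc T.finsum_insert\<close>)
  then show ?thesis by simp
qed

text \<open>\<open>T\<close> need not contain an element 1 \<otimes> d, so d cannot be moved out as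
  a factor. But the identities of \<open>complementary_squares\<close> live in \<open>D\<close> and
  can be tensored with adj a a, which makes a \<otimes> dx and a \<otimes> (x - cx) complementary in
  \<open>T\<close>.\<close>

lemma nrm_tens_mult_selfadjoint:
  assumes a: "a \<in> carrier A" and d: "d \<in> carrier D" "adj D d = d" "nrm D d \<le> 1" and x: "x \<in> carrier D"
  shows "nrm T (tens a (d \<otimes>\<^bsub>D\<^esub> x)) \<le> nrm T (tens a x)"
proof -
  have dd: "d \<otimes>\<^bsub>D\<^esub> d \<in> carrier D" "adj D (d \<otimes>\<^bsub>D\<^esub> d) = d \<otimes>\<^bsub>D\<^esub> d" "nrm D (d \<otimes>\<^bsub>D\<^esub> d) \<le> 1"
    using d D.nrm_nonneg by (simp_all add: D.nrm_selfadjoint_mult power_le_one D.adj_mult)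
  obtain c where c: "c \<in> carrier D" "adj D c = c" "nrm D c \<le> 1"
    "smul D 2 c = d \<otimes>\<^bsub>D\<^esub> d \<oplus>\<^bsub>D\<^esub> c \<otimes>\<^bsub>D\<^esub> c"
    "\<And>z. z \<in> carrier D \<Longrightarrow> z \<otimes>\<^bsub>D\<^esub> (d \<otimes>\<^bsub>D\<^esub> d) = d \<otimes>\<^bsub>D\<^esub> d \<otimes>\<^bsub>D\<^esub> z \<Longrightarrow> z \<otimes>\<^bsub>D\<^esub> c = c \<otimes>\<^bsub>D\<^esub> z"
    using D.half_square_fixpoint[OF _ _ dd(3)] dd(1,2) by blast
  have dc: "d \<otimes>\<^bsub>D\<^esub> c = c \<otimes>\<^bsub>D\<^esub> d" using d(1) by (intro c(5)) (simp_all add: D.mult_assoc)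
  let ?u = "d \<otimes>\<^bsub>D\<^esub> x" and ?v = "x \<ominus>\<^bsub>D\<^esub> c \<otimes>\<^bsub>D\<^esub> x"
  have uv: "?u \<in> carrier D" "?v \<in> carrier D" using c(1) d(1) x by simp_all
  note sq = D.complementary_squares[OF c(1) d(1) x c(2) d(2) dc c(4)]
  have "(nrm T (tens a ?u))\<^sup>2 \<le> nrm T (adj T (tens a ?u) \<otimes>\<^bsub>T\<^esub> tens a ?u \<oplus>\<^bsub>T\<^esub> adj T (tens a ?v) \<otimes>\<^bsub>T\<^esub> tens a ?v)"
    using a uv by (intro T.nrm_sum_squares) (simp_all only: tens_closed tens_adj tens_mult sq(1) A.adj_closed D.adj_closed)
  also have "adj T (tens a ?u) \<otimes>\<^bsub>T\<^esub> tens a ?u \<oplus>\<^bsub>T\<^esub> adj T (tens a ?v) \<otimes>\<^bsub>T\<^esub> tens a ?v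
      = tens (adj A a \<otimes>\<^bsub>A\<^esub> a) (adj D x \<otimes>\<^bsub>D\<^esub> x)"
    using a uv by (simp only: tens_adj tens_mult A.adj_closed D.adj_closed A.mult_closed D.mult_closed
        tens_add_right[symmetric] sq(2))
  also have "\<dots> = adj T (tens a x) \<otimes>\<^bsub>T\<^esub> tens a x" using a x by (simp add: tens_adj tens_mult)
  finally show ?thesis
    using a x uv T.nrm_nonneg by (simp add: T.cstar_identity power2_le_iff_abs_le)
qed

text \<open>The C*-identity replaces d by adj d d, which is self-adjoint of norm
  \<parallel>d\<parallel>^2, and splits off one factor \<parallel>a \<otimes> x\<parallel>.\<close>

lemma nrm_tens_mult_left:
  assumes a: "a \<in> carrier A" and d: "d \<in> carrier D" and x: "x \<in> carrier D"
  shows "nrm T (tens a (d \<otimes>\<^bsub>D\<^esub> x)) \<le> nrm D d * nrm T (tens a x)"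
proof -
  have sa: "nrm T (tens a (h \<otimes>\<^bsub>D\<^esub> x)) \<le> nrm D h * nrm T (tens a x)" if h: "h \<in> carrier D" "adj D h = h" for h
  proof (cases "nrm D h = 0")
    case True
    then have "h = \<zero>\<^bsub>D\<^esub>" using h by (simp add: D.nrm_eq_0)
    then show ?thesis using a x by simp
  next
    case False
    then have pos: "nrm D h > 0" using D.nrm_nonneg[OF h(1)] by simp
    let ?h = "smul D (of_real (1 / nrm D h)) h"
    have "nrm T (tens a (?h \<otimes>\<^bsub>D\<^esub> x)) \<le> nrm T (tens a x)"
      using h pos by (intro nrm_tens_mult_selfadjoint a x) (simp_all add: D.adj_smul D.nrm_smul norm_divide)
    then show ?thesis
      using h a x pos by (simp add: D.smul_mult_left tens_smul_right T.nrm_smul norm_divide field_simps)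
  qed
  have "(nrm T (tens a (d \<otimes>\<^bsub>D\<^esub> x)))\<^sup>2 = nrm T (adj T (tens a x) \<otimes>\<^bsub>T\<^esub> tens a (adj D d \<otimes>\<^bsub>D\<^esub> d \<otimes>\<^bsub>D\<^esub> x))"
    using a d x T.cstar_identity[of "tens a (d \<otimes>\<^bsub>D\<^esub> x)"] by (simp add: tens_adj tens_mult D.adj_mult D.mult_assoc)
  also have "\<dots> \<le> nrm T (tens a x) * nrm T (tens a (adj D d \<otimes>\<^bsub>D\<^esub> d \<otimes>\<^bsub>D\<^esub> x))"
    using a d x T.nrm_mult[of "adj T (tens a x)" "tens a (adj D d \<otimes>\<^bsub>D\<^esub> d \<otimes>\<^bsub>D\<^esub> x)"] by (simp add: T.nrm_adj)
  also have "\<dots> \<le> nrm T (tens a x) * ((nrm D d)\<^sup>2 * nrm T (tens a x))"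
  proof (rule mult_left_mono[OF _ T.nrm_nonneg[OF tens_closed[OF a x]]])
    show "nrm T (tens a (adj D d \<otimes>\<^bsub>D\<^esub> d \<otimes>\<^bsub>D\<^esub> x)) \<le> (nrm D d)\<^sup>2 * nrm T (tens a x)"
      using sa[of "adj D d \<otimes>\<^bsub>D\<^esub> d"] d by (simp add: D.adj_mult D.adj_adj D.cstar_identity)
  qed
  also have "\<dots> = (nrm D d * nrm T (tens a x))\<^sup>2" by (simp add: power2_eq_square)
  finally show ?thesis
    by (rule power2_le_imp_le)
      (intro mult_nonneg_nonneg T.nrm_nonneg D.nrm_nonneg tens_closed a d x)
qed

lemma nrm_tens_mult_right:
  assumes a: "a \<in> carrier A" and d: "d \<in> carrier D" and x: "x \<in> carrier D"
  shows "nrm T (tens a (x \<otimes>\<^bsub>D\<^esub> d)) \<le> nrm D d * nrm T (tens a x)"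
proof -
  have "nrm T (tens a (x \<otimes>\<^bsub>D\<^esub> d)) = nrm T (tens (adj A a) (adj D d \<otimes>\<^bsub>D\<^esub> adj D x))"
    using a d x T.nrm_adj[of "tens a (x \<otimes>\<^bsub>D\<^esub> d)"] by (simp add: tens_adj D.adj_mult)
  also have "\<dots> \<le> nrm D d * nrm T (tens (adj A a) (adj D x))"
    using nrm_tens_mult_left[of "adj A a" "adj D d" "adj D x"] a d x by (simp add: D.nrm_adj)
  also have "nrm T (tens (adj A a) (adj D x)) = nrm T (tens a x)"
    using a x T.nrm_adj[of "tens a x"] by (simp add: tens_adj)
  finally show ?thesis .
qed

text \<open>The difference y = Q k - k is small in \<open>D\<close>, but it is not given as a
  product with a small factor, so the preceding bounds do not reach a \<otimes> y directly. They do
  reach \<parallel>a \<otimes> y\<parallel>^2 = \<parallel>adj a a \<otimes> adj y y\<parallel>,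
  where y is the small right factor and adj a a \<otimes> adj y stays bounded.\<close>

lemma tens_conv_left:
  assumes a: "a \<in> carrier A" and k: "k \<in> carrier D" and Q: "\<And>n. Q n \<in> carrier D" "\<And>n. nrm D (Q n) \<le> 1"
    and lim: "D.conv (\<lambda>n. Q n \<otimes>\<^bsub>D\<^esub> k) k"
  shows "T.conv (\<lambda>n. tens a (Q n \<otimes>\<^bsub>D\<^esub> k)) (tens a k)"
proof -
  let ?b = "adj A a \<otimes>\<^bsub>A\<^esub> a" and ?k = "adj D k"
  \<comment> \<open>The 2 counts the terms of adj y = adj k adj Q - adj k; tensored with adj a a,
    each is bounded by the norm of adj a a \<otimes> adj k because \<parallel>Q\<parallel> \<le>
    1.\<close>
  define C where "C = 2 * nrm T (tens ?b ?k)"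
  let ?y = "\<lambda>n. Q n \<otimes>\<^bsub>D\<^esub> k \<ominus>\<^bsub>D\<^esub> k"
  have b: "?b \<in> carrier A" and y: "?y n \<in> carrier D" for n using a k Q by simp_all
  have le: "(nrm T (tens a (?y n)))\<^sup>2 \<le> nrm D (?y n) * C" for n
  proof -
    have "(nrm T (tens a (?y n)))\<^sup>2 = nrm T (tens ?b (adj D (?y n) \<otimes>\<^bsub>D\<^esub> ?y n))"
      using a y[of n] T.cstar_identity[of "tens a (?y n)"] by (simp only: tens_adj tens_mult tens_closed A.adj_closed D.adj_closed)
    also have "\<dots> \<le> nrm D (?y n) * nrm T (tens ?b (adj D (?y n)))"
      using b y[of n] by (intro nrm_tens_mult_right) (simp_all only: D.adj_closed)
    also have "nrm T (tens ?b (adj D (?y n))) \<le> C"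
    proof -
      have "tens ?b (adj D (?y n)) = tens ?b (?k \<otimes>\<^bsub>D\<^esub> adj D (Q n)) \<ominus>\<^bsub>T\<^esub> tens ?b ?k"
        using b k Q by (simp add: D.adj_diff D.adj_mult tens_diff_right)
      then have "nrm T (tens ?b (adj D (?y n))) \<le> nrm T (tens ?b (?k \<otimes>\<^bsub>D\<^esub> adj D (Q n))) + nrm T (tens ?b ?k)"
        using T.nrm_diff[of "tens ?b (?k \<otimes>\<^bsub>D\<^esub> adj D (Q n))" "tens ?b ?k"] a k Q by simp
      also have "nrm T (tens ?b (?k \<otimes>\<^bsub>D\<^esub> adj D (Q n))) \<le> nrm D (Q n) * nrm T (tens ?b ?k)"
        using nrm_tens_mult_right[of ?b "adj D (Q n)" ?k] b k Q by (simp add: D.nrm_adj)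
      also have "\<dots> \<le> 1 * nrm T (tens ?b ?k)"
        using Q(2) T.nrm_nonneg[of "tens ?b ?k"] a k by (intro mult_right_mono) simp_all
      finally show ?thesis by (simp add: C_def)
    qed
    finally show ?thesis using D.nrm_nonneg[OF y] by (simp add: mult_left_mono)
  qed
  have "(\<lambda>n. nrm D (?y n) * C) \<longlonglongrightarrow> 0"
    by (rule tendsto_mult_left_zero[OF D.conv_lim[OF lim]])
  then have "(\<lambda>n. sqrt (nrm D (?y n) * C)) \<longlonglongrightarrow> 0"
    by (rule tendsto_real_sqrt[of _ 0, unfolded real_sqrt_zero])
  then show ?thesis
  proof (rule T.convI[rotated 3])
    show "nrm T (tens a (Q n \<otimes>\<^bsub>D\<^esub> k) \<ominus>\<^bsub>T\<^esub> tens a k) \<le> sqrt (nrm D (?y n) * C)" for n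
      using le[of n] a k Q by (intro real_le_rsqrt) (simp add: tens_diff_right)
  qed (use a k Q in simp_all)
qed

lemma tens_conv_right:
  assumes a: "a \<in> carrier A" and k: "k \<in> carrier D" and Q: "\<And>n. Q n \<in> carrier D" "\<And>n. nrm D (Q n) \<le> 1"
    and lim: "D.conv (\<lambda>n. k \<otimes>\<^bsub>D\<^esub> Q n) k"
  shows "T.conv (\<lambda>n. tens a (k \<otimes>\<^bsub>D\<^esub> Q n)) (tens a k)"
proof -
  have "D.conv (\<lambda>n. adj D (k \<otimes>\<^bsub>D\<^esub> Q n)) (adj D k)" by (rule D.conv_adj[OF lim])
  then have "D.conv (\<lambda>n. adj D (Q n) \<otimes>\<^bsub>D\<^esub> adj D k) (adj D k)" using k Q by (simp add: D.adj_mult)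
  then have "T.conv (\<lambda>n. tens (adj A a) (adj D (Q n) \<otimes>\<^bsub>D\<^esub> adj D k)) (tens (adj A a) (adj D k))"
    using a k Q by (intro tens_conv_left) (simp_all add: D.nrm_adj)
  then have "T.conv (\<lambda>n. adj T (tens (adj A a) (adj D (Q n) \<otimes>\<^bsub>D\<^esub> adj D k))) (adj T (tens (adj A a) (adj D k)))"
    by (rule T.conv_adj)
  then show ?thesis using a k Q by (simp add: tens_adj D.adj_mult D.adj_adj A.adj_adj)
qed

lemma tens_finsum_left:
  assumes "\<And>i. i \<in> I \<Longrightarrow> f i \<in> carrier A" "d \<in> carrier D"
  shows "tens (finsum A f I) d = finsum T (\<lambda>i. tens (f i) d) I"
proof (cases "finite I")
  case True
  then show ?thesis using assms(1)
  proof (induction I rule: finite_induct)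
    case (insert i I)
    then have "finsum A f (insert i I) = f i \<oplus>\<^bsub>A\<^esub> finsum A f I"
      by (intro A.finsum_insert) auto
    moreover have "finsum T (\<lambda>i. tens (f i) d) (insert i I) = tens (f i) d \<oplus>\<^bsub>T\<^esub> finsum T (\<lambda>i. tens (f i) d) I"
      using insert assms(2) by (intro T.finsum_insert) auto
    moreover have "finsum A f I \<in> carrier A" using insert.prems by (intro A.finsum_closed) auto
    ultimately show ?case using insert assms(2) by (simp add: tens_add_left)
  qed (simp add: assms(2))
qed (simp add: A.finsum_infinite T.finsum_infinite assms(2))

lemma tens_diff_left:
  assumes "a \<in> carrier A" "a' \<in> carrier A" "d \<in> carrier D"
  shows "tens (a \<ominus>\<^bsub>A\<^esub> a') d = tens a d \<ominus>\<^bsub>T\<^esub> tens a' d"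
proof -
  have "tens (\<ominus>\<^bsub>A\<^esub> a') d = \<ominus>\<^bsub>T\<^esub> tens a' d"
    using assms tens_smul_left[of a' d "-1"] by (simp add: A.smul_minus_one T.smul_minus_one)
  then show ?thesis using assms by (simp add: a_minus_def tens_add_left)
qed

text \<open>The C*-identity replaces e by its initial projection q, and a \<mapsto> a \<otimes> q is
  a homomorphism, hence contractive. The case of interest is a matrix unit.\<close>

lemma nrm_tens_partial_isometry:
  assumes a: "a \<in> carrier A" and e: "e \<in> carrier D" "projection D (adj D e \<otimes>\<^bsub>D\<^esub> e)"
  shows "nrm T (tens a e) \<le> nrm A a"
proof -
  have "(nrm T (tens a e))\<^sup>2 = nrm T (tens (adj A a \<otimes>\<^bsub>A\<^esub> a) (adj D e \<otimes>\<^bsub>D\<^esub> e))"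
    using a e(1) T.cstar_identity[of "tens a e"] by (simp add: tens_adj tens_mult)
  also have "\<dots> \<le> nrm A (adj A a \<otimes>\<^bsub>A\<^esub> a)"
    using a by (intro cstar_hom_contractive[OF cstar_A cstar_T tens_hom_left[OF e(2)]]) simp
  also have "\<dots> = (nrm A a)\<^sup>2" using a by (simp add: A.cstar_identity)
  finally show ?thesis using A.nrm_nonneg[OF a] by (rule power2_le_imp_le)
qed

lemma tens_partial_isometry_conv:
  assumes X: "A.conv X a" and e: "e \<in> carrier D" "projection D (adj D e \<otimes>\<^bsub>D\<^esub> e)"
  shows "T.conv (\<lambda>n. tens (X n) e) (tens a e)"
proof (rule T.convI[OF _ _ _ A.conv_lim[OF X]])
  note c = A.conv_carrier[OF X]
  show "nrm T (tens (X n) e \<ominus>\<^bsub>T\<^esub> tens a e) \<le> nrm A (X n \<ominus>\<^bsub>A\<^esub> a)" for n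
    using nrm_tens_partial_isometry[of "X n \<ominus>\<^bsub>A\<^esub> a" e] c e by (simp add: tens_diff_left)
qed (use A.conv_carrier[OF X] e in simp_all)

end

section \<open>Matrix units on a separable Hilbert space\<close>

lemma cinner_diff_left: "cinner (x - y) z = cinner x z - cinner y (z::'h::complex_hilbert)"
  using cinner_add_left[of "x - y" y z] by simp

lemma cinner_add_right: "cinner x (y + z) = cinner x y + cinner x (z::'h::complex_hilbert)"
  by (metis cinner_add_left cinner_commute complex_cnj_add)

lemma cinner_diff_right: "cinner x (y - z) = cinner x y - cinner x (z::'h::complex_hilbert)"
  using cinner_add_right[of x "y - z" z] by simp

lemma cinner_zero_left [simp]: "cinner 0 (x::'h::complex_hilbert) = 0"
  using cinner_add_left[of 0 0 x] by simp

lemma cinner_zero_right [simp]: "cinner (x::'h::complex_hilbert) 0 = 0"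
  using cinner_add_right[of x 0 0] by simp

lemma cinner_scaleC_right: "cinner x (c *\<^sub>C y) = cnj c * cinner x (y::'h::complex_hilbert)"
  by (metis cinner_commute cinner_scaleC_left complex_cnj_mult)

lemma cinner_self: "cinner x x = of_real ((norm (x::'h::complex_hilbert))\<^sup>2)"
proof (rule complex_eqI)
  show "Re (cinner x x) = Re (of_real ((norm x)\<^sup>2))"
    by (simp add: inner_eq_Re_cinner[symmetric] power2_norm_eq_inner)
  have "Im (cinner x x) = - Im (cinner x x)" using arg_cong[OF cinner_commute[of x x], of Im] by simp
  then show "Im (cinner x x) = Im (of_real ((norm x)\<^sup>2))" by simp
qed

lemma cinner_sum_left: "cinner (\<Sum>i\<in>I. f i) x = (\<Sum>i\<in>I. cinner (f i) (x::'h::complex_hilbert))"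
  by (induction I rule: infinite_finite_induct) (simp_all add: cinner_add_left)

lemma scaleC_zero_left [simp]: "0 *\<^sub>C x = (0::'h::complex_hilbert)"
  using scaleC_add_left[of 0 0 x] by simp

lemma scaleC_zero_right [simp]: "c *\<^sub>C (0::'h::complex_hilbert) = 0"
  using scaleC_add_right[of c 0 "0::'h"] by simp

lemma scaleC_one [simp]: "1 *\<^sub>C x = (x::'h::complex_hilbert)"
  using scaleC_of_real[of 1 x] by simp

lemma scaleC_minus_left: "(- c) *\<^sub>C x = - (c *\<^sub>C (x::'h::complex_hilbert))"
  using scaleC_add_left[of c "-c" x] by (simp add: eq_neg_iff_add_eq_0 add.commute)

lemma scaleC_diff_left: "(c - d) *\<^sub>C x = c *\<^sub>C x - d *\<^sub>C (x::'h::complex_hilbert)"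
  using scaleC_add_left[of c "-d" x] by (simp add: scaleC_minus_left)

lemma norm_scaleC: "norm (c *\<^sub>C x) = cmod c * norm (x::'h::complex_hilbert)"
proof -
  have "complex_of_real ((norm (c *\<^sub>C x))\<^sup>2) = (c * cnj c) * cinner x x"
    by (simp only: cinner_self[symmetric] cinner_scaleC_left cinner_scaleC_right mult_ac)
  also have "\<dots> = complex_of_real ((cmod c * norm x)\<^sup>2)"
    by (simp only: complex_norm_square[symmetric] cinner_self of_real_mult[symmetric] power_mult_distrib)
  finally have "(norm (c *\<^sub>C x))\<^sup>2 = (cmod c * norm x)\<^sup>2" by (simp only: of_real_eq_iff)
  then show ?thesis by (simp add: power2_eq_iff_nonneg)
qed

lemma cmod_cinner_le: "cmod (cinner x y) \<le> norm x * norm (y::'h::complex_hilbert)"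
proof -
  \<comment> \<open>A phase that makes the inner product real and nonnegative, so that the real
    Cauchy-Schwarz inequality applies.\<close>
  obtain c where c: "cmod c = 1" "c * cinner x y = of_real (cmod (cinner x y))"
  proof (cases "cinner x y = 0")
    case True then show ?thesis using that[of 1] by simp
  next
    case False
    have "cnj (cinner x y) / of_real (cmod (cinner x y)) * cinner x y = of_real (cmod (cinner x y))"
      using False complex_norm_square[of "cinner x y"] by (simp add: field_simps power2_eq_square)
    then show ?thesis using that[of "cnj (cinner x y) / of_real (cmod (cinner x y))"] False
      by (simp add: norm_divide)
  qed
  have "cmod (cinner x y) = inner (c *\<^sub>C x) y"
    by (simp add: inner_eq_Re_cinner cinner_scaleC_left c(2))
  also have "\<dots> \<le> norm x * norm y"
    using norm_cauchy_schwarz[of "c *\<^sub>C x" y] c(1) by (simp add: norm_scaleC)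
  finally show ?thesis .
qed

lemma cinner_ext: "(\<And>x. cinner x a = cinner x b) \<Longrightarrow> a = (b::'h::complex_hilbert)"
  using cinner_self[of "a - b"] cinner_diff_right[of "a - b" a b] by simp


definition rank_one :: "'h::complex_hilbert \<Rightarrow> 'h \<Rightarrow> 'h \<Rightarrow> 'h" where
  "rank_one a b x = cinner x b *\<^sub>C a"

lemma hilbert_adjoint_rank_one: "hilbert_adjoint (rank_one a b) = rank_one b a"
  unfolding hilbert_adjoint_def
proof (rule the_equality)
  have eq: "cinner (rank_one a b x) y = cinner x (rank_one b a y)" for x y
    using cinner_commute[of a y] by (simp add: rank_one_def cinner_scaleC_left cinner_scaleC_right)
  then show "\<forall>x y. cinner (rank_one a b x) y = cinner x (rank_one b a y)" by blast
  fix g assume "\<forall>x y. cinner (rank_one a b x) y = cinner x (g y)"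
  then show "g = rank_one b a" using eq by (intro ext cinner_ext) metis
qed

lemma bounded_clinear_rank_one: "bounded_clinear (rank_one a b)"
  unfolding bounded_clinear_def
proof (intro conjI allI bounded_linear_intro)
  show "norm (rank_one a b x) \<le> norm x * (norm b * norm a)" for x
    using mult_right_mono[OF cmod_cinner_le[of x b] norm_ge_zero[of a]]
    by (simp add: rank_one_def norm_scaleC mult.assoc)
  show "rank_one a b (c *\<^sub>C x) = c *\<^sub>C rank_one a b x" for c x
    by (simp add: rank_one_def cinner_scaleC_left scaleC_scaleC)
  then show "rank_one a b (r *\<^sub>R x) = r *\<^sub>R rank_one a b x" for r x
    by (metis scaleC_of_real)
qed (simp add: rank_one_def cinner_add_left scaleC_add_left)

lemma compact_operator_rank_one: "compact_operator (rank_one a b)"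
  unfolding compact_operator_def
proof
  let ?S = "(\<lambda>c. c *\<^sub>C a) ` cball 0 (norm b)"
  have "bounded_linear (\<lambda>c. c *\<^sub>C a)"
    by (rule bounded_linear_intro[of _ "norm a"])
      (simp_all add: scaleC_add_left norm_scaleC scaleR_conv_of_real scaleC_of_real scaleC_scaleC[symmetric])
  then have "compact ?S"
    by (intro compact_continuous_image linear_continuous_on compact_cball)
  moreover have "rank_one a b ` cball 0 1 \<subseteq> ?S"
  proof
    fix y assume "y \<in> rank_one a b ` cball 0 1"
    then obtain x where x: "norm x \<le> 1" "y = cinner x b *\<^sub>C a" by (auto simp: rank_one_def)
    then have "cmod (cinner x b) \<le> norm b"
      using cmod_cinner_le[of x b] mult_right_mono[OF x(1) norm_ge_zero[of b]] by simp
    then show "y \<in> ?S" using x by auto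
  qed
  ultimately have "closure (rank_one a b ` cball 0 1) \<subseteq> ?S"
    by (intro closure_minimal compact_imp_closed)
  then show "compact (closure (rank_one a b ` cball 0 1))"
    using \<open>compact ?S\<close> compact_Int_closed[of ?S "closure (rank_one a b ` cball 0 1)"] by (simp add: Int_absorb1)
qed (rule bounded_clinear_rank_one)

lemma compact_operators_simps [simp]:
  "carrier compact_operators = {f. compact_operator f}"
  "f \<otimes>\<^bsub>compact_operators\<^esub> g = f \<circ> g"
  "f \<oplus>\<^bsub>compact_operators\<^esub> g = (\<lambda>x. f x + g x)"
  "\<zero>\<^bsub>compact_operators\<^esub> = (\<lambda>x. 0)"
  "smul compact_operators c f = (\<lambda>x. c *\<^sub>C f x)"
  "adj compact_operators f = hilbert_adjoint f"
  "nrm compact_operators f = onorm f"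
  by (simp_all add: compact_operators_def)


section \<open>Gram-Schmidt\<close>

definition orthonormal :: "'h::complex_hilbert set \<Rightarrow> bool" where
  "orthonormal F \<longleftrightarrow> (\<forall>x\<in>F. \<forall>y\<in>F. cinner x y = (if x = y then 1 else 0))"

text \<open>For finite orthonormal \<open>F\<close> this is the component of x orthogonal to the
  complex span of \<open>F\<close>; it vanishes exactly on that span.\<close>

definition residual :: "'h::complex_hilbert set \<Rightarrow> 'h \<Rightarrow> 'h" where
  "residual F x = x - (\<Sum>y\<in>F. cinner x y *\<^sub>C y)"

lemma residual_diff: "residual F (x - y) = residual F x - residual F y"
  by (simp add: residual_def cinner_diff_left scaleC_diff_left sum_subtractf)

context
  fixes F :: "'h::complex_hilbert set"
  assumes F: "finite F" "orthonormal F"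
begin

lemma cinner_residual: "y \<in> F \<Longrightarrow> cinner (residual F x) y = 0"
proof -
  assume y: "y \<in> F"
  have "(\<Sum>z\<in>F. cinner (cinner x z *\<^sub>C z) y) = (\<Sum>z\<in>F. if z = y then cinner x y else 0)"
    using F(2) y by (intro sum.cong) (auto simp: orthonormal_def cinner_scaleC_left)
  also have "\<dots> = cinner x y" using F(1) y by simp
  finally show ?thesis by (simp add: residual_def cinner_diff_left cinner_sum_left)
qed

lemma norm_residual_le: "norm (residual F x) \<le> norm x"
  and norm_projection_le: "norm (x - residual F x) \<le> norm x"
proof -
  let ?r = "residual F x" and ?p = "x - residual F x"
  have "cinner ?p ?r = 0"
  proof -
    have "cinner ?r (\<Sum>y\<in>F. cinner x y *\<^sub>C y) = cnj (\<Sum>y\<in>F. cinner x y * cinner y ?r)"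
      by (subst cinner_commute) (simp add: cinner_sum_left cinner_scaleC_left)
    also have "\<dots> = 0"
    proof -
      have "cinner y ?r = 0" if "y \<in> F" for y
        using cinner_residual[OF that, of x] cinner_commute[of y ?r] by simp
      then show ?thesis by simp
    qed
    finally have "cinner (\<Sum>y\<in>F. cinner x y *\<^sub>C y) ?r = 0" by (subst cinner_commute) simp
    then show ?thesis by (simp add: residual_def)
  qed
  then have "inner ?p ?r = 0" by (simp add: inner_eq_Re_cinner)
  then have "(norm (?p + ?r))\<^sup>2 = (norm ?p)\<^sup>2 + (norm ?r)\<^sup>2"
    by (intro norm_add_Pythagorean) (simp only: orthogonal_def)
  then have "(norm x)\<^sup>2 = (norm ?p)\<^sup>2 + (norm ?r)\<^sup>2" by simp
  then have "(norm ?r)\<^sup>2 \<le> (norm x)\<^sup>2" "(norm ?p)\<^sup>2 \<le> (norm x)\<^sup>2" by simp_all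
  then show "norm ?r \<le> norm x" "norm ?p \<le> norm x"
    by (simp_all only: power2_le_imp_le norm_ge_zero)
qed

lemma continuous_residual: "continuous_on UNIV (residual F)"
  unfolding continuous_on_iff
proof (intro ballI allI impI)
  fix x and e :: real assume "e > 0"
  have "dist (residual F y) (residual F x) \<le> dist y x" for y
    using norm_residual_le[of "y - x"] by (simp add: dist_norm residual_diff)
  then show "\<exists>d>0. \<forall>y\<in>UNIV. dist y x < d \<longrightarrow> dist (residual F y) (residual F x) < e"
    using \<open>e > 0\<close> by (intro exI[of _ e]) (meson le_less_trans)
qed

lemma residual_insert:
  assumes "z \<notin> F" shows "residual (insert z F) x = residual F x - cinner x z *\<^sub>C z"
  using assms F(1) by (simp add: residual_def)

lemma cinner_eq_cinner_residual:
  assumes "\<And>y. y \<in> F \<Longrightarrow> cinner y z = 0" shows "cinner x z = cinner (residual F x) z"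
  using assms by (simp add: residual_def cinner_diff_left cinner_sum_left cinner_scaleC_left)

text \<open>One Gram-Schmidt step, with z the normalized residual of x. Afterwards x lies in the
  span, and vectors already there stay there.\<close>

lemma residual_unit:
  assumes r: "residual F x \<noteq> 0"
  defines "z \<equiv> of_real (1 / norm (residual F x)) *\<^sub>C residual F x"
  shows "z \<notin> F" "orthonormal (insert z F)" "residual (insert z F) x = 0"
    "residual F y = 0 \<Longrightarrow> residual (insert z F) y = 0"
proof -
  let ?r = "residual F x" and ?t = "norm (residual F x)"
  have t: "?t > 0" using r by simp
  have zF: "cinner z y = 0" if "y \<in> F" for y using that by (simp add: z_def cinner_scaleC_left cinner_residual)
  have Fz: "cinner y z = 0" if "y \<in> F" for y using zF[OF that] cinner_commute[of y z] by simp
  have zz: "cinner z z = 1"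
  proof -
    have "norm z = 1" using t by (simp add: z_def norm_scaleC norm_divide)
    then show ?thesis by (simp add: cinner_self)
  qed
  show nF: "z \<notin> F" using zF[of z] zz by auto
  show "orthonormal (insert z F)"
    using F(2) zF Fz zz nF by (auto simp: orthonormal_def)
  have "cinner x z = of_real ?t"
    using cinner_eq_cinner_residual[OF Fz, of x] t
    by (simp add: z_def cinner_scaleC_right cinner_self power2_eq_square)
  then have "cinner x z *\<^sub>C z = ?r" using t by (simp add: z_def scaleC_scaleC)
  then show "residual (insert z F) x = 0" by (simp add: residual_insert[OF nF])
  show "residual (insert z F) y = 0" if "residual F y = 0"
    using that cinner_eq_cinner_residual[OF Fz, of y] by (simp add: residual_insert[OF nF])
qed

text \<open>Otherwise the residual, being continuous, would vanish everywhere and \<open>F\<close>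
  would span the space.\<close>

lemma exists_residual_nonzero:
  assumes "infinite_dimensional TYPE('h)" "closure D = UNIV"
  shows "\<exists>x\<in>D. residual F x \<noteq> 0"
proof (rule ccontr)
  assume "\<not> (\<exists>x\<in>D. residual F x \<noteq> 0)"
  then have "D \<subseteq> {x \<in> UNIV. residual F x = 0}" by auto
  moreover have "closed {x \<in> UNIV. residual F x = 0}"
    by (rule continuous_closed_preimage_constant[OF continuous_residual closed_UNIV])
  ultimately have "closure D \<subseteq> {x \<in> UNIV. residual F x = 0}" by (rule closure_minimal)
  then have zero: "residual F x = 0" for x unfolding assms(2) by blast
  \<comment> \<open>\<open>span\<close> is taken over the reals, so the multiples by \<i> are added
    to reach all complex combinations.\<close>
  let ?B = "F \<union> (\<lambda>y. \<i> *\<^sub>C y) ` F"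
  have "x \<in> span ?B" for x
  proof -
    have scaleC: "c *\<^sub>C y \<in> span ?B" if "y \<in> F" for c y
    proof -
      have c: "c = of_real (Re c) + of_real (Im c) * \<i>"
        using complex_eq[of c] by (simp only: mult.commute)
      have "c *\<^sub>C y = of_real (Re c) *\<^sub>C y + of_real (Im c) *\<^sub>C \<i> *\<^sub>C y"
        by (subst c) (simp only: scaleC_add_left scaleC_scaleC)
      also have "\<dots> = Re c *\<^sub>R y + Im c *\<^sub>R (\<i> *\<^sub>C y)" by (simp only: scaleC_of_real)
      also have "\<dots> \<in> span ?B" using that
        by (intro span_add[OF span_scale[OF span_base] span_scale[OF span_base]] UnI1 UnI2 imageI)
      finally show ?thesis .
    qed
    have "(\<Sum>y\<in>F. cinner x y *\<^sub>C y) \<in> span ?B" by (rule span_sum) (rule scaleC)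
    then show ?thesis using zero[of x] by (simp add: residual_def)
  qed
  then have "span ?B = UNIV" by (rule UNIV_eq_I[symmetric])
  moreover have "finite ?B" using F(1) by simp
  ultimately show False using assms(1) unfolding infinite_dimensional_def by blast
qed

end

text \<open>Gram-Schmidt along a dense sequence d, each time with the first d m outside the current
  span; infinite dimension keeps the process going. The first n basis vectors span d 0, ..., d (n -
  1), and since residuals do not increase norms, density gives convergence at every x.\<close>

lemma exists_orthonormal_basis:
  assumes sep: "separable_space (euclidean :: 'h::complex_hilbert topology)" and inf: "infinite_dimensional TYPE('h)"
  obtains b :: "nat \<Rightarrow> 'h::complex_hilbert" where "\<And>i j. cinner (b i) (b j) = (if i = j then 1 else 0)"
    "\<And>x. (\<lambda>n. residual (b ` {..<n}) x) \<longlonglongrightarrow> 0"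
proof -
  obtain C :: "'h set" where C: "countable C" "closure C = UNIV"
    using sep unfolding separable_space_def by (metis euclidean_closure_of topspace_euclidean)
  have "C \<noteq> {}" using C(2) by auto
  define d where "d = from_nat_into C"
  have d: "range d = C" using C \<open>C \<noteq> {}\<close> by (simp add: d_def range_from_nat_into)
  define \<mu> where "\<mu> F = (LEAST m. residual F (d m) \<noteq> 0)" for F
  define nxt where "nxt F = of_real (1 / norm (residual F (d (\<mu> F)))) *\<^sub>C residual F (d (\<mu> F))" for F
  define F where "F = rec_nat {} (\<lambda>_ S. insert (nxt S) S)"
  have F_0: "F 0 = {}" and F_Suc: "F (Suc n) = insert (nxt (F n)) (F n)" for n
    by (simp_all add: F_def)
  have \<mu>: "residual S (d (\<mu> S)) \<noteq> 0" "j < \<mu> S \<Longrightarrow> residual S (d j) = 0" if "finite S" "orthonormal S" for S j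
  proof -
    have "\<exists>m. residual S (d m) \<noteq> 0"
      using exists_residual_nonzero[OF that inf C(2)] d by auto
    then show "residual S (d (\<mu> S)) \<noteq> 0" unfolding \<mu>_def by (rule LeastI_ex)
    show "residual S (d j) = 0" if "j < \<mu> S"
      using not_less_Least[OF that[unfolded \<mu>_def]] by simp
  qed
  have on: "finite (F n) \<and> orthonormal (F n)" for n
  proof (induction n)
    case (Suc n)
    then show ?case
      using residual_unit(2)[of "F n" "d (\<mu> (F n))"] \<mu>(1)[of "F n"] by (simp add: F_Suc nxt_def)
  qed (simp add: F_0 orthonormal_def)
  have zero: "residual (F n) (d j) = 0" if "j < n" for j n
    using that
  proof (induction n arbitrary: j)
    case (Suc n)
    note IH = Suc.IH
    have n: "finite (F n)" "orthonormal (F n)" using on by blast+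
    note r = residual_unit(3,4)[OF n \<mu>(1)[OF n], folded nxt_def F_Suc]
    have "residual (F n) (d j) = 0 \<or> j = \<mu> (F n)"
    proof (cases "j < n")
      case False
      then have "j = n" using Suc.prems by simp
      \<comment> \<open>All d j with j < n are already spanned, so the selected index is at least n.
        Hence d n either is spanned as well or is the vector selected.\<close>
      have "\<mu> (F n) \<le> n \<Longrightarrow> \<mu> (F n) = n"
      proof (rule ccontr)
        assume "\<mu> (F n) \<le> n" "\<mu> (F n) \<noteq> n"
        then have "residual (F n) (d (\<mu> (F n))) = 0" by (intro IH) simp
        then show False using \<mu>(1)[OF n] by blast
      qed
      then show ?thesis using \<mu>(2)[OF n, of j] \<open>j = n\<close> by (cases "\<mu> (F n) \<le> n") auto
    qed (use IH in simp)
    then show ?case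
    proof
      assume "residual (F n) (d j) = 0"
      then show ?thesis by (rule r(2))
    next
      assume "j = \<mu> (F n)"
      then show ?thesis using r(1) by simp
    qed
  qed simp
  define b where "b n = nxt (F n)" for n
  have F_b: "F n = b ` {..<n}" for n
    by (induction n) (simp_all add: F_0 F_Suc b_def lessThan_Suc)
  have b_notin: "b n \<notin> F n" for n
    using residual_unit(1)[of "F n" "d (\<mu> (F n))"] on[of n] \<mu>(1)[of "F n"] by (simp add: b_def nxt_def)
  show thesis
  proof (rule that[of b])
    fix i j
    have "b i \<noteq> b j" if "i < j" for i j
      using b_notin[of j] imageI[of i "{..<j}" b] that unfolding F_b by (metis lessThan_iff)
    then have "b i = b j \<longleftrightarrow> i = j" by (metis nat_neq_iff)
    moreover have "b i \<in> F (Suc (max i j))" "b j \<in> F (Suc (max i j))"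
      unfolding F_b by (intro imageI; simp)+
    moreover have "orthonormal (F (Suc (max i j)))" using on by blast
    ultimately show "cinner (b i) (b j) = (if i = j then 1 else 0)"
      by (simp only: orthonormal_def)
  next
    fix x
    show "(\<lambda>n. residual (b ` {..<n}) x) \<longlonglongrightarrow> 0"
    proof (rule LIMSEQ_I)
      fix e :: real assume "e > 0"
      have "x \<in> closure (range d)" using C(2) d by simp
      then have "\<exists>y\<in>range d. dist y x < e" using \<open>e > 0\<close> unfolding closure_approachable by simp
      then obtain m where m: "dist (d m) x < e" by auto
      have "norm (residual (F n) x - 0) < e" if "n \<ge> Suc m" for n
      proof -
        have "residual (F n) x = residual (F n) (x - d m)"
          using zero[of m n] that by (simp add: residual_diff)
        then show ?thesis
          using norm_residual_le[of "F n" "x - d m"] on[of n] m by (simp add: dist_norm norm_minus_commute)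
      qed
      then show "\<exists>no. \<forall>n\<ge>no. norm (residual (b ` {..<n}) x - 0) < e" unfolding F_b by blast
    qed
  qed
qed

section \<open>Matrix units and finite-rank truncations\<close>

locale orthonormal_basis =
  fixes b :: "nat \<Rightarrow> 'h::complex_hilbert"
  assumes cinner_basis: "cinner (b i) (b j) = (if i = j then 1 else 0)"
    and basis_dense: "(\<lambda>n. residual (b ` {..<n}) x) \<longlonglongrightarrow> 0"
begin

abbreviation K :: "('h \<Rightarrow> 'h) cstar" where "K \<equiv> compact_operators"

definition matrix_unit :: "nat \<Rightarrow> nat \<Rightarrow> 'h \<Rightarrow> 'h" where
  "matrix_unit i j = rank_one (b i) (b j)"

text \<open>The projection onto the span of the first n basis vectors, a sum of diagonal matrix
  units. By \<open>basis_dense\<close> these projections converge strongly to the identity; they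
  serve as an approximate unit of \<open>K\<close>.\<close>

definition trunc :: "nat \<Rightarrow> 'h \<Rightarrow> 'h" where
  "trunc n x = x - residual (b ` {..<n}) x"

lemma basis_inj: "b i = b j \<longleftrightarrow> i = j"
  by (metis cinner_basis zero_neq_one)

lemma orthonormal_basis_set: "finite (b ` {..<n})" "orthonormal (b ` {..<n})"
  by (auto simp: orthonormal_def cinner_basis basis_inj)

lemma matrix_unit_closed [simp]: "compact_operator (matrix_unit i j)"
  by (simp add: matrix_unit_def compact_operator_rank_one)

lemma matrix_unit_mult: "matrix_unit i j \<circ> matrix_unit k l = (if j = k then matrix_unit i l else (\<lambda>x. 0))"
  by (rule ext) (simp add: matrix_unit_def rank_one_def cinner_scaleC_left cinner_basis)

lemma matrix_unit_adj [simp]: "hilbert_adjoint (matrix_unit i j) = matrix_unit j i"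
  by (simp add: matrix_unit_def hilbert_adjoint_rank_one)

lemma matrix_unit_nonzero: "matrix_unit i j \<noteq> (\<lambda>x. 0)"
proof
  assume "matrix_unit i j = (\<lambda>x. 0)"
  then have "cinner (b j) (b j) *\<^sub>C b i = 0" by (metis matrix_unit_def rank_one_def)
  then show False using cinner_basis[of i i] by (simp add: cinner_basis)
qed

lemma projection_matrix_unit: "projection K (matrix_unit i i)"
  by (simp add: projection_def matrix_unit_mult)

text \<open>Hence truncating k on both sides yields a finite combination of matrix units.\<close>

lemma matrix_unit_compression:
  assumes "bounded_clinear k"
  shows "matrix_unit i i \<circ> k \<circ> matrix_unit j j = (\<lambda>x. cinner (k (b j)) (b i) *\<^sub>C matrix_unit i j x)"
proof
  fix x
  have "k (cinner x (b j) *\<^sub>C b j) = cinner x (b j) *\<^sub>C k (b j)"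
    using assms by (simp add: bounded_clinear_def)
  then show "(matrix_unit i i \<circ> k \<circ> matrix_unit j j) x = cinner (k (b j)) (b i) *\<^sub>C matrix_unit i j x"
    by (simp add: matrix_unit_def rank_one_def cinner_scaleC_left scaleC_scaleC mult.commute)
qed

lemma trunc_0: "trunc 0 = (\<lambda>x. 0)"
  by (rule ext) (simp add: trunc_def residual_def)

lemma trunc_Suc: "trunc (Suc n) = (\<lambda>x. trunc n x + matrix_unit n n x)"
proof
  fix x
  have "b n \<notin> b ` {..<n}" by (auto simp: basis_inj)
  then show "trunc (Suc n) x = trunc n x + matrix_unit n n x"
    by (simp add: trunc_def lessThan_Suc residual_insert[OF orthonormal_basis_set(1)
          orthonormal_basis_set(2)] matrix_unit_def rank_one_def)
qed

lemma norm_trunc_le: "norm (trunc n x) \<le> norm x"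
  unfolding trunc_def by (rule norm_projection_le[OF orthonormal_basis_set])

lemma onorm_trunc_le: "onorm (trunc n) \<le> 1"
  by (rule onorm_bound) (simp_all add: norm_trunc_le)

text \<open>That the compact operators form a C*-algebra is among the axioms of
  \<open>cstar_tensor_product\<close>; here it is a hypothesis, later discharged by
  \<open>cstar_D\<close>.\<close>

context
  assumes K: "cstar_algebra K"
begin

interpretation K: cstar_algebra K by (rule K)

lemma trunc_closed: "trunc n \<in> carrier K" and trunc_adj: "adj K (trunc n) = trunc n"
proof (induction n)
  case 0
  show "trunc 0 \<in> carrier K" "adj K (trunc 0) = trunc 0"
    using K.zero_closed K.adj_zero by (simp_all only: trunc_0 compact_operators_simps(4))
next
  case (Suc n)
  have eq: "trunc (Suc n) = trunc n \<oplus>\<^bsub>K\<^esub> matrix_unit n n" by (simp add: trunc_Suc)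
  have m: "matrix_unit n n \<in> carrier K" "adj K (matrix_unit n n) = matrix_unit n n" by simp_all
  show "trunc (Suc n) \<in> carrier K" "adj K (trunc (Suc n)) = trunc (Suc n)"
    unfolding eq using Suc m by (simp_all only: K.a_closed K.adj_add)
qed

text \<open>The image of the unit ball under k is totally bounded. Residuals tend to 0 at the
  finitely many points of a net, and as they do not increase norms the convergence is uniform on the
  image.\<close>

lemma trunc_conv_left:
  assumes k: "k \<in> carrier K" shows "K.conv (\<lambda>n. trunc n \<otimes>\<^bsub>K\<^esub> k) k"
proof -
  have kc: "bounded_clinear k" "compact (closure (k ` cball 0 1))"
    using k by (auto simp: compact_operator_def)
  interpret k: bounded_linear k using kc(1) by (simp add: bounded_clinear_def)
  have tk: "trunc n \<otimes>\<^bsub>K\<^esub> k \<in> carrier K" for n by (rule K.mult_closed[OF trunc_closed k])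
  have diff: "(trunc n \<otimes>\<^bsub>K\<^esub> k) \<ominus>\<^bsub>K\<^esub> k = (\<lambda>x. - residual (b ` {..<n}) (k x))" for n
  proof -
    have "\<ominus>\<^bsub>K\<^esub> k = smul K (-1) k" by (rule K.smul_minus_one[OF k, symmetric])
    then show ?thesis by (simp add: a_minus_def fun_eq_iff trunc_def scaleC_minus_left)
  qed
  note F = orthonormal_basis_set
  have "(\<lambda>n. onorm (\<lambda>x. - residual (b ` {..<n}) (k x))) \<longlonglongrightarrow> 0"
  proof (rule LIMSEQ_I)
    fix e :: real assume e: "e > 0"
    \<comment> \<open>With e/4 the distance to the net and the residual at the net point add up to
      at most e/2, so the operator norm stays strictly below e.\<close>
    obtain T where T: "finite T" "T \<subseteq> closure (k ` cball 0 1)" "closure (k ` cball 0 1) \<subseteq> (\<Union>t\<in>T. ball t (e / 4))"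
      using compactE_image[OF kc(2), of "closure (k ` cball 0 1)" "\<lambda>t. ball t (e / 4)"] e
      by (metis (no_types, lifting) UN_I centre_in_ball open_ball subsetI zero_less_divide_iff zero_less_numeral)
    have "\<forall>\<^sub>F n in sequentially. \<forall>t\<in>T. norm (residual (b ` {..<n}) t) < e / 4"
    proof (rule eventually_ball_finite[OF T(1)], rule ballI)
      fix t
      show "\<forall>\<^sub>F n in sequentially. norm (residual (b ` {..<n}) t) < e / 4"
        using tendstoD[OF basis_dense[of t], of "e / 4"] e by simp
    qed
    then obtain N where N: "\<And>n t. n \<ge> N \<Longrightarrow> t \<in> T \<Longrightarrow> norm (residual (b ` {..<n}) t) < e / 4"
      unfolding eventually_sequentially by blast
    have "norm (onorm (\<lambda>x. - residual (b ` {..<n}) (k x)) - 0) < e" if n: "n \<ge> N" for n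
    proof -
      let ?r = "residual (b ` {..<n})"
      have unit: "norm (?r (k x)) \<le> e / 2" if x: "norm x \<le> 1" for x
      proof -
        have "k x \<in> closure (k ` cball 0 1)" using x by (intro closure_subset[THEN subsetD] imageI) simp
        then obtain t where t: "t \<in> T" "dist t (k x) < e / 4" using T(3) by auto
        have "norm (?r (k x)) = norm (?r (k x - t) + ?r t)" by (simp add: residual_diff)
        also have "\<dots> \<le> norm (k x - t) + norm (?r t)"
          using norm_triangle_ineq[of "?r (k x - t)" "?r t"] norm_residual_le[OF F, of n "k x - t"] by linarith
        also have "\<dots> \<le> e / 4 + e / 4"
          using t N[OF n t(1)] by (intro add_mono) (simp_all add: dist_norm norm_minus_commute)
        finally show ?thesis by simp
      qed
      have r0: "?r 0 = 0" by (simp add: residual_def)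
      have rs: "?r (c *\<^sub>R x) = c *\<^sub>R ?r x" for c x
        unfolding residual_def scaleC_of_real[of c x, symmetric] cinner_scaleC_left scaleC_scaleC[symmetric]
        by (simp only: scaleC_of_real scaleR_right_diff_distrib scaleR_sum_right)
      have "onorm (\<lambda>x. - ?r (k x)) \<le> e / 2"
      proof (rule onorm_bound)
        fix x
        show "norm (- ?r (k x)) \<le> e / 2 * norm x"
        proof (cases "x = 0")
          case False
          then have "norm ((1 / norm x) *\<^sub>R ?r (k x)) \<le> e / 2"
            using unit[of "(1 / norm x) *\<^sub>R x"] by (simp add: k.scaleR rs)
          then show ?thesis using False by (simp add: field_simps)
        qed (simp add: k.zero r0)
      qed (use e in simp)
      moreover have "0 \<le> onorm (\<lambda>x. - ?r (k x))"
        using K.nrm_nonneg[OF K.minus_closed[OF tk k], of n] unfolding diff by simp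
      ultimately show ?thesis using e by simp
    qed
    then show "\<exists>no. \<forall>n\<ge>no. norm (onorm (\<lambda>x. - residual (b ` {..<n}) (k x)) - 0) < e" by blast
  qed
  then show ?thesis
    unfolding K.conv_def diff using k tk by (simp only: compact_operators_simps(7)) simp
qed

lemma trunc_conv_right:
  assumes k: "k \<in> carrier K" shows "K.conv (\<lambda>n. k \<otimes>\<^bsub>K\<^esub> trunc n) k"
proof -
  have "K.conv (\<lambda>n. adj K (trunc n \<otimes>\<^bsub>K\<^esub> adj K k)) (adj K (adj K k))"
    by (intro K.conv_adj trunc_conv_left K.adj_closed k)
  then show ?thesis
    using k by (simp only: K.adj_mult[OF trunc_closed K.adj_closed] K.adj_adj trunc_adj)
qed

end

end

section \<open>Cuntz--Krieger families on the graph with heads\<close>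

lemma add_heads_simps [simp]:
  "verts (add_heads G) = Inl ` verts G \<union> Inr ` (verts G \<times> {1..})"
  "arcs (add_heads G) = Inl ` arcs G \<union> Inr ` (verts G \<times> {1..})"
  "tail (add_heads G) (Inl e) = Inl (tail G e)" "tail (add_heads G) (Inr x) = Inr x"
  "head (add_heads G) (Inl e) = Inl (head G e)"
  "head (add_heads G) (Inr (v, i)) = (if i = 1 then Inl v else Inr (v, i - 1))"
  by (auto simp: add_heads_def split: prod.splits)

lemma wf_add_heads: "wf_digraph G \<Longrightarrow> wf_digraph (add_heads G)"
  by (auto simp: wf_digraph_def)

text \<open>No new edge starts at an old vertex, so old vertices keep their singularity and their
  Cuntz-Krieger relation.\<close>

lemma tail_fiber_Inl:
  "{e \<in> arcs (add_heads G). tail (add_heads G) e = Inl v} = Inl ` {e \<in> arcs G. tail G e = v}"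
  by auto

text \<open>A vertex of a head is therefore not singular, and its Cuntz-Krieger relation has a
  single range projection.\<close>

lemma tail_fiber_Inr:
  "v \<in> verts G \<Longrightarrow> i \<ge> 1 \<Longrightarrow> {e \<in> arcs (add_heads G). tail (add_heads G) e = Inr (v, i)} = {Inr (v, i)}"
  by auto

lemma singular_Inl: "singular (add_heads G) (Inl v) \<longleftrightarrow> singular G v"
  unfolding singular_def tail_fiber_Inl by (simp add: finite_image_iff)

lemma CK_familyD:
  assumes "CK_family G A p s"
  shows "v \<in> verts G \<Longrightarrow> p v \<in> carrier A" "v \<in> verts G \<Longrightarrow> adj A (p v) = p v"
    "v \<in> verts G \<Longrightarrow> p v \<otimes>\<^bsub>A\<^esub> p v = p v"
    "v \<in> verts G \<Longrightarrow> w \<in> verts G \<Longrightarrow> v \<noteq> w \<Longrightarrow> p v \<otimes>\<^bsub>A\<^esub> p w = \<zero>\<^bsub>A\<^esub>"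
    "e \<in> arcs G \<Longrightarrow> s e \<in> carrier A" "e \<in> arcs G \<Longrightarrow> s e \<otimes>\<^bsub>A\<^esub> adj A (s e) \<otimes>\<^bsub>A\<^esub> s e = s e"
    "e \<in> arcs G \<Longrightarrow> f \<in> arcs G \<Longrightarrow> e \<noteq> f \<Longrightarrow>
      (s e \<otimes>\<^bsub>A\<^esub> adj A (s e)) \<otimes>\<^bsub>A\<^esub> (s f \<otimes>\<^bsub>A\<^esub> adj A (s f)) = \<zero>\<^bsub>A\<^esub>"
    "e \<in> arcs G \<Longrightarrow> adj A (s e) \<otimes>\<^bsub>A\<^esub> s e = p (head G e)"
    "e \<in> arcs G \<Longrightarrow> p (tail G e) \<otimes>\<^bsub>A\<^esub> (s e \<otimes>\<^bsub>A\<^esub> adj A (s e)) = s e \<otimes>\<^bsub>A\<^esub> adj A (s e)"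
    "v \<in> verts G \<Longrightarrow> \<not> singular G v \<Longrightarrow>
      p v = (\<Oplus>\<^bsub>A\<^esub> e\<in>{e \<in> arcs G. tail G e = v}. s e \<otimes>\<^bsub>A\<^esub> adj A (s e))"
  using assms
  by (simp_all add: CK_family_def projection_def partial_isometry_def range_proj_def proj_le_def)

lemma CK_family_edge:
  assumes "cstar_algebra A" "wf_digraph G" and CK: "CK_family G A p s" and e: "e \<in> arcs G"
  shows "s e \<otimes>\<^bsub>A\<^esub> p (head G e) = s e" "p (tail G e) \<otimes>\<^bsub>A\<^esub> s e = s e"
proof -
  interpret A: cstar_algebra A by fact
  interpret wf_digraph G by fact
  note D = CK_familyD[OF CK]
  have c: "s e \<in> carrier A" "p (tail G e) \<in> carrier A" using e D(1,5) by simp_all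
  show "s e \<otimes>\<^bsub>A\<^esub> p (head G e) = s e"
    using c D(6)[OF e] by (simp add: D(8)[OF e, symmetric] A.mult_assoc)
  have "p (tail G e) \<otimes>\<^bsub>A\<^esub> s e = (p (tail G e) \<otimes>\<^bsub>A\<^esub> (s e \<otimes>\<^bsub>A\<^esub> adj A (s e))) \<otimes>\<^bsub>A\<^esub> s e"
    using c D(6)[OF e] by (simp add: A.mult_assoc)
  then show "p (tail G e) \<otimes>\<^bsub>A\<^esub> s e = s e" using D(6)[OF e] by (simp add: D(9)[OF e])
qed

text \<open>Universality of C*(G), applied to this family, supplies \<theta>.\<close>

lemma CK_family_restrict:
  assumes "cstar_algebra B" "CK_family (add_heads G) B P S"
  shows "CK_family G B (P \<circ> Inl) (S \<circ> Inl)"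
proof -
  interpret B: cstar_algebra B by fact
  note D = CK_familyD[OF assms(2)]
  show ?thesis
    unfolding CK_family_def projection_def partial_isometry_def range_proj_def proj_le_def comp_def
  proof (intro conjI ballI impI)
    fix v assume v: "v \<in> verts G" "\<not> singular G v"
    have c: "S (Inl e) \<in> carrier B" if "e \<in> arcs G" for e using D(5)[of "Inl e"] that by simp
    have "P (Inl v) = (\<Oplus>\<^bsub>B\<^esub> e\<in>Inl ` {e \<in> arcs G. tail G e = v}. S e \<otimes>\<^bsub>B\<^esub> adj B (S e))"
      using D(10)[of "Inl v", unfolded tail_fiber_Inl singular_Inl] v by simp
    also have "\<dots> = (\<Oplus>\<^bsub>B\<^esub> e\<in>{e \<in> arcs G. tail G e = v}. S (Inl e) \<otimes>\<^bsub>B\<^esub> adj B (S (Inl e)))"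
      using c by (intro B.finsum_reindex) auto
    finally show "P (Inl v) = (\<Oplus>\<^bsub>B\<^esub> e\<in>{e \<in> arcs G. tail G e = v}. S (Inl e) \<otimes>\<^bsub>B\<^esub> adj B (S (Inl e)))" .
  next
    fix v w assume "v \<in> verts G" "w \<in> verts G" "v \<noteq> w"
    then show "P (Inl v) \<otimes>\<^bsub>B\<^esub> P (Inl w) = \<zero>\<^bsub>B\<^esub>" by (intro D(4)) auto
  next
    fix e f assume "e \<in> arcs G" "f \<in> arcs G" "e \<noteq> f"
    then show "(S (Inl e) \<otimes>\<^bsub>B\<^esub> adj B (S (Inl e))) \<otimes>\<^bsub>B\<^esub> (S (Inl f) \<otimes>\<^bsub>B\<^esub> adj B (S (Inl f))) = \<zero>\<^bsub>B\<^esub>"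
      by (intro D(7)) auto
  next
    fix e assume "e \<in> arcs G"
    then have e: "Inl e \<in> arcs (add_heads G)" by simp
    show "S (Inl e) \<in> carrier B" "S (Inl e) \<otimes>\<^bsub>B\<^esub> adj B (S (Inl e)) \<otimes>\<^bsub>B\<^esub> S (Inl e) = S (Inl e)"
      "adj B (S (Inl e)) \<otimes>\<^bsub>B\<^esub> S (Inl e) = P (Inl (head G e))"
      "P (Inl (tail G e)) \<otimes>\<^bsub>B\<^esub> (S (Inl e) \<otimes>\<^bsub>B\<^esub> adj B (S (Inl e))) = S (Inl e) \<otimes>\<^bsub>B\<^esub> adj B (S (Inl e))"
      using D(5,6,8,9)[OF e] by simp_all
  next
    fix v assume "v \<in> verts G"
    then have v: "Inl v \<in> verts (add_heads G)" by simp
    show "P (Inl v) \<in> carrier B" "adj B (P (Inl v)) = P (Inl v)" "P (Inl v) \<otimes>\<^bsub>B\<^esub> P (Inl v) = P (Inl v)"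
      using D(1,2,3)[OF v] by simp_all
  qed
qed

text \<open>The path \<open>v\<^sub>i \<rightarrow> \<dots> \<rightarrow> v\<close> in the added head gives a partial isometry from \<open>p\<^sub>v\<close> onto \<open>p\<^bsub>v\<^sub>i\<^esub>\<close>.\<close>

primrec head_path :: "'b cstar \<Rightarrow> ('v + 'v \<times> nat \<Rightarrow> 'b) \<Rightarrow> ('e + 'v \<times> nat \<Rightarrow> 'b) \<Rightarrow> 'v \<Rightarrow> nat \<Rightarrow> 'b" where
  "head_path B P S v 0 = P (Inl v)"
| "head_path B P S v (Suc i) = S (Inr (v, Suc i)) \<otimes>\<^bsub>B\<^esub> head_path B P S v i"

text \<open>Index 0 is v itself, so the edge with index i + 1 always runs from index i + 1 to index
  i.\<close>

definition head_vertex :: "'v \<Rightarrow> nat \<Rightarrow> 'v + 'v \<times> nat" where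
  "head_vertex v i = (if i = 0 then Inl v else Inr (v, i))"

lemma head_vertex_in: "v \<in> verts G \<Longrightarrow> head_vertex v i \<in> verts (add_heads G)"
  by (auto simp: head_vertex_def)

lemma head_vertex_eq: "head_vertex v i = head_vertex w j \<longleftrightarrow> v = w \<and> i = j"
  by (auto simp: head_vertex_def)

section \<open>Partial isometries of paths in the added heads\<close>

locale CK_add_heads = cstar_algebra B for B :: "'b cstar" (structure) +
  fixes G :: "('v, 'e) pre_digraph" and P S
  assumes CK: "CK_family (add_heads G) B P S" and wf: "wf_digraph G"
begin

abbreviation W where "W \<equiv> head_path B P S"

lemmas CKD = CK_familyD[OF CK]

text \<open>The range projection equals the vertex projection, instead of only lying below it,
  because the vertex with index i + 1 emits this edge alone. So each new edge links consecutive
  vertex projections by an equivalence.\<close>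

lemma head_edge:
  assumes "v \<in> verts G"
  shows "S (Inr (v, Suc i)) \<in> carrier B"
    "adj B (S (Inr (v, Suc i))) \<otimes> S (Inr (v, Suc i)) = P (head_vertex v i)"
    "S (Inr (v, Suc i)) \<otimes> adj B (S (Inr (v, Suc i))) = P (head_vertex v (Suc i))"
    "S (Inr (v, Suc i)) \<otimes> P (head_vertex v i) = S (Inr (v, Suc i))"
proof -
  have e: "Inr (v, Suc i) \<in> arcs (add_heads G)" using assms by simp
  show c: "S (Inr (v, Suc i)) \<in> carrier B" by (rule CKD(5)[OF e])
  have h: "head (add_heads G) (Inr (v, Suc i)) = head_vertex v i" by (simp add: head_vertex_def)
  show "adj B (S (Inr (v, Suc i))) \<otimes> S (Inr (v, Suc i)) = P (head_vertex v i)"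
    using CKD(8)[OF e] by (simp only: h)
  show "S (Inr (v, Suc i)) \<otimes> P (head_vertex v i) = S (Inr (v, Suc i))"
    using CK_family_edge(1)[OF cstar_algebra_axioms wf_add_heads[OF wf] CK e] by (simp only: h)
  have f: "{e \<in> arcs (add_heads G). tail (add_heads G) e = Inr (v, Suc i)} = {Inr (v, Suc i)}"
    using assms by (intro tail_fiber_Inr) auto
  have "P (Inr (v, Suc i)) = (\<Oplus>e\<in>{Inr (v, Suc i)}. S e \<otimes> adj B (S e))"
    using CKD(10)[of "Inr (v, Suc i)", unfolded singular_def f] assms by simp
  also have "\<dots> = S (Inr (v, Suc i)) \<otimes> adj B (S (Inr (v, Suc i)))"
    using c by (simp add: finsum_insert)
  finally show "S (Inr (v, Suc i)) \<otimes> adj B (S (Inr (v, Suc i))) = P (head_vertex v (Suc i))"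
    by (simp add: head_vertex_def)
qed

lemma P_head_vertex [simp]: "v \<in> verts G \<Longrightarrow> P (head_vertex v i) \<in> carrier B"
  "v \<in> verts G \<Longrightarrow> adj B (P (head_vertex v i)) = P (head_vertex v i)"
  "v \<in> verts G \<Longrightarrow> P (head_vertex v i) \<otimes> P (head_vertex v i) = P (head_vertex v i)"
  by (rule CKD(1-3)[OF head_vertex_in], assumption)+

lemma P_Inl [simp]: "v \<in> verts G \<Longrightarrow> P (Inl v) \<in> carrier B"
  "v \<in> verts G \<Longrightarrow> adj B (P (Inl v)) = P (Inl v)"
  "v \<in> verts G \<Longrightarrow> P (Inl v) \<otimes> P (Inl v) = P (Inl v)"
  using P_head_vertex[of v 0] by (simp_all add: head_vertex_def)

lemma W_closed [simp]: "v \<in> verts G \<Longrightarrow> W v i \<in> carrier B"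
  by (induction i) (simp_all add: head_edge(1))

lemma P_W: "v \<in> verts G \<Longrightarrow> P (head_vertex v i) \<otimes> W v i = W v i"
proof (cases i)
  case (Suc j)
  assume v: "v \<in> verts G"
  note s = head_edge[OF v, of j]
  have "P (head_vertex v (Suc j)) \<otimes> S (Inr (v, Suc j)) = S (Inr (v, Suc j)) \<otimes> (adj B (S (Inr (v, Suc j))) \<otimes> S (Inr (v, Suc j)))"
    using s(1) by (simp add: s(3)[symmetric] mult_assoc)
  then have "P (head_vertex v (Suc j)) \<otimes> S (Inr (v, Suc j)) = S (Inr (v, Suc j))" by (simp only: s(2,4))
  then show ?thesis using v s(1) Suc by (simp add: mult_assoc[symmetric])
qed (simp add: head_vertex_def)

lemma adj_W_W: "v \<in> verts G \<Longrightarrow> adj B (W v i) \<otimes> W v i = P (Inl v)"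
proof (induction i)
  case (Suc i)
  note v = Suc.prems and s = head_edge[OF Suc.prems, of i]
  have "adj B (W v (Suc i)) \<otimes> W v (Suc i)
      = adj B (W v i) \<otimes> ((adj B (S (Inr (v, Suc i))) \<otimes> S (Inr (v, Suc i))) \<otimes> W v i)"
    using v s(1) by (simp add: adj_mult mult_assoc)
  also have "\<dots> = adj B (W v i) \<otimes> W v i" by (simp only: s(2) P_W[OF v])
  finally show ?case using Suc.IH[OF v] by simp
qed simp

lemma W_adj_W: "v \<in> verts G \<Longrightarrow> W v i \<otimes> adj B (W v i) = P (head_vertex v i)"
proof (induction i)
  case 0
  then show ?case by (simp add: head_vertex_def)
next
  case (Suc i)
  note v = Suc.prems and s = head_edge[OF Suc.prems, of i]
  have "W v (Suc i) \<otimes> adj B (W v (Suc i))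
      = S (Inr (v, Suc i)) \<otimes> (W v i \<otimes> adj B (W v i)) \<otimes> adj B (S (Inr (v, Suc i)))"
    using v s(1) by (simp add: adj_mult mult_assoc)
  then show ?case by (simp only: Suc.IH[OF v] s(3,4))
qed

text \<open>The range projection of a path is the projection of its starting vertex, and these are
  mutually orthogonal. By these relations the paths behave like a column of matrix units.\<close>

lemma adj_W_W_eq:
  assumes v: "v \<in> verts G" and w: "w \<in> verts G"
  shows "adj B (W v i) \<otimes> W w j = (if v = w \<and> i = j then P (Inl v) else \<zero>)"
proof (cases "v = w \<and> i = j")
  case False
  have "adj B (W v i) \<otimes> W w j = adj B (P (head_vertex v i) \<otimes> W v i) \<otimes> (P (head_vertex w j) \<otimes> W w j)"
    using v w by (simp only: P_W)
  also have "\<dots> = adj B (W v i) \<otimes> ((P (head_vertex v i) \<otimes> P (head_vertex w j)) \<otimes> W w j)"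
    using v w by (simp add: adj_mult mult_assoc)
  also have "P (head_vertex v i) \<otimes> P (head_vertex w j) = \<zero>"
    by (rule CKD(4)[OF head_vertex_in[OF v] head_vertex_in[OF w]]) (use False in \<open>simp add: head_vertex_eq\<close>)
  finally have "adj B (W v i) \<otimes> W w j = \<zero>" using v w by simp
  then show ?thesis by (simp only: if_not_P[OF False])
qed (use v adj_W_W in simp)

lemma W_P: "v \<in> verts G \<Longrightarrow> W v i \<otimes> P (Inl v) = W v i"
  using adj_W_W[of v i] W_adj_W[of v i] P_W[of v i] mult_assoc[of "W v i" "adj B (W v i)" "W v i"] by simp

end

locale stabilized_graph_algebra =
  wf_digraph G + orthonormal_basis b + cstar_tensor_product A compact_operators T tens
  for G :: "('v, 'e) pre_digraph" and b :: "nat \<Rightarrow> 'h::complex_hilbert" and A :: "'a cstar" and T :: "'t cstar"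
    and tens :: "'a \<Rightarrow> ('h \<Rightarrow> 'h) \<Rightarrow> 't" +
  fixes p :: "'v \<Rightarrow> 'a" and s :: "'e \<Rightarrow> 'a"
  assumes CK_A: "CK_family G A p s"
begin


end

section \<open>The isomorphism\<close>

context stabilized_graph_algebra begin

lemmas pD = CK_familyD[OF CK_A]

lemma p_closed [simp]: "v \<in> verts G \<Longrightarrow> p v \<in> carrier A" by (rule pD(1))
lemma s_closed [simp]: "e \<in> arcs G \<Longrightarrow> s e \<in> carrier A" by (rule pD(5))

lemma p_mult: "v \<in> verts G \<Longrightarrow> w \<in> verts G \<Longrightarrow> p v \<otimes>\<^bsub>A\<^esub> p w = (if v = w then p v else \<zero>\<^bsub>A\<^esub>)"
  using pD(3,4) by auto

lemma s_range_mult: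
  assumes "e \<in> arcs G" "f \<in> arcs G"
  shows "(s e \<otimes>\<^bsub>A\<^esub> adj A (s e)) \<otimes>\<^bsub>A\<^esub> (s f \<otimes>\<^bsub>A\<^esub> adj A (s f))
    = (if e = f then s e \<otimes>\<^bsub>A\<^esub> adj A (s e) else \<zero>\<^bsub>A\<^esub>)"
proof (cases "e = f")
  case True
  have "(s e \<otimes>\<^bsub>A\<^esub> adj A (s e)) \<otimes>\<^bsub>A\<^esub> (s e \<otimes>\<^bsub>A\<^esub> adj A (s e))
      = (s e \<otimes>\<^bsub>A\<^esub> adj A (s e) \<otimes>\<^bsub>A\<^esub> s e) \<otimes>\<^bsub>A\<^esub> adj A (s e)"
    using assms(1) by (simp add: A.mult_assoc)
  then show ?thesis using True pD(6)[OF assms(1)] by simp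
qed (use assms pD(7) in simp)

section \<open>The Cuntz-Krieger family in the tensor product\<close>

definition tens_unit :: "'a \<Rightarrow> nat \<Rightarrow> nat \<Rightarrow> 't" where
  "tens_unit a i j = tens a (matrix_unit i j)"

lemma tens_unit_closed [simp]: "a \<in> carrier A \<Longrightarrow> tens_unit a i j \<in> carrier T"
  by (simp add: tens_unit_def)

lemma tens_unit_mult: "a \<in> carrier A \<Longrightarrow> a' \<in> carrier A \<Longrightarrow>
    tens_unit a i j \<otimes>\<^bsub>T\<^esub> tens_unit a' k l = (if j = k then tens_unit (a \<otimes>\<^bsub>A\<^esub> a') i l else \<zero>\<^bsub>T\<^esub>)"
  using tens_zero_right[of "a \<otimes>\<^bsub>A\<^esub> a'"] by (simp add: tens_unit_def tens_mult matrix_unit_mult)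

lemma tens_unit_adj: "a \<in> carrier A \<Longrightarrow> adj T (tens_unit a i j) = tens_unit (adj A a) j i"
  by (simp add: tens_unit_def tens_adj)

lemma tens_unit_zero [simp]: "tens_unit \<zero>\<^bsub>A\<^esub> i j = \<zero>\<^bsub>T\<^esub>"
  by (simp add: tens_unit_def)

definition stable_p :: "'v + 'v \<times> nat \<Rightarrow> 't" where
  "stable_p x = (case x of Inl v \<Rightarrow> tens_unit (p v) 0 0 | Inr (v, i) \<Rightarrow> tens_unit (p v) i i)"

definition stable_s :: "'e + 'v \<times> nat \<Rightarrow> 't" where
  "stable_s x = (case x of Inl e \<Rightarrow> tens_unit (s e) 0 0 | Inr (v, i) \<Rightarrow> tens_unit (p v) i (i - 1))"

lemma stable_simps [simp]:
  "stable_p (Inl v) = tens_unit (p v) 0 0" "stable_p (Inr (v, i)) = tens_unit (p v) i i"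
  "stable_s (Inl e) = tens_unit (s e) 0 0" "stable_s (Inr (v, i)) = tens_unit (p v) i (i - 1)"
  by (simp_all add: stable_p_def stable_s_def)

lemma range_stable_s:
  "e \<in> arcs G \<Longrightarrow> tens_unit (s e) 0 0 \<otimes>\<^bsub>T\<^esub> adj T (tens_unit (s e) 0 0) = tens_unit (s e \<otimes>\<^bsub>A\<^esub> adj A (s e)) 0 0"
  "v \<in> verts G \<Longrightarrow> tens_unit (p v) i j \<otimes>\<^bsub>T\<^esub> adj T (tens_unit (p v) i j) = tens_unit (p v) i i"
  by (simp_all add: tens_unit_adj tens_unit_mult pD)

text \<open>Old edges have ranges at index (0, 0) and the new edge with index i has its range at (i,
  i) with i \<ge> 1, so the two kinds are orthogonal. At an old vertex, tensoring with a fixed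
  matrix unit commutes with the finite sum.\<close>

lemma CK_family_stable: "CK_family (add_heads G) T stable_p stable_s"
  unfolding CK_family_def projection_def partial_isometry_def range_proj_def proj_le_def
proof (intro conjI ballI impI)
  fix x assume "x \<in> verts (add_heads G)"
  then show "stable_p x \<in> carrier T" "adj T (stable_p x) = stable_p x"
    "stable_p x \<otimes>\<^bsub>T\<^esub> stable_p x = stable_p x"
    by (auto simp: tens_unit_adj tens_unit_mult pD)
  fix y assume "y \<in> verts (add_heads G)" "x \<noteq> y"
  with \<open>x \<in> verts (add_heads G)\<close> show "stable_p x \<otimes>\<^bsub>T\<^esub> stable_p y = \<zero>\<^bsub>T\<^esub>"
    by (auto simp: tens_unit_mult p_mult split: if_splits)
next
  fix x assume x: "x \<in> arcs (add_heads G)"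
  then show "stable_s x \<in> carrier T" by auto
  show "stable_s x \<otimes>\<^bsub>T\<^esub> adj T (stable_s x) \<otimes>\<^bsub>T\<^esub> stable_s x = stable_s x"
    using x by (auto simp: range_stable_s tens_unit_mult pD(3,6))
  show "adj T (stable_s x) \<otimes>\<^bsub>T\<^esub> stable_s x = stable_p (head (add_heads G) x)"
    using x by (auto simp: tens_unit_adj tens_unit_mult pD(2,3,8))
  show "stable_p (tail (add_heads G) x) \<otimes>\<^bsub>T\<^esub> (stable_s x \<otimes>\<^bsub>T\<^esub> adj T (stable_s x)) = stable_s x \<otimes>\<^bsub>T\<^esub> adj T (stable_s x)"
    using x by (auto simp: range_stable_s tens_unit_mult pD(3,9))
  fix y assume "y \<in> arcs (add_heads G)" "x \<noteq> y"
  with x show "stable_s x \<otimes>\<^bsub>T\<^esub> adj T (stable_s x) \<otimes>\<^bsub>T\<^esub> (stable_s y \<otimes>\<^bsub>T\<^esub> adj T (stable_s y)) = \<zero>\<^bsub>T\<^esub>"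
    by (auto simp: range_stable_s tens_unit_mult p_mult s_range_mult split: if_splits)
next
  fix x assume x: "x \<in> verts (add_heads G)" "\<not> singular (add_heads G) x"
  show "stable_p x = (\<Oplus>\<^bsub>T\<^esub>e\<in>{e \<in> arcs (add_heads G). tail (add_heads G) e = x}. stable_s e \<otimes>\<^bsub>T\<^esub> adj T (stable_s e))"
  proof (cases x)
    case (Inl v)
    let ?E = "{e \<in> arcs G. tail G e = v}"
    have v: "v \<in> verts G" "\<not> singular G v" using x Inl by (auto simp: singular_Inl)
    have "(\<Oplus>\<^bsub>T\<^esub>e\<in>Inl ` ?E. stable_s e \<otimes>\<^bsub>T\<^esub> adj T (stable_s e)) = (\<Oplus>\<^bsub>T\<^esub>e\<in>?E. stable_s (Inl e) \<otimes>\<^bsub>T\<^esub> adj T (stable_s (Inl e)))"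
      by (intro T.finsum_reindex) auto
    also have "\<dots> = (\<Oplus>\<^bsub>T\<^esub>e\<in>?E. tens (s e \<otimes>\<^bsub>A\<^esub> adj A (s e)) (matrix_unit 0 0))"
      by (intro T.finsum_cong') (auto simp: range_stable_s tens_unit_def[symmetric])
    also have "\<dots> = tens (\<Oplus>\<^bsub>A\<^esub>e\<in>?E. s e \<otimes>\<^bsub>A\<^esub> adj A (s e)) (matrix_unit 0 0)"
      by (intro tens_finsum_left[symmetric]) auto
    also have "\<dots> = stable_p x" using Inl pD(10)[OF v] by (simp add: tens_unit_def)
    finally show ?thesis unfolding Inl tail_fiber_Inl by simp
  next
    case (Inr y)
    then obtain v i where y: "x = Inr (v, i)" "v \<in> verts G" "i \<ge> 1" using x by auto
    show ?thesis unfolding y(1) tail_fiber_Inr[OF y(2,3)] using y(2) by (simp add: T.finsum_insert range_stable_s)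
  qed
qed

end

locale stabilized_graph_algebras = stabilized_graph_algebra G b A T tens p s + B: CK_add_heads B G P S
  for G :: "('v, 'e) pre_digraph" and b :: "nat \<Rightarrow> 'h::complex_hilbert" and A :: "'a cstar" and T :: "'t cstar"
    and tens :: "'a \<Rightarrow> ('h \<Rightarrow> 'h) \<Rightarrow> 't" and p :: "'v \<Rightarrow> 'a" and s :: "'e \<Rightarrow> 'a"
    and B :: "'b cstar" and P S +
  fixes \<theta> :: "'a \<Rightarrow> 'b" and \<phi> :: "'b \<Rightarrow> 't"
  assumes gen_A: "cstar_generated A (p ` verts G \<union> s ` arcs G) = carrier A"
    and gen_B: "cstar_generated B (P ` verts (add_heads G) \<union> S ` arcs (add_heads G)) = carrier B"
    and \<theta>: "\<theta> \<in> cstar_hom A B" and \<theta>_p: "v \<in> verts G \<Longrightarrow> \<theta> (p v) = P (Inl v)"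
    and \<theta>_s: "e \<in> arcs G \<Longrightarrow> \<theta> (s e) = S (Inl e)"
    and \<phi>: "\<phi> \<in> cstar_hom B T" and \<phi>_P: "x \<in> verts (add_heads G) \<Longrightarrow> \<phi> (P x) = stable_p x"
    and \<phi>_S: "f \<in> arcs (add_heads G) \<Longrightarrow> \<phi> (S f) = stable_s f"
begin

abbreviation W where "W \<equiv> head_path B P S"

lemmas \<theta>D [simp] = cstar_homD(1)[OF \<theta>]
lemmas \<phi>D [simp] = cstar_homD(1)[OF \<phi>]

lemma \<phi>_W: "v \<in> verts G \<Longrightarrow> \<phi> (W v i) = tens_unit (p v) i 0"
proof (induction i)
  case (Suc i)
  then show ?case
    using cstar_homD(5)[OF \<phi> B.head_edge(1)[OF Suc.prems, of i] B.W_closed[OF Suc.prems, of i]] \<phi>_S[of "Inr (v, Suc i)"]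
    by (simp add: tens_unit_mult pD(3))
qed (simp add: \<phi>_P)

lemma \<phi>_\<theta>: "a \<in> carrier A \<Longrightarrow> \<phi> (\<theta> a) = tens_unit a 0 0"
proof -
  assume a: "a \<in> carrier A"
  have "(\<phi> \<circ> \<theta>) a = tens a (matrix_unit 0 0)"
  proof (rule cstar_hom_eq_on_generated[OF cstar_A cstar_T _ tens_hom_left[OF projection_matrix_unit]])
    show "\<phi> \<circ> \<theta> \<in> cstar_hom A T"
      using \<theta> \<phi> unfolding cstar_hom_def by (auto simp: Pi_iff)
    show "p ` verts G \<union> s ` arcs G \<subseteq> carrier A" by auto
    show "a \<in> cstar_generated A (p ` verts G \<union> s ` arcs G)" using a gen_A by simp
    fix x assume "x \<in> p ` verts G \<union> s ` arcs G"
    then show "(\<phi> \<circ> \<theta>) x = tens x (matrix_unit 0 0)"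
      by (auto simp: \<theta>_p \<theta>_s \<phi>_P \<phi>_S tens_unit_def)
  qed
  then show ?thesis by (simp add: tens_unit_def)
qed

text \<open>This is where the independence axiom enters: it makes a \<mapsto> a \<otimes>
  \<open>matrix_unit 0 0\<close> injective, hence isometric.\<close>

lemma nrm_tens_unit: "a \<in> carrier A \<Longrightarrow> nrm T (tens_unit a 0 0) = nrm A a"
proof -
  assume a: "a \<in> carrier A"
  have "inj_on (\<lambda>a. tens a (matrix_unit 0 0)) (carrier A)"
  proof (rule inj_onI)
    fix x y assume xy: "x \<in> carrier A" "y \<in> carrier A" "tens x (matrix_unit 0 0) = tens y (matrix_unit 0 0)"
    then have "tens (x \<ominus>\<^bsub>A\<^esub> y) (matrix_unit 0 0) = \<zero>\<^bsub>T\<^esub>"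
      by (simp add: tens_diff_left T.minus_eq_zero_iff)
    then have "x \<ominus>\<^bsub>A\<^esub> y = \<zero>\<^bsub>A\<^esub>"
      using xy matrix_unit_nonzero by (intro tens_eq_zero[of _ "matrix_unit 0 0"]) simp_all
    then show "x = y" using xy by (simp add: A.minus_eq_zero_iff)
  qed
  then show ?thesis unfolding tens_unit_def
    by (rule cstar_hom_isometric[OF cstar_A cstar_T tens_hom_left[OF projection_matrix_unit] _ a])
qed

section \<open>Corners and injectivity\<close>

definition corner :: "'v \<Rightarrow> nat \<Rightarrow> 'a \<Rightarrow> 'v \<Rightarrow> nat \<Rightarrow> 'b" where
  "corner v i a w j = W v i \<otimes>\<^bsub>B\<^esub> \<theta> a \<otimes>\<^bsub>B\<^esub> adj B (W w j)"

lemma corner_closed [simp]: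
  "v \<in> verts G \<Longrightarrow> w \<in> verts G \<Longrightarrow> a \<in> carrier A \<Longrightarrow> corner v i a w j \<in> carrier B"
  by (simp add: corner_def)

lemma \<theta>_mult: "a \<in> carrier A \<Longrightarrow> a' \<in> carrier A \<Longrightarrow> \<theta> (a \<otimes>\<^bsub>A\<^esub> a') = \<theta> a \<otimes>\<^bsub>B\<^esub> \<theta> a'"
  by (rule cstar_homD(5)[OF \<theta>])

text \<open>The middle factor arises from adj W W = \<theta> (p w). Thus products of corners are
  again corners or 0, with indices multiplying like those of matrix units.\<close>

lemma corner_mult:
  assumes "v \<in> verts G" "w \<in> verts G" "v' \<in> verts G" "w' \<in> verts G" "a \<in> carrier A" "a' \<in> carrier A"
  shows "corner v i a w j \<otimes>\<^bsub>B\<^esub> corner v' i' a' w' j' =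
    (if w = v' \<and> j = i' then corner v i (a \<otimes>\<^bsub>A\<^esub> p w \<otimes>\<^bsub>A\<^esub> a') w' j' else \<zero>\<^bsub>B\<^esub>)"
proof -
  have "corner v i a w j \<otimes>\<^bsub>B\<^esub> corner v' i' a' w' j'
      = W v i \<otimes>\<^bsub>B\<^esub> (\<theta> a \<otimes>\<^bsub>B\<^esub> ((adj B (W w j) \<otimes>\<^bsub>B\<^esub> W v' i') \<otimes>\<^bsub>B\<^esub> (\<theta> a' \<otimes>\<^bsub>B\<^esub> adj B (W w' j'))))"
    using assms by (simp add: corner_def B.mult_assoc)
  also have "\<dots> = (if w = v' \<and> j = i' then corner v i (a \<otimes>\<^bsub>A\<^esub> p w \<otimes>\<^bsub>A\<^esub> a') w' j' else \<zero>\<^bsub>B\<^esub>)"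
    using assms by (simp add: B.adj_W_W_eq corner_def \<theta>_mult \<theta>_p B.mult_assoc)
  finally show ?thesis .
qed

text \<open>Finite sums suffice for a linear span: scalars are absorbed into a.\<close>

inductive_set corner_span :: "'b set" where
  zero: "\<zero>\<^bsub>B\<^esub> \<in> corner_span"
| step: "v \<in> verts G \<Longrightarrow> w \<in> verts G \<Longrightarrow> a \<in> carrier A \<Longrightarrow> x \<in> corner_span \<Longrightarrow>
    corner v i a w j \<oplus>\<^bsub>B\<^esub> x \<in> corner_span"

lemma corner_span_closed: "x \<in> corner_span \<Longrightarrow> x \<in> carrier B"
  by (induction rule: corner_span.induct) simp_all

lemma corner_span_add: "x \<in> corner_span \<Longrightarrow> y \<in> corner_span \<Longrightarrow> x \<oplus>\<^bsub>B\<^esub> y \<in> corner_span"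
proof (induction rule: corner_span.induct)
  case (step v w a x i j)
  then have "corner v i a w j \<oplus>\<^bsub>B\<^esub> x \<oplus>\<^bsub>B\<^esub> y = corner v i a w j \<oplus>\<^bsub>B\<^esub> (x \<oplus>\<^bsub>B\<^esub> y)"
    by (simp add: corner_span_closed B.a_assoc)
  then show ?case using step by (simp add: corner_span.step)
qed (simp add: corner_span_closed)

lemma corner_in_span:
  assumes "v \<in> verts G" "w \<in> verts G" "a \<in> carrier A" shows "corner v i a w j \<in> corner_span"
  using corner_span.step[OF assms corner_span.zero, of i j] assms by simp

lemma corner_span_smul: "x \<in> corner_span \<Longrightarrow> smul B c x \<in> corner_span"
proof (induction rule: corner_span.induct)
  case (step v w a x i j)
  have "smul B c (corner v i a w j) = corner v i (smul A c a) w j"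
    using step by (simp add: corner_def cstar_homD(3)[OF \<theta>] B.smul_mult_left B.smul_mult_right)
  then show ?case
    using step by (simp add: corner_span_closed B.smul_add_right corner_span.step)
qed (simp add: corner_span.zero)

lemma corner_span_adj: "x \<in> corner_span \<Longrightarrow> adj B x \<in> corner_span"
proof (induction rule: corner_span.induct)
  case (step v w a x i j)
  have "adj B (corner v i a w j) = corner w j (adj A a) v i"
    using step by (simp add: corner_def cstar_homD(2)[OF \<theta>] B.adj_mult B.adj_adj B.mult_assoc)
  then show ?case
    using step by (simp add: corner_span_closed B.adj_add corner_span.step)
qed (simp add: corner_span.zero)

lemma corner_mult_span:
  assumes "v \<in> verts G" "w \<in> verts G" "a \<in> carrier A" and y: "y \<in> corner_span"
  shows "corner v i a w j \<otimes>\<^bsub>B\<^esub> y \<in> corner_span"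
  using y
proof (induction rule: corner_span.induct)
  case (step v' w' a' x i' j')
  have "corner v i a w j \<otimes>\<^bsub>B\<^esub> corner v' i' a' w' j' \<in> corner_span"
    using assms step by (simp add: corner_mult corner_in_span corner_span.zero)
  then show ?case using assms step by (simp add: B.distrib_left corner_span_closed corner_span_add)
qed (use assms in \<open>simp add: corner_span.zero\<close>)

lemma corner_span_mult: "x \<in> corner_span \<Longrightarrow> y \<in> corner_span \<Longrightarrow> x \<otimes>\<^bsub>B\<^esub> y \<in> corner_span"
proof (induction rule: corner_span.induct)
  case (step v w a x i j)
  then show ?case by (simp add: B.distrib_right corner_span_closed corner_mult_span corner_span_add)
qed (simp add: corner_span_closed corner_span.zero)

text \<open>Each generator is a single corner: a vertex projection is W p adj W with equal indices,
  an old edge is p s p at index 0, and a new edge is W at i + 1 times the adjoint of W at i.\<close>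

lemma generators_in_corner_span:
  "P ` verts (add_heads G) \<union> S ` arcs (add_heads G) \<subseteq> corner_span"
proof (intro Un_least image_subsetI)
  have P: "P (head_vertex v i) \<in> corner_span" if v: "v \<in> verts G" for v i
  proof -
    have "P (head_vertex v i) = corner v i (p v) v i"
      using v by (simp add: corner_def \<theta>_p B.W_P B.W_adj_W)
    then show ?thesis using corner_in_span[OF v v p_closed[OF v], of i i] by simp
  qed
  fix x assume "x \<in> verts (add_heads G)"
  then obtain v i where "v \<in> verts G" "x = head_vertex v i"
  proof (cases x)
    case (Inl v)
    then show ?thesis using that[of v 0] \<open>x \<in> verts (add_heads G)\<close> by (auto simp: head_vertex_def)
  next
    case (Inr y)
    then show ?thesis using that[of "fst y" "snd y"] \<open>x \<in> verts (add_heads G)\<close> by (auto simp: head_vertex_def)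
  qed
  then show "P x \<in> corner_span" using P by simp
next
  fix x assume "x \<in> arcs (add_heads G)"
  then consider e where "e \<in> arcs G" "x = Inl e" | v i where "v \<in> verts G" "x = Inr (v, Suc i)"
    by (auto simp: Suc_le_eq gr0_conv_Suc)
  then show "S x \<in> corner_span"
  proof cases
    case 1
    note ht = tail_in_verts[OF 1(1)] head_in_verts[OF 1(1)]
    have e: "Inl e \<in> arcs (add_heads G)" using 1 by simp
    note eq = CK_family_edge[OF B.cstar_algebra_axioms wf_add_heads[OF wf_digraph_axioms] B.CK e, simplified]
    have "S (Inl e) = corner (tail G e) 0 (s e) (head G e) 0"
      using 1 ht eq by (simp add: corner_def \<theta>_s)
    then show ?thesis using corner_in_span[OF ht s_closed[OF 1(1)], of 0 0] 1 by simp
  next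
    case 2
    have "S (Inr (v, Suc i)) = corner v (Suc i) (p v) v i"
    proof -
      have "corner v (Suc i) (p v) v i = W v (Suc i) \<otimes>\<^bsub>B\<^esub> adj B (W v i)"
        using 2(1) by (simp only: corner_def \<theta>_p B.W_P)
      also have "\<dots> = S (Inr (v, Suc i)) \<otimes>\<^bsub>B\<^esub> P (head_vertex v i)"
        using 2(1) B.head_edge(1)[OF 2(1), of i] by (simp add: B.mult_assoc B.W_adj_W)
      finally show ?thesis using B.head_edge(4)[OF 2(1), of i] by simp
    qed
    then show ?thesis using corner_in_span[OF 2(1) 2(1) p_closed[OF 2(1)], of "Suc i" i] 2 by simp
  qed
qed

text \<open>The span is closed under products and adjoints and contains the generators, so its
  closure is all of \<open>B\<close>.\<close>

lemma corner_span_approx: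
  assumes x: "x \<in> carrier B"
  obtains X where "\<And>n. X n \<in> corner_span" "B.conv X x"
proof -
  have sub: "corner_span \<subseteq> carrier B" using corner_span_closed by blast
  let ?C = "Abstract_Topology.closure_of (norm_topology B) corner_span"
  interpret M: Metric_space "carrier B" "cdist B" by (rule B.Metric_space_cdist)
  have "cstar_subalgebra ?C B"
    by (rule B.cstar_subalgebra_closure[OF sub corner_span.zero corner_span_add corner_span_mult
          corner_span_adj corner_span_smul])
  moreover have "corner_span \<subseteq> ?C" using sub by (simp add: closure_of_subset)
  ultimately have "carrier B \<subseteq> ?C"
    using cstar_generated_subset[of ?C B] generators_in_corner_span gen_B by blast
  then show thesis using B.in_closure_conv[OF sub] x that by blast
qed

text \<open>On a corner the outer paths cancel by \<open>adj_W_W_eq\<close>, which leaves either 0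
  or \<theta> (p v a p w).\<close>

lemma compression_in_range:
  assumes v: "v \<in> verts G" and w: "w \<in> verts G" and y: "y \<in> corner_span"
  shows "adj B (W v i) \<otimes>\<^bsub>B\<^esub> y \<otimes>\<^bsub>B\<^esub> W w j \<in> \<theta> ` carrier A"
  using y
proof (induction rule: corner_span.induct)
  case zero
  then show ?case using v w cstar_hom_zero[OF cstar_A B.cstar_algebra_axioms \<theta>]
    by (intro image_eqI[of _ _ "\<zero>\<^bsub>A\<^esub>"]) simp_all
next
  case (step v' w' a x i' j')
  then obtain a' where a': "a' \<in> carrier A" "adj B (W v i) \<otimes>\<^bsub>B\<^esub> x \<otimes>\<^bsub>B\<^esub> W w j = \<theta> a'" by blast
  have "adj B (W v i) \<otimes>\<^bsub>B\<^esub> corner v' i' a w' j' \<otimes>\<^bsub>B\<^esub> W w j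
      = (adj B (W v i) \<otimes>\<^bsub>B\<^esub> W v' i') \<otimes>\<^bsub>B\<^esub> \<theta> a \<otimes>\<^bsub>B\<^esub> (adj B (W w' j') \<otimes>\<^bsub>B\<^esub> W w j)"
    using v w step by (simp add: corner_def B.mult_assoc)
  also have "\<dots> \<in> \<theta> ` carrier A"
  proof (cases "(v = v' \<and> i = i') \<and> (w' = w \<and> j' = j)")
    case True
    then show ?thesis using v w step
      by (intro image_eqI[of _ _ "p v \<otimes>\<^bsub>A\<^esub> a \<otimes>\<^bsub>A\<^esub> p w"]) (simp_all add: B.adj_W_W_eq \<theta>_mult \<theta>_p)
  next
    case False
    then have "(adj B (W v i) \<otimes>\<^bsub>B\<^esub> W v' i') \<otimes>\<^bsub>B\<^esub> \<theta> a \<otimes>\<^bsub>B\<^esub> (adj B (W w' j') \<otimes>\<^bsub>B\<^esub> W w j) = \<zero>\<^bsub>B\<^esub>"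
      using v w step B.adj_W_W_eq[of v v' i i'] B.adj_W_W_eq[of w' w j' j] by auto
    then show ?thesis using cstar_hom_zero[OF cstar_A B.cstar_algebra_axioms \<theta>] A.zero_closed by force
  qed
  finally obtain a'' where a'': "a'' \<in> carrier A" "adj B (W v i) \<otimes>\<^bsub>B\<^esub> corner v' i' a w' j' \<otimes>\<^bsub>B\<^esub> W w j = \<theta> a''" by blast
  have "adj B (W v i) \<otimes>\<^bsub>B\<^esub> (corner v' i' a w' j' \<oplus>\<^bsub>B\<^esub> x) \<otimes>\<^bsub>B\<^esub> W w j = \<theta> a'' \<oplus>\<^bsub>B\<^esub> \<theta> a'"
    using v w step by (simp add: B.distrib_left B.distrib_right corner_span_closed a'(2)[symmetric] a''(2)[symmetric])
  also have "\<dots> = \<theta> (a'' \<oplus>\<^bsub>A\<^esub> a')" using a' a'' by (simp add: cstar_homD(4)[OF \<theta>])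
  finally show ?case using a' a'' by simp
qed

text \<open>Approximating x from the span gives compressions \<theta> (a n). Their images under
  \<phi> tend to 0, and a \<mapsto> \<phi> (\<theta> a) is isometric, so the a n themselves tend to
  0 and the compression of x vanishes.\<close>

lemma compression_zero:
  assumes v: "v \<in> verts G" and w: "w \<in> verts G" and x: "x \<in> carrier B" "\<phi> x = \<zero>\<^bsub>T\<^esub>"
  shows "adj B (W v i) \<otimes>\<^bsub>B\<^esub> x \<otimes>\<^bsub>B\<^esub> W w j = \<zero>\<^bsub>B\<^esub>"
proof -
  let ?c = "\<lambda>x. adj B (W v i) \<otimes>\<^bsub>B\<^esub> x \<otimes>\<^bsub>B\<^esub> W w j"
  obtain X where X: "\<And>n. X n \<in> corner_span" "B.conv X x" using corner_span_approx[OF x(1)] by blast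
  have conv: "B.conv (\<lambda>n. ?c (X n)) (?c x)"
    using v w by (intro B.conv_mult B.conv_const X(2)) simp_all
  have "\<forall>n. \<exists>a\<in>carrier A. ?c (X n) = \<theta> a" using compression_in_range[OF v w X(1)] by blast
  then obtain a where a: "\<And>n. a n \<in> carrier A" "\<And>n. ?c (X n) = \<theta> (a n)" by metis
  have "\<phi> (?c x) = adj T (\<phi> (W v i)) \<otimes>\<^bsub>T\<^esub> \<phi> x \<otimes>\<^bsub>T\<^esub> \<phi> (W w j)"
    using v w x(1) by (simp add: cstar_homD(2,5)[OF \<phi>])
  then have "\<phi> (?c x) = \<zero>\<^bsub>T\<^esub>" using v w x(2) by simp
  then have "T.conv (\<lambda>n. tens_unit (a n) 0 0) \<zero>\<^bsub>T\<^esub>"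
    using cstar_hom_conv[OF B.cstar_algebra_axioms cstar_T \<phi> conv] by (simp add: a \<phi>_\<theta>)
  then have "(\<lambda>n. nrm T (tens_unit (a n) 0 0)) \<longlonglongrightarrow> 0" using T.conv_nrm by fastforce
  then have lim: "(\<lambda>n. nrm A (a n)) \<longlonglongrightarrow> 0" by (simp add: nrm_tens_unit a(1))
  have "B.conv (\<lambda>n. \<theta> (a n)) \<zero>\<^bsub>B\<^esub>"
  proof (rule B.convI[OF _ _ _ lim])
    show "nrm B (\<theta> (a n) \<ominus>\<^bsub>B\<^esub> \<zero>\<^bsub>B\<^esub>) \<le> nrm A (a n)" for n
      using cstar_hom_contractive[OF cstar_A B.cstar_algebra_axioms \<theta> a(1)] a(1) by simp
  qed (simp_all add: a(1))
  then show ?thesis using conv B.conv_unique by (simp add: a(2))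
qed

lemma \<phi>_eq_zero:
  assumes x: "x \<in> carrier B" "\<phi> x = \<zero>\<^bsub>T\<^esub>" shows "x = \<zero>\<^bsub>B\<^esub>"
proof -
  have corner: "corner v i a w j \<otimes>\<^bsub>B\<^esub> x \<otimes>\<^bsub>B\<^esub> z = \<zero>\<^bsub>B\<^esub>"
    if vw: "v \<in> verts G" "w \<in> verts G" "a \<in> carrier A" and z: "z \<in> corner_span" for v i a w j z
    using z
  proof (induction rule: corner_span.induct)
    case (step v' w' a' y i' j')
    have "corner v i a w j \<otimes>\<^bsub>B\<^esub> x \<otimes>\<^bsub>B\<^esub> corner v' i' a' w' j'
        = W v i \<otimes>\<^bsub>B\<^esub> \<theta> a \<otimes>\<^bsub>B\<^esub> ((adj B (W w j) \<otimes>\<^bsub>B\<^esub> x \<otimes>\<^bsub>B\<^esub> W v' i') \<otimes>\<^bsub>B\<^esub> (\<theta> a' \<otimes>\<^bsub>B\<^esub> adj B (W w' j')))"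
      using vw step x(1) by (simp add: corner_def B.mult_assoc)
    also have "\<dots> = \<zero>\<^bsub>B\<^esub>"
      unfolding compression_zero[OF vw(2) step(1) x] using vw step by simp
    finally show ?case
      using step vw x(1) by (simp add: B.distrib_left corner_span_closed)
  qed (use vw x(1) in simp)
  have span: "y \<otimes>\<^bsub>B\<^esub> x \<otimes>\<^bsub>B\<^esub> z = \<zero>\<^bsub>B\<^esub>" if "y \<in> corner_span" and z: "z \<in> corner_span" for y z
    using that(1)
  proof (induction rule: corner_span.induct)
    case (step v w a y i j)
    then show ?case
      using corner[OF step(1-3) z] x(1) z by (simp add: B.distrib_right corner_span_closed)
  qed (use x(1) corner_span_closed[OF z] in simp)
  have xa: "adj B x \<in> carrier B" using x(1) by simp
  \<comment> \<open>Approximating the adjoint of x on both sides takes the place of an approximate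
    unit: the limit adj x x adj x is 0, and multiplying by x shows that the self-adjoint x adj x has
    square 0.\<close>
  obtain X where X: "\<And>n. X n \<in> corner_span" "B.conv X (adj B x)" using corner_span_approx[OF xa] by blast
  have "B.conv (\<lambda>n. X n \<otimes>\<^bsub>B\<^esub> x \<otimes>\<^bsub>B\<^esub> X n) (adj B x \<otimes>\<^bsub>B\<^esub> x \<otimes>\<^bsub>B\<^esub> adj B x)"
    by (intro B.conv_mult B.conv_const X(2) x(1))
  then have "adj B x \<otimes>\<^bsub>B\<^esub> x \<otimes>\<^bsub>B\<^esub> adj B x = \<zero>\<^bsub>B\<^esub>"
    using B.conv_unique[OF _ B.conv_const[OF B.zero_closed]] by (simp add: span[OF X(1) X(1)])
  then have "x \<otimes>\<^bsub>B\<^esub> (adj B x \<otimes>\<^bsub>B\<^esub> x \<otimes>\<^bsub>B\<^esub> adj B x) = \<zero>\<^bsub>B\<^esub>" using x(1) by simp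
  then have "adj B (x \<otimes>\<^bsub>B\<^esub> adj B x) \<otimes>\<^bsub>B\<^esub> (x \<otimes>\<^bsub>B\<^esub> adj B x) = \<zero>\<^bsub>B\<^esub>"
    using x(1) by (simp add: B.adj_mult B.adj_adj B.mult_assoc)
  then have "x \<otimes>\<^bsub>B\<^esub> adj B x = \<zero>\<^bsub>B\<^esub>" by (rule B.mult_adj_eq_zero[rotated]) (use x(1) in simp)
  then have "adj B (adj B x) \<otimes>\<^bsub>B\<^esub> adj B x = \<zero>\<^bsub>B\<^esub>" using x(1) by (simp add: B.adj_adj)
  then have "adj B x = \<zero>\<^bsub>B\<^esub>" by (rule B.mult_adj_eq_zero[rotated]) (use x(1) in simp)
  then show ?thesis using B.adj_adj[OF x(1)] by simp
qed

lemma inj_\<phi>: "inj_on \<phi> (carrier B)"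
proof (rule inj_onI)
  fix x y assume xy: "x \<in> carrier B" "y \<in> carrier B" "\<phi> x = \<phi> y"
  have "\<phi> (x \<ominus>\<^bsub>B\<^esub> y) = \<zero>\<^bsub>T\<^esub>"
    using xy cstar_hom_diff[OF B.cstar_algebra_axioms cstar_T \<phi> xy(1,2)] by (simp add: T.minus_eq_zero_iff)
  then have "x \<ominus>\<^bsub>B\<^esub> y = \<zero>\<^bsub>B\<^esub>" using xy by (intro \<phi>_eq_zero) simp_all
  then show "x = y" using xy by (simp add: B.minus_eq_zero_iff)
qed

section \<open>Surjectivity\<close>

lemma range_\<phi>: "cstar_subalgebra (\<phi> ` carrier B) T"
  by (rule cstar_subalgebra_range[OF B.cstar_algebra_axioms cstar_T \<phi> inj_\<phi>])

lemma range_\<phi>D: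
  "x \<in> \<phi> ` carrier B \<Longrightarrow> y \<in> \<phi> ` carrier B \<Longrightarrow> x \<oplus>\<^bsub>T\<^esub> y \<in> \<phi> ` carrier B"
  "x \<in> \<phi> ` carrier B \<Longrightarrow> y \<in> \<phi> ` carrier B \<Longrightarrow> x \<otimes>\<^bsub>T\<^esub> y \<in> \<phi> ` carrier B"
  "x \<in> \<phi> ` carrier B \<Longrightarrow> adj T x \<in> \<phi> ` carrier B"
  "x \<in> \<phi> ` carrier B \<Longrightarrow> smul T c x \<in> \<phi> ` carrier B"
  "\<zero>\<^bsub>T\<^esub> \<in> \<phi> ` carrier B" "closedin (norm_topology T) (\<phi> ` carrier B)"
  using range_\<phi> unfolding cstar_subalgebra_def by blast+

text \<open>All index pairs are treated at once so that the admissible a form an algebra: xy at (i,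
  j) is x at (i, i) times y at (i, j), and the adjoint exchanges the indices. Only the generators of
  C*(G) remain to be checked.\<close>

lemma tens_unit_in_range:
  assumes "a \<in> carrier A" shows "tens_unit a i j \<in> \<phi> ` carrier B"
proof -
  let ?R = "\<phi> ` carrier B" and ?S = "{a \<in> carrier A. \<forall>i j. tens_unit a i j \<in> \<phi> ` carrier B}"
  \<comment> \<open>\<phi> sends W at i to p v at (i, 0), so W at i times the adjoint of W at j goes
    to p v at (i, j).\<close>
  have p: "tens_unit (p v) i j \<in> ?R" if v: "v \<in> verts G" for v i j
  proof -
    have "\<phi> (W v i \<otimes>\<^bsub>B\<^esub> adj B (W v j)) = tens_unit (p v) i j"
      using v by (simp add: cstar_homD(2,5)[OF \<phi>] \<phi>_W tens_unit_adj tens_unit_mult pD)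
    then show ?thesis using v by (metis B.W_closed B.adj_closed B.mult_closed imageI)
  qed
  have "cstar_subalgebra ?S A"
  proof (rule A.cstar_subalgebraI)
    fix x y assume x: "x \<in> ?S" and y: "y \<in> ?S"
    have "tens_unit (x \<oplus>\<^bsub>A\<^esub> y) i j = tens_unit x i j \<oplus>\<^bsub>T\<^esub> tens_unit y i j" for i j
      using x y by (simp add: tens_unit_def tens_add_left)
    then show "x \<oplus>\<^bsub>A\<^esub> y \<in> ?S" using x y range_\<phi>D(1) by simp
    have "tens_unit (x \<otimes>\<^bsub>A\<^esub> y) i j = tens_unit x i i \<otimes>\<^bsub>T\<^esub> tens_unit y i j" for i j
      using x y by (simp add: tens_unit_mult)
    then show "x \<otimes>\<^bsub>A\<^esub> y \<in> ?S" using x y range_\<phi>D(2) by simp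
  next
    fix x assume x: "x \<in> ?S"
    have "tens_unit (adj A x) i j = adj T (tens_unit x j i)" for i j
      using x by (simp add: tens_unit_adj)
    then show "adj A x \<in> ?S" using x range_\<phi>D(3) by simp
    have "tens_unit (smul A c x) i j = smul T c (tens_unit x i j)" for c i j
      using x by (simp add: tens_unit_def tens_smul_left)
    then show "smul A c x \<in> ?S" for c using x range_\<phi>D(4) by simp
  next
    fix X l assume X: "\<And>n. X n \<in> ?S" "A.conv X l"
    have "tens_unit l i j \<in> ?R" for i j
    proof (rule T.closed_conv[OF range_\<phi>D(6)])
      have "projection K (adj K (matrix_unit i j) \<otimes>\<^bsub>K\<^esub> matrix_unit i j)"
        using projection_matrix_unit[of j] by (simp add: matrix_unit_mult)
      then show "T.conv (\<lambda>n. tens_unit (X n) i j) (tens_unit l i j)"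
        unfolding tens_unit_def by (intro tens_partial_isometry_conv X(2)) simp_all
      show "tens_unit (X n) i j \<in> ?R" for n using X(1)[of n] by simp
    qed
    then show "l \<in> ?S" using A.conv_carrier(2)[OF X(2)] by simp
  qed (use range_\<phi>D(5) in auto)
  moreover have "p ` verts G \<union> s ` arcs G \<subseteq> ?S"
  proof (intro Un_least image_subsetI)
    show "p v \<in> ?S" if "v \<in> verts G" for v using that p by simp
    fix e assume e: "e \<in> arcs G"
    note ht = tail_in_verts[OF e] head_in_verts[OF e]
    note eq = CK_family_edge[OF cstar_A wf_digraph_axioms CK_A e]
    have "\<phi> (S (Inl e)) = tens_unit (s e) 0 0" using e \<phi>_S[of "Inl e"] by simp
    moreover have "S (Inl e) \<in> carrier B" using e B.CKD(5)[of "Inl e"] by simp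
    ultimately have s0: "tens_unit (s e) 0 0 \<in> ?R" by (metis imageI)
    \<comment> \<open>Since s = p s p, factors p at (i, 0) and (0, j) move s from index (0, 0) to
      (i, j).\<close>
    have "tens_unit (s e) i j \<in> ?R" for i j
    proof -
      have "tens_unit (s e) i j = tens_unit (p (tail G e)) i 0 \<otimes>\<^bsub>T\<^esub> tens_unit (s e) 0 0 \<otimes>\<^bsub>T\<^esub> tens_unit (p (head G e)) 0 j"
        using e ht by (simp add: tens_unit_mult eq)
      then show ?thesis using range_\<phi>D(2)[OF range_\<phi>D(2)[OF p[OF ht(1)] s0] p[OF ht(2)]] by simp
    qed
    then show "s e \<in> ?S" using e by simp
  qed
  ultimately show ?thesis using cstar_generated_subset[of ?S A] gen_A assms by blast
qed

text \<open>For k truncated on both sides the claim reduces to matrix units. The truncations are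
  then removed one at a time, the right one first, because each continuity statement concerns one
  side.\<close>

lemma tens_in_range:
  assumes a: "a \<in> carrier A" and k: "k \<in> carrier K" shows "tens a k \<in> \<phi> ` carrier B"
proof -
  let ?R = "\<phi> ` carrier B"
  note tr = trunc_closed[OF cstar_D] and tr1 = onorm_trunc_le[folded compact_operators_simps(7)]
  have E: "matrix_unit i j \<in> carrier K" for i j by simp
  have Suc: "trunc (Suc n) = trunc n \<oplus>\<^bsub>K\<^esub> matrix_unit n n" for n by (simp add: trunc_Suc)
  have zero: "trunc 0 = \<zero>\<^bsub>K\<^esub>" by (simp add: trunc_0)
  have kE: "matrix_unit i i \<otimes>\<^bsub>K\<^esub> k \<in> carrier K" for i by (rule D.mult_closed[OF E k])
  have 1: "tens a (matrix_unit i i \<otimes>\<^bsub>K\<^esub> k \<otimes>\<^bsub>K\<^esub> trunc m) \<in> ?R" for i m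
  proof (induction m)
    case 0
    then show ?case unfolding zero D.mult_zero_right[OF kE] tens_zero_right[OF a] by (rule range_\<phi>D(5))
  next
    case (Suc m)
    have "matrix_unit i i \<otimes>\<^bsub>K\<^esub> k \<otimes>\<^bsub>K\<^esub> matrix_unit m m = smul K (cinner (k (b m)) (b i)) (matrix_unit i m)"
      using matrix_unit_compression[of k i m] k by (simp add: compact_operator_def)
    then have "tens a (matrix_unit i i \<otimes>\<^bsub>K\<^esub> k \<otimes>\<^bsub>K\<^esub> matrix_unit m m) \<in> ?R"
      using range_\<phi>D(4)[OF tens_unit_in_range[OF a]] by (simp only: tens_smul_right[OF a E] tens_unit_def[symmetric])
    then show ?case
      using Suc.IH range_\<phi>D(1)
      by (simp only: \<open>\<And>n. trunc (Suc n) = _\<close> D.distrib_left[OF tr E kE] tens_add_right[OF a D.mult_closed[OF kE tr] D.mult_closed[OF kE E]])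
  qed
  have 2: "tens a (trunc n \<otimes>\<^bsub>K\<^esub> k \<otimes>\<^bsub>K\<^esub> trunc m) \<in> ?R" for n m
  proof (induction n)
    case 0
    show ?case unfolding zero D.mult_zero_left[OF k] D.mult_zero_left[OF tr] tens_zero_right[OF a]
      by (rule range_\<phi>D(5))
  next
    case (Suc n)
    have tk: "trunc n \<otimes>\<^bsub>K\<^esub> k \<in> carrier K" by (rule D.mult_closed[OF tr k])
    show ?case
      using Suc.IH 1 range_\<phi>D(1)
      by (simp only: \<open>\<And>n. trunc (Suc n) = _\<close> D.distrib_right[OF tr E k] D.distrib_right[OF tk kE tr]
          tens_add_right[OF a D.mult_closed[OF tk tr] D.mult_closed[OF kE tr]])
  qed
  have 3: "tens a (trunc n \<otimes>\<^bsub>K\<^esub> k) \<in> ?R" for n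
  proof (rule T.closed_conv[OF range_\<phi>D(6) 2])
    have tk: "trunc n \<otimes>\<^bsub>K\<^esub> k \<in> carrier K" by (rule D.mult_closed[OF tr k])
    show "T.conv (\<lambda>m. tens a (trunc n \<otimes>\<^bsub>K\<^esub> k \<otimes>\<^bsub>K\<^esub> trunc m)) (tens a (trunc n \<otimes>\<^bsub>K\<^esub> k))"
      by (rule tens_conv_right[OF a tk tr tr1 trunc_conv_right[OF cstar_D tk]])
  qed
  show ?thesis
    by (rule T.closed_conv[OF range_\<phi>D(6) 3 tens_conv_left[OF a k tr tr1 trunc_conv_left[OF cstar_D k]]])
qed

lemma surj_\<phi>: "\<phi> ` carrier B = carrier T"
proof
  show "\<phi> ` carrier B \<subseteq> carrier T" by auto
  let ?S = "{x. \<exists>(n::nat) as ds. (\<forall>i<n. as i \<in> carrier A \<and> ds i \<in> carrier K) \<and>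
             x = (\<Oplus>\<^bsub>T\<^esub> i\<in>{..<n}. tens (as i) (ds i))}"
  have "?S \<subseteq> \<phi> ` carrier B"
    by (auto simp del: compact_operators_simps intro!: T.finsum_in_subalgebra[OF range_\<phi>] tens_in_range)
  then have "Abstract_Topology.closure_of (norm_topology T) ?S \<subseteq> \<phi> ` carrier B"
    using range_\<phi>D(6) by (rule closure_of_minimal)
  then show "carrier T \<subseteq> \<phi> ` carrier B" unfolding tens_dense .
qed

end

theorem theorem4p2:
  fixes G :: "('v, 'e) pre_digraph"
    and A :: "'a cstar" and B :: "'b cstar" and T :: "'t cstar"
  assumes "wf_digraph G" and "countable (verts G)" and "countable (arcs G)"
    and "is_graph_algebra G A"
    and "is_graph_algebra (add_heads G) B"
    and "separable_space (euclidean :: 'h::complex_hilbert topology)"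
    and "infinite_dimensional TYPE('h)"
    and "is_stabilization TYPE('h) A T"
  shows "B \<cong>\<^sup>* T"
proof -
  obtain p s where A: "cstar_algebra A" "universal_CK_family G A p s"
    using assms(4) by (auto simp: is_graph_algebra_def)
  obtain P S where B: "cstar_algebra B" "universal_CK_family (add_heads G) B P S"
    using assms(5) by (auto simp: is_graph_algebra_def)
  obtain tens where tens: "cstar_tensor_product A (compact_operators :: ('h \<Rightarrow> 'h) cstar) T tens"
    using assms(8) by (auto simp: is_stabilization_def)
  obtain b :: "nat \<Rightarrow> 'h" where b: "\<And>i j. cinner (b i) (b j) = (if i = j then 1 else 0)"
    "\<And>x. (\<lambda>n. residual (b ` {..<n}) x) \<longlonglongrightarrow> 0"
    using exists_orthonormal_basis[OF assms(6,7)] by blast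
  have CK_A: "CK_family G A p s" and CK_B: "CK_family (add_heads G) B P S"
    using A(2) B(2) by (simp_all add: universal_CK_family_def)
  interpret stabilized_graph_algebra G b A T tens p s
    by (intro stabilized_graph_algebra.intro orthonormal_basis.intro stabilized_graph_algebra_axioms.intro
        assms(1) b tens CK_A)
  obtain \<theta> where \<theta>: "\<theta> \<in> cstar_hom A B" "\<forall>v\<in>verts G. \<theta> (p v) = (P \<circ> Inl) v" "\<forall>e\<in>arcs G. \<theta> (s e) = (S \<circ> Inl) e"
    using universal_CK_family_hom[OF assms(1-3) A(2) B(1) CK_family_restrict[OF B(1) CK_B]] by blast
  have "countable (verts (add_heads G))" "countable (arcs (add_heads G))"
    using assms(2,3) by auto
  then obtain \<phi> where \<phi>: "\<phi> \<in> cstar_hom B T" "\<forall>x\<in>verts (add_heads G). \<phi> (P x) = stable_p x"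
    "\<forall>x\<in>arcs (add_heads G). \<phi> (S x) = stable_s x"
    using universal_CK_family_hom[OF wf_add_heads[OF assms(1)] _ _ B(2) cstar_T CK_family_stable] by blast
  interpret stabilized_graph_algebras G b A T tens p s B P S \<theta> \<phi>
  proof (intro stabilized_graph_algebras.intro stabilized_graph_algebra_axioms CK_add_heads.intro
      CK_add_heads_axioms.intro stabilized_graph_algebras_axioms.intro)
    show "cstar_generated A (p ` verts G \<union> s ` arcs G) = carrier A"
      "cstar_generated B (P ` verts (add_heads G) \<union> S ` arcs (add_heads G)) = carrier B"
      using A(2) B(2) by (simp_all only: universal_CK_family_def)
  qed (use B(1) CK_B assms(1) \<theta> \<phi> in auto)
  show ?thesis
    unfolding cstar_isomorphic_def bij_betw_def using \<phi> inj_\<phi> surj_\<phi> by blast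
qed

end
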